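(* Let $c\geq 2$ be an odd integer and let $0\leq a<c$ be an integer. Then \[ \overline{N}_2(a,c,n)\sim \frac{1}{c}\,\overline{p}(n)\sim \frac{1}{8cn}e^{\pi\sqrt{n}}\qquad\text{as } n\to\infty . \]
   Context: An overpartition of a nonnegative integer $n$ is a partition of $n$ (a non-increasing sequence of positive integers summing to $n$) in which the first occurrence of each distinct part may be overlined. $\overline{p}(n)$ denotes the number of overpartitions of $n$. For an overpartition $\lambda$, let $l(\lambda)$ be its largest part, $n(\lambda)$ its number of parts, and $n(\lambda_o)$ its number of odd non-overlined parts; let $\chi(\lambda)=1$ if the largest part $l(\lambda)$ is odd and non-overlined, and $\chi(\lambda)=0$ otherwise. The $M_2$-rank of $\lambda$ is $\lceil l(\lambda)/2\rceil-n(\lambda)-n(\lambda_o)-\chi(\lambda)$. $\overline{N}_2(a,c,n)$ denotes the number of overpartitions of $n$ whose $M_2$-rank is congruent to $a$ modulo $c$. The notation $f(n)\sim g(n)$ means $f(n)/g(n)\to 1$. *)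

theory Defs
  imports Complex_Main "HOL-Library.Landau_Symbols" "HOL-Number_Theory.Cong"
begin

text \<open>
  An overpartition is the list of its parts in non-increasing order, each part paired with a flag
  that says whether it is overlined. Only the first occurrence of a part may carry the flag.
\<close>

type_synonym overpartition = "(nat \<times> bool) list"

definition overpartitions :: "nat \<Rightarrow> overpartition set" where
  "overpartitions n = {xs.
     sorted_wrt (\<ge>) (map fst xs) \<and>
     (\<forall>x\<in>set xs. 0 < fst x) \<and>
     sum_list (map fst xs) = n \<and>
     (\<forall>i<length xs. snd (xs ! i) \<longrightarrow> (\<forall>j<i. fst (xs ! j) \<noteq> fst (xs ! i)))}"

definition overpartition_count :: "nat \<Rightarrow> nat" where
  "overpartition_count n = card (overpartitions n)"

text \<open>The largest part is the head of the list; the empty overpartition gets largest part 0.\<close>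

definition largest_part :: "overpartition \<Rightarrow> nat" where
  "largest_part xs = (if xs = [] then 0 else fst (hd xs))"

definition num_odd_nonoverlined :: "overpartition \<Rightarrow> nat" where
  "num_odd_nonoverlined xs = length (filter (\<lambda>(k, b). odd k \<and> \<not> b) xs)"

text \<open>
  If the largest part is repeated, it counts as overlined when its first occurrence (the head of
  the list) is overlined.
\<close>

definition chi :: "overpartition \<Rightarrow> nat" where
  "chi xs = (if xs \<noteq> [] \<and> odd (fst (hd xs)) \<and> \<not> snd (hd xs) then 1 else 0)"

definition M2_rank :: "overpartition \<Rightarrow> int" where
  "M2_rank xs = \<lceil>real (largest_part xs) / 2\<rceil> - int (length xs)
     - int (num_odd_nonoverlined xs) - int (chi xs)"

definition N2_count :: "int \<Rightarrow> int \<Rightarrow> nat \<Rightarrow> nat" where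
  "N2_count a c n = card {xs \<in> overpartitions n. [M2_rank xs = a] (mod c)}"

lemma finite_overpartitions: "finite (overpartitions n)"
proof (rule finite_subset)
  show "overpartitions n \<subseteq> {xs. set xs \<subseteq> {..n} \<times> UNIV \<and> length xs \<le> n}"
  proof
    fix xs assume "xs \<in> overpartitions n"
    then have pos: "\<forall>x\<in>set xs. 0 < fst x" and sum: "sum_list (map fst xs) = n"
      by (auto simp: overpartitions_def)
    have "fst x \<le> n" if "x \<in> set xs" for x
      using that sum member_le_sum_list[of "fst x" "map fst xs"] by auto
    moreover have "length xs \<le> sum_list (map fst xs)"
      using pos by (induction xs) auto
    ultimately show "xs \<in> {xs. set xs \<subseteq> {..n} \<times> UNIV \<and> length xs \<le> n}"
      using sum by auto
  qed
qed (simp add: finite_lists_length_le)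

end

theory Submission
  imports Defs "HOL-Probability.Probability" "HOL-Complex_Analysis.Complex_Analysis" "HOL-Real_Asymp.Real_Asymp"
begin

text \<open>
  The generating function of overpartitions is the product of (1 + q^k) / (1 - q^k). Its logarithm
  at q = exp (-t) is f t = (\<Sum>N. c N * exp (-N t)), where c N is the sum of 2 / j over the odd
  divisors j of N. The alternating sum f t - 2 f (2 t) is evaluated up to o(1) by a q-analogue of
  Wallis' product, and since t f t tends to pi^2 / 4 this determines
  f t = pi^2 / (4 t) + ln (t / (4 pi)) / 2 + o(1). The saddle point method at t = pi / (2 sqrt n),
  with Cauchy's integral rescaled by t^(3/2) and dominated convergence, yields the asymptotics of
  the number of overpartitions.

  For the equidistribution, toggling the overline on the first occurrence of an odd part other than
  the largest changes the rank by one. Hence in the exponential sum of zeta^rank, for a root of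
  unity zeta \<noteq> 1, every odd part size contributes a factor |1 + zeta| / 2 < 1. An overpartition
  typically has many distinct odd part sizes, so at the saddle point this sum is smaller than the
  number of overpartitions by a factor exp (- \<delta> sqrt n).
\<close>

section \<open>The logarithm of the generating function\<close>

text \<open>The product is the eta quotient eta(2 tau) / eta(tau)^2, whose behaviour at q = 1 is
  usually read off a modular transformation. Here f t is wanted only up to o(1) and only for real t,
  and f t - 2 f (2 t) supplies it: this combination annihilates every multiple of 1/t, and its terms
  near t = 0 are logarithms of Wallis' factors. The multiple of 1/t that it cannot see is fixed by
  the crude limit of t f t.

  The point pi / (2 sqrt n) balances the leading term pi^2 / (4 t) of f t against n t; both equal pi
  sqrt n / 2. The second derivative of f has order t^(-3), hence the Gaussian width t^(3/2).

  The obstacle for the rank is the largest part, which enters through a ceiling and through chi, so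
  that the exponential sum is not a product. For a fixed block of copies of the largest part the
  rank is a constant minus a statistic of the smaller parts, and that statistic does factor. The
  block costs no more than the constant 1 / \<gamma> with \<gamma> = |1 + zeta| / 2. The gain is
  exponential in sqrt n, so a bound by the whole positive series replaces a second saddle point
  analysis.\<close>

definition log_coeff :: "nat \<Rightarrow> real" where
  "log_coeff N = (\<Sum>j | odd j \<and> j dvd N. 2 / real j)"

text \<open>Every odd j divides 0, so the defining sum ranges over an infinite set and takes the
  default value 0. The index 0 thereby drops out of all series in \<open>log_coeff\<close>.\<close>

lemma log_coeff_0 [simp]: "log_coeff 0 = 0"
proof -
  have "range (\<lambda>i. 2 * i + 1 :: nat) \<subseteq> {j. odd j}"
    by auto
  moreover have "infinite (range (\<lambda>i. 2 * i + 1 :: nat))"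
    by (intro range_inj_infinite) (auto simp: inj_on_def)
  ultimately have "infinite {j::nat. odd j}"
    using finite_subset by blast
  then show ?thesis
    by (simp add: log_coeff_def)
qed

lemma log_coeff_nonneg: "log_coeff N \<ge> 0"
  unfolding log_coeff_def by (intro sum_nonneg) auto

text \<open>The divisor j = 1 alone contributes 2. In \<open>gf_re_ge\<close> this compares the
  logarithm with twice a geometric series.\<close>

lemma log_coeff_ge_2:
  assumes "N > 0"
  shows "log_coeff N \<ge> 2"
proof -
  have "finite {j. odd j \<and> j dvd N}"
    using assms by (auto intro: finite_subset[OF _ finite_divisors_nat[OF assms]])
  then have "(\<Sum>j\<in>{1}. 2 / real j) \<le> log_coeff N"
    unfolding log_coeff_def by (intro sum_mono2) auto
  then show ?thesis by simp
qed

text \<open>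
  The coefficients come from expanding ln ((1 + q^k) / (1 - q^k)) as the sum of 2 q^(jk) / j over
  odd j; the two conclusions are the two orders of summation over j and k.
\<close>

lemma sums_log_coeff:
  fixes a :: "nat \<Rightarrow> real"
  assumes nonneg: "\<And>N. a N \<ge> 0"
    and inner: "\<And>i. (\<lambda>l. a ((2*i+1) * Suc l)) sums A i"
    and outer: "(\<lambda>i. 2 / real (2*i+1) * A i) sums S"
  shows "(\<lambda>N. log_coeff N * a N) sums S"
    and "(\<And>l. (\<lambda>i. 2 / real (2*i+1) * a ((2*i+1) * Suc l)) sums B l) \<Longrightarrow> B sums S"
proof -
  define h where "h = (\<lambda>(i, l). 2 / real (2*i+1) * a ((2*i+1) * Suc l))"
  have h_nonneg: "h p \<ge> 0" for p
    by (auto simp: h_def nonneg split: prod.splits)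
  have A_nonneg: "A i \<ge> 0" for i
    by (rule sums_le[OF _ sums_zero inner]) (rule nonneg)
  have inner': "((\<lambda>l. h (i, l)) has_sum (2 / real (2*i+1) * A i)) UNIV" for i
    unfolding h_def prod.case
    by (intro has_sum_cmult_right sums_nonneg_imp_has_sum inner nonneg)
  have outer': "((\<lambda>i. 2 / real (2*i+1) * A i) has_sum S) UNIV"
    by (intro sums_nonneg_imp_has_sum outer) (auto simp: A_nonneg)
  have "h summable_on (UNIV \<times> UNIV)"
    by (rule summable_on_SigmaI[OF inner']) (use outer' h_nonneg in \<open>auto simp: summable_on_def\<close>)
  then have hS: "(h has_sum S) (UNIV \<times> UNIV)"
    by (intro has_sum_SigmaI[OF inner' outer']) auto
  show "B sums S" if B: "\<And>l. (\<lambda>i. 2 / real (2*i+1) * a ((2*i+1) * Suc l)) sums B l"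
  proof -
    have "((\<lambda>(l, i). h (i, l)) has_sum S) (UNIV \<times> UNIV)"
      using hS by (subst (asm) has_sum_swap) simp
    moreover have "((\<lambda>i. (\<lambda>(l, i). h (i, l)) (l, i)) has_sum B l) UNIV" for l
      unfolding h_def prod.case by (intro sums_nonneg_imp_has_sum B) (auto simp: nonneg)
    ultimately have "(B has_sum S) UNIV"
      by (rule has_sum_SigmaD)
    then show ?thesis by (rule has_sum_imp_sums)
  qed
  \<comment> \<open>Writing j = 2 i + 1 and N = j (l + 1) identifies T with all pairs (i, l). N = 0
    has to stay outside, since its fibre would be infinite; its term is 0 anyway.\<close>
  define T where "T = Sigma {1..} (\<lambda>N::nat. {j. odd j \<and> j dvd N})"
  have "((\<lambda>(N, j). 2 / real j * a N) has_sum S) T \<longleftrightarrow> (h has_sum S) (UNIV \<times> UNIV)"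
  proof (rule has_sum_reindex_bij_witness[where
        i = "\<lambda>(i, l). ((2*i+1) * Suc l, 2*i+1)" and j = "\<lambda>(N, j). ((j - 1) div 2, N div j - 1)"])
    fix p assume "p \<in> T"
    then obtain N j where Nj: "p = (N, j)" "N > 0" "odd j" "j dvd N"
      by (cases p) (auto simp: T_def)
    obtain i where "j = 2 * i + 1" using \<open>odd j\<close> by (rule oddE)
    moreover obtain l where "N = j * l" using \<open>j dvd N\<close> by (rule dvdE)
    moreover from this Nj obtain l' where "l = Suc l'" by (cases l) auto
    ultimately have p: "p = (N, j)" "j = 2 * i + 1" "N = (2 * i + 1) * Suc l'"
      using Nj by simp_all
    moreover have "(2 * i + 1) * Suc l' div (2 * i + 1) = Suc l'"
      by (rule nonzero_mult_div_cancel_left) auto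
    ultimately show "(\<lambda>(i, l). ((2*i+1) * Suc l, 2*i+1)) ((\<lambda>(N, j). ((j - 1) div 2, N div j - 1)) p) = p"
      "h ((\<lambda>(N, j). ((j - 1) div 2, N div j - 1)) p) = (\<lambda>(N, j). 2 / real j * a N) p"
      by (simp_all add: h_def del: mult_Suc_right mult_Suc)
  next
    fix p :: "nat \<times> nat"
    obtain i l where p: "p = (i, l)" by (cases p)
    have "(2 * i + 1) * Suc l div (2 * i + 1) = Suc l"
      by (rule nonzero_mult_div_cancel_left) auto
    then show "(\<lambda>(N, j). ((j - 1) div 2, N div j - 1)) ((\<lambda>(i, l). ((2*i+1) * Suc l, 2*i+1)) p) = p"
      by (simp add: p del: mult_Suc_right)
    show "(\<lambda>(i, l). ((2*i+1) * Suc l, 2*i+1)) p \<in> T"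
      by (simp add: T_def p del: mult_Suc_right mult_Suc)
  qed auto
  with hS have hT: "((\<lambda>(N, j). 2 / real j * a N) has_sum S) T" by simp
  have "((\<lambda>N. log_coeff N * a N) has_sum S) {1..}"
  proof (rule has_sum_SigmaD[OF hT[unfolded T_def]])
    fix N :: nat assume "N \<in> {1..}"
    then have "finite {j. odd j \<and> j dvd N}"
      by (auto intro: finite_subset[OF _ finite_divisors_nat])
    then have "((\<lambda>j. 2 / real j * a N) has_sum (\<Sum>j | odd j \<and> j dvd N. 2 / real j * a N)) {j. odd j \<and> j dvd N}"
      by (rule has_sum_finite)
    then show "((\<lambda>j. case (N, j) of (N, j) \<Rightarrow> 2 / real j * a N) has_sum log_coeff N * a N) {j. odd j \<and> j dvd N}"
      by (simp add: log_coeff_def sum_distrib_right)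
  qed
  then have "((\<lambda>N. log_coeff N * a N) has_sum S) UNIV"
    by (rule has_sum_cong_neutral[THEN iffD1, rotated -1]) (auto simp: not_le)
  then show "(\<lambda>N. log_coeff N * a N) sums S"
    by (rule has_sum_imp_sums)
qed

section \<open>Series weighted by inverse odd squares\<close>

lemma sums_inverse_odd_squares: "(\<lambda>i. 1 / (2 * real i + 1)\<^sup>2) sums (pi\<^sup>2 / 8)"
proof -
  have "(\<lambda>n. \<Sum>k\<in>{n*2..<n*2+2}. 1 / (real k + 1)\<^sup>2) sums (pi\<^sup>2 / 6)"
    using sums_group[OF inverse_squares_sums, of 2] by (simp add: add.commute)
  then have "(\<lambda>n. 1 / (2 * real n + 1)\<^sup>2 + 1 / (2 * real n + 2)\<^sup>2) sums (pi\<^sup>2 / 6)"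
    by (simp add: numeral_2_eq_2 mult.commute add_ac)
  moreover have "(\<lambda>n. 1/4 * (1 / (real n + 1)\<^sup>2)) sums (1/4 * (pi\<^sup>2 / 6))"
    using inverse_squares_sums by (intro sums_mult) (simp add: add.commute)
  then have "(\<lambda>n. 1 / (2 * real n + 2)\<^sup>2) sums (pi\<^sup>2 / 24)"
  proof -
    have "1/4 * (1 / (real n + 1)\<^sup>2) = 1 / (2 * real n + 2)\<^sup>2" for n
      by (simp add: field_simps power2_eq_square)
    with \<open>(\<lambda>n. 1/4 * (1 / (real n + 1)\<^sup>2)) sums (1/4 * (pi\<^sup>2 / 6))\<close> show ?thesis by simp
  qed
  ultimately have "(\<lambda>n. (1 / (2 * real n + 1)\<^sup>2 + 1 / (2 * real n + 2)\<^sup>2) - 1 / (2 * real n + 2)\<^sup>2)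
      sums (pi\<^sup>2 / 6 - pi\<^sup>2 / 24)"
    by (rule sums_diff)
  then show ?thesis by simp
qed

text \<open>The weights 2 / j^2 over odd j are summable with total pi^2 / 4, so boundedness of the
  profile allows the limit to be taken term by term (Tannery).\<close>

lemma tendsto_odd_square_sum:
  fixes \<phi> :: "real \<Rightarrow> real"
  assumes lim: "(\<phi> \<longlongrightarrow> L) (at_right 0)"
    and bound: "\<And>u. u > 0 \<Longrightarrow> \<bar>\<phi> u\<bar> \<le> M"
  shows "((\<lambda>t. \<Sum>i. 2 / (2 * real i + 1)\<^sup>2 * \<phi> ((2 * real i + 1) * t)) \<longlongrightarrow> L * pi\<^sup>2 / 4) (at_right 0)"
proof -
  have sum2: "(\<lambda>i. K * (2 / (2 * real i + 1)\<^sup>2)) sums (K * (pi\<^sup>2 / 4))" for K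
    using sums_mult[OF sums_inverse_odd_squares, of "2 * K"] by (simp add: field_simps)
  have "((\<lambda>t. \<Sum>i. 2 / (2 * real i + 1)\<^sup>2 * \<phi> ((2 * real i + 1) * t)) \<longlongrightarrow>
         (\<Sum>i. 2 / (2 * real i + 1)\<^sup>2 * L)) (at_right 0)"
  proof (rule tannerys_theorem[where M = "\<lambda>i. M * (2 / (2 * real i + 1)\<^sup>2)", THEN conjunct2, THEN conjunct2])
    fix i
    have "filterlim (\<lambda>t. (2 * real i + 1) * t) (at_right 0) (at_right 0)"
      by real_asymp
    then show "((\<lambda>t. 2 / (2 * real i + 1)\<^sup>2 * \<phi> ((2 * real i + 1) * t)) \<longlongrightarrow> 2 / (2 * real i + 1)\<^sup>2 * L) (at_right 0)"
      by (intro tendsto_intros filterlim_compose[OF lim])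
  next
    have "eventually (\<lambda>t::real. t > 0) (at_right 0)"
      by (rule eventually_at_right_less)
    then have "eventually (\<lambda>p::nat \<times> real. snd p > 0) (at_top \<times>\<^sub>F at_right 0)"
      by (rule eventually_compose_filterlim) (rule filterlim_snd)
    then show "eventually (\<lambda>(i, t). norm (2 / (2 * real i + 1)\<^sup>2 * \<phi> ((2 * real i + 1) * t))
        \<le> M * (2 / (2 * real i + 1)\<^sup>2)) (at_top \<times>\<^sub>F at_right 0)"
    proof eventually_elim
      case (elim x)
      then have "\<bar>\<phi> ((2 * real (fst x) + 1) * snd x)\<bar> \<le> M"
        by (intro bound mult_pos_pos) auto
      then show ?case
        by (auto simp: case_prod_unfold abs_mult mult.commute[of _ M] divide_right_mono intro!: mult_right_mono)
    qed
  qed (use sum2 in \<open>auto simp: sums_iff\<close>)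
  also have "(\<Sum>i. 2 / (2 * real i + 1)\<^sup>2 * L) = L * pi\<^sup>2 / 4"
    using sum2[of L] by (simp add: sums_iff mult.commute)
  finally show ?thesis .
qed

lemma summable_odd_square_sum:
  fixes \<phi> :: "real \<Rightarrow> real"
  assumes bound: "\<And>u. u > 0 \<Longrightarrow> \<bar>\<phi> u\<bar> \<le> M" and "t > 0"
  shows "summable (\<lambda>i. 2 / (2 * real i + 1)\<^sup>2 * \<phi> ((2 * real i + 1) * t))"
proof (rule summable_comparison_test')
  show "summable (\<lambda>i. 1 / (2 * real i + 1)\<^sup>2 * (2 * M))"
    using sums_inverse_odd_squares by (intro summable_mult2) (simp add: sums_iff)
  show "norm (2 / (2 * real i + 1)\<^sup>2 * \<phi> ((2 * real i + 1) * t)) \<le> 1 / (2 * real i + 1)\<^sup>2 * (2 * M)" for i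
  proof -
    have "\<bar>\<phi> ((2 * real i + 1) * t)\<bar> \<le> M"
      using \<open>t > 0\<close> by (intro bound mult_pos_pos) auto
    then have "2 / (2 * real i + 1)\<^sup>2 * \<bar>\<phi> ((2 * real i + 1) * t)\<bar> \<le> 2 / (2 * real i + 1)\<^sup>2 * M"
      by (intro mult_left_mono) auto
    then show ?thesis by (simp add: abs_mult)
  qed
qed

text \<open>
  The profiles of the p-th derivative, p = 0, 1, 2, of the Lambert series: summing first over k,
  t^(p+1) times the derivative becomes the sum of 2 / j^2 times the profile at j t over odd j.
\<close>

definition lambert0 :: "real \<Rightarrow> real" where "lambert0 u = u * exp (-u) / (1 - exp (-u))"
definition lambert1 :: "real \<Rightarrow> real" where "lambert1 u = u\<^sup>2 * exp (-u) / (1 - exp (-u))\<^sup>2"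
definition lambert2 :: "real \<Rightarrow> real" where "lambert2 u = u^3 * exp (-u) * (1 + exp (-u)) / (1 - exp (-u))^3"

section \<open>Bounds for the three profiles\<close>

lemma lambert0_bounds:
  assumes "u > 0"
  shows "0 \<le> lambert0 u" "lambert0 u \<le> 1"
proof -
  have "1 + u \<le> exp u" by (rule exp_ge_add_one_self)
  then show "lambert0 u \<le> 1"
    using assms by (simp add: lambert0_def field_simps exp_minus)
  show "0 \<le> lambert0 u" using assms by (simp add: lambert0_def)
qed

lemma sinh_ge_self:
  assumes "(x::real) \<ge> 0"
  shows "x \<le> sinh x"
proof -
  have "sinh 0 - 0 \<le> sinh x - x"
    by (rule DERIV_nonneg_imp_nondecreasing[OF assms])
      (auto intro!: exI derivative_eq_intros cosh_real_ge_1)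
  then show ?thesis by simp
qed

text \<open>The profile equals ((u/2) / sinh (u/2))^2, which gives the upper bound; the lower one is
  1 - exp (-u) \<le> u. Together they give 0 \<le> 1 - \<open>lambert1 u\<close> \<le> 1 - exp (-u),
  the rate of convergence needed in \<open>log_gf1_approx\<close>.\<close>

lemma lambert1_bounds:
  assumes "u > 0"
  shows "exp (-u) \<le> lambert1 u" "lambert1 u \<le> 1"
proof -
  have pos: "1 - exp (-u) > 0" using assms by simp
  have "1 - exp (-u) \<le> u" using exp_ge_add_one_self[of "-u"] by simp
  then have "(1 - exp (-u))\<^sup>2 \<le> u\<^sup>2" using pos by (intro power_mono) auto
  then show "exp (-u) \<le> lambert1 u"
    using pos by (simp add: lambert1_def pos_le_divide_eq mult.commute)
  have "u / 2 \<le> sinh (u / 2)" using assms by (intro sinh_ge_self) simp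
  then have "u \<le> exp (u/2) - exp (-u/2)" by (simp add: sinh_def)
  then have "u * exp (-u/2) \<le> (exp (u/2) - exp (-u/2)) * exp (-u/2)"
    by (intro mult_right_mono) auto
  also have "\<dots> = 1 - exp (-u)" by (simp add: algebra_simps flip: exp_add)
  finally have "(u * exp (-u/2))\<^sup>2 \<le> (1 - exp (-u))\<^sup>2"
    using assms by (intro power_mono) auto
  moreover have "(u * exp (-u/2))\<^sup>2 = u\<^sup>2 * exp (-u)"
    by (simp add: power_mult_distrib power2_eq_square flip: exp_add)
  ultimately show "lambert1 u \<le> 1"
    using pos by (simp add: lambert1_def)
qed

text \<open>One factor exp (-u/3) is given to each of the three factors u / (1 - exp (-u)); each
  product is at most (1 + u) exp (-u/3) \<le> 3. With 1 + exp (-u) \<le> 2 this yields 27 * 2 =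
  54.\<close>

lemma lambert2_bounds:
  assumes "u > 0"
  shows "0 \<le> lambert2 u" "lambert2 u \<le> 54"
proof -
  have pos: "1 - exp (-u) > 0" using assms by simp
  show "0 \<le> lambert2 u" using assms pos by (simp add: lambert2_def)
  have "1 + u \<le> exp u" by (rule exp_ge_add_one_self)
  then have "u / (1 - exp (-u)) \<le> 1 + u"
    using assms by (simp add: field_simps exp_minus)
  moreover have "1 + u/3 \<le> exp (u/3)" by (rule exp_ge_add_one_self)
  then have "(1 + u) * exp (-u/3) \<le> 3"
    using assms by (simp add: field_simps exp_minus)
  ultimately have "u / (1 - exp (-u)) * exp (-u/3) \<le> 3"
    by (meson exp_ge_zero mult_right_mono order_trans)
  then have "(u / (1 - exp (-u)) * exp (-u/3))^3 \<le> 3^3"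
    using assms pos by (intro power_mono) auto
  then have "(u / (1 - exp (-u)) * exp (-u/3))^3 * (1 + exp (-u)) \<le> 3^3 * 2"
    using assms by (intro mult_mono) auto
  moreover have "(u / (1 - exp (-u)) * exp (-u/3))^3 * (1 + exp (-u)) = lambert2 u"
    by (simp add: lambert2_def power_mult_distrib power_divide flip: exp_of_nat_mult)
  ultimately show "lambert2 u \<le> 54" by simp
qed

lemma sums_Suc_power:
  assumes "\<bar>y::real\<bar> < 1"
  shows "(\<lambda>k. y ^ Suc k) sums (y / (1 - y))"
    and "(\<lambda>k. real (Suc k) * y ^ Suc k) sums (y / (1 - y)\<^sup>2)"
    and "(\<lambda>k. real (Suc k) ^ 2 * y ^ Suc k) sums (y * (1 + y) / (1 - y)^3)"
proof -
  show 0: "(\<lambda>k. y ^ Suc k) sums (y / (1 - y))"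
    using sums_mult[OF geometric_sums[of y], of y] assms by simp
  show 1: "(\<lambda>k. real (Suc k) * y ^ Suc k) sums (y / (1 - y)\<^sup>2)"
    using sums_mult[OF geometric_deriv_sums[of y], of y] assms by (simp add: mult_ac)
  have ne: "1 - y \<noteq> 0" using assms by auto
  define g where "g = (\<lambda>k. real k ^ 2 * y ^ k)"
  have "summable (\<lambda>k. real (Suc k) * real (Suc (Suc k)) * y ^ k)"
  proof -
    have "summable (\<lambda>n. diffs (diffs (\<lambda>_. 1)) n * y ^ n)"
    proof (rule termdiff_converges[where K = 1])
      show "norm y < 1" using assms by simp
      fix x :: real assume "norm x < 1"
      then show "summable (\<lambda>n. diffs (\<lambda>_. 1) n * x ^ n)"
        by (intro termdiff_converges[where K = 1]) auto
    qed
    then show ?thesis by (simp add: diffs_def mult_ac)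
  qed
  then have "summable (\<lambda>k. y * (real (Suc k) * real (Suc (Suc k)) * y ^ k))"
    by (rule summable_mult)
  then have "summable (\<lambda>k. y * (real (Suc k) * real (Suc (Suc k)) * y ^ k) - real (Suc k) * y ^ Suc k)"
    using 1 by (intro summable_diff) (auto simp: sums_iff)
  moreover have "(\<lambda>k. y * (real (Suc k) * real (Suc (Suc k)) * y ^ k) - real (Suc k) * y ^ Suc k) = (\<lambda>k. g (Suc k))"
    by (auto simp: g_def power2_eq_square algebra_simps)
  ultimately have "summable (\<lambda>k. g (Suc k))" by simp
  then obtain T where T': "(\<lambda>k. g (Suc k)) sums T" by (auto simp: summable_def)
  then have T: "g sums T" using sums_Suc[of g T] by (simp add: g_def)
  \<comment> \<open>From (k+1)^2 = k^2 + 2 (k+1) - 1, the shifted series is y times the original one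
    plus known sums. Since the term at k = 0 vanishes, both have the sum T, which therefore
    satisfies a linear equation.\<close>
  have "(\<lambda>k. y * g k + 2 * (real (Suc k) * y ^ Suc k) - y ^ Suc k) sums (y * T + 2 * (y / (1-y)\<^sup>2) - y / (1-y))"
    by (intro sums_add sums_diff sums_mult T 0 1)
  moreover have "(\<lambda>k. y * g k + 2 * (real (Suc k) * y ^ Suc k) - y ^ Suc k) = (\<lambda>k. g (Suc k))"
    by (auto simp: g_def power2_eq_square algebra_simps)
  ultimately have "T = y * T + 2 * (y / (1-y)\<^sup>2) - y / (1-y)"
    using T' sums_unique2 by metis
  then have "T * (1 - y) = 2 * (y / (1-y)\<^sup>2) - y / (1-y)" by (simp add: algebra_simps)
  also have "\<dots> = y * (1 + y) / (1-y)^3 * (1 - y)"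
  proof -
    obtain w where "y = 1 - w" "w \<noteq> 0" using ne that[of "1 - y"] by simp
    then show ?thesis by (simp add: divide_simps) (simp add: algebra_simps power2_eq_square power3_eq_cube)
  qed
  finally have "T = y * (1 + y) / (1-y)^3" using ne by (metis mult_right_cancel)
  with T' show "(\<lambda>k. real (Suc k) ^ 2 * y ^ Suc k) sums (y * (1 + y) / (1 - y)^3)"
    by (simp add: g_def)
qed

lemma exp_minus_power_odd: "exp (-t) ^ (2*i+1) = exp (-((2 * real i + 1) * t))"
  by (simp add: algebra_simps flip: exp_of_nat_mult exp_add)

text \<open>Instances of \<open>sums_log_coeff\<close> with a N = N^p exp (-t N), where the sum over
  the multiples of an odd j has a closed form. The first and the last series share their value: this
  is what makes the power series with coefficients \<open>log_coeff\<close> the logarithm of the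
  product.\<close>

lemma sums_log_coeff_exp:
  assumes "t > (0::real)"
  shows "(\<lambda>N. log_coeff N * exp (-t) ^ N) sums
           (\<Sum>i. 2 / (2 * real i + 1)\<^sup>2 * lambert0 ((2 * real i + 1) * t) / t)"
    and "(\<lambda>N. log_coeff N * (real N * exp (-t) ^ N)) sums
           (\<Sum>i. 2 / (2 * real i + 1)\<^sup>2 * lambert1 ((2 * real i + 1) * t) / t\<^sup>2)"
    and "(\<lambda>N. log_coeff N * (real N ^ 2 * exp (-t) ^ N)) sums
           (\<Sum>i. 2 / (2 * real i + 1)\<^sup>2 * lambert2 ((2 * real i + 1) * t) / t^3)"
    and "(\<lambda>l. ln ((1 + exp (-t) ^ Suc l) / (1 - exp (-t) ^ Suc l))) sums
           (\<Sum>i. 2 / (2 * real i + 1)\<^sup>2 * lambert0 ((2 * real i + 1) * t) / t)"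
proof -
  define y where "y = (\<lambda>i::nat. exp (-t) ^ (2*i+1))"
  have y: "y i > 0" "y i < 1" "\<bar>y i\<bar> < 1" for i
    using assms unfolding y_def exp_minus_power_odd by auto
  have y_eq: "y i = exp (-((2 * real i + 1) * t))" for i
    unfolding y_def by (rule exp_minus_power_odd)
  have pow: "exp (-t) ^ ((2*i+1) * Suc l) = y i ^ Suc l" for i l
    by (simp only: y_def power_mult)
  have b0: "summable (\<lambda>i. 2 / (2 * real i + 1)\<^sup>2 * lambert0 ((2 * real i + 1) * t) / t)"
    by (intro summable_divide summable_odd_square_sum[where M = 1])
      (use assms lambert0_bounds in auto)
  have b1: "summable (\<lambda>i. 2 / (2 * real i + 1)\<^sup>2 * lambert1 ((2 * real i + 1) * t) / t\<^sup>2)"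
  proof (intro summable_divide summable_odd_square_sum[where M = 1])
    show "\<bar>lambert1 u\<bar> \<le> 1" if "u > 0" for u
      using lambert1_bounds[OF that] exp_gt_zero[of "-u"] by linarith
  qed fact
  have b2: "summable (\<lambda>i. 2 / (2 * real i + 1)\<^sup>2 * lambert2 ((2 * real i + 1) * t) / t^3)"
    by (intro summable_divide summable_odd_square_sum[where M = 54])
      (use assms lambert2_bounds in auto)
  have inner0: "(\<lambda>l. exp (-t) ^ ((2*i+1) * Suc l)) sums (y i / (1 - y i))" for i
    unfolding pow by (rule sums_Suc_power(1)[OF y(3)])
  have outer0: "(\<lambda>i. 2 / real (2*i+1) * (y i / (1 - y i))) sums
      (\<Sum>i. 2 / (2 * real i + 1)\<^sup>2 * lambert0 ((2 * real i + 1) * t) / t)"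
  proof -
    have "2 / real (2*i+1) * (y i / (1 - y i)) = 2 / (2 * real i + 1)\<^sup>2 * lambert0 ((2 * real i + 1) * t) / t" for i
      using assms unfolding lambert0_def y_eq by (simp add: power2_eq_square add.commute)
    then show ?thesis using summable_sums[OF b0] by simp
  qed
  show "(\<lambda>N. log_coeff N * exp (-t) ^ N) sums
           (\<Sum>i. 2 / (2 * real i + 1)\<^sup>2 * lambert0 ((2 * real i + 1) * t) / t)"
    by (rule sums_log_coeff(1)[OF _ inner0 outer0]) auto
  show "(\<lambda>l. ln ((1 + exp (-t) ^ Suc l) / (1 - exp (-t) ^ Suc l))) sums
           (\<Sum>i. 2 / (2 * real i + 1)\<^sup>2 * lambert0 ((2 * real i + 1) * t) / t)"
  proof (rule sums_log_coeff(2)[OF _ inner0 outer0])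
    fix l
    define z where "z = exp (-t) ^ Suc l"
    have z: "0 < z" "z < 1"
      using assms by (auto simp: z_def simp del: power_Suc intro!: power_Suc_less_one)
    \<comment> \<open>The artanh series for ln x in powers of (x - 1) / (x + 1), taken at x = (1 +
      z) / (1 - z), where that quotient is z.\<close>
    have "(\<lambda>n. 2 * ((((1+z)/(1-z)) - 1) / (((1+z)/(1-z)) + 1)) ^ (2*n+1) / of_nat (2*n+1)) sums ln ((1+z)/(1-z))"
      by (rule ln_series_quadratic) (use z in auto)
    moreover have "(((1+z)/(1-z)) - 1) / (((1+z)/(1-z)) + 1) = z"
      using z by (simp add: field_simps)
    ultimately have "(\<lambda>n. 2 * z ^ (2*n+1) / real (2*n+1)) sums ln ((1+z)/(1-z))"
      by (simp only:)
    then have "(\<lambda>n. 2 / real (2*n+1) * z ^ (2*n+1)) sums ln ((1+z)/(1-z))"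
      by (simp only: times_divide_eq_left)
    moreover have "z ^ (2*n+1) = exp (-t) ^ ((2*n+1) * Suc l)" for n
      unfolding z_def by (simp only: power_mult [symmetric] mult.commute)
    ultimately show "(\<lambda>i. 2 / real (2*i+1) * exp (-t) ^ ((2*i+1) * Suc l)) sums
        ln ((1 + exp (-t) ^ Suc l) / (1 - exp (-t) ^ Suc l))"
      by (simp only: z_def)
  qed auto
  show "(\<lambda>N. log_coeff N * (real N * exp (-t) ^ N)) sums
           (\<Sum>i. 2 / (2 * real i + 1)\<^sup>2 * lambert1 ((2 * real i + 1) * t) / t\<^sup>2)"
  proof (rule sums_log_coeff(1))
    fix i
    have "(\<lambda>l. real (2*i+1) * (real (Suc l) * y i ^ Suc l)) sums (real (2*i+1) * (y i / (1 - y i)\<^sup>2))"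
      by (intro sums_mult sums_Suc_power(2) y)
    then show "(\<lambda>l. real ((2*i+1) * Suc l) * exp (-t) ^ ((2*i+1) * Suc l)) sums (real (2*i+1) * (y i / (1 - y i)\<^sup>2))"
      unfolding pow by (simp only: of_nat_mult mult.assoc)
  next
    have "2 / real (2*i+1) * (real (2*i+1) * (y i / (1 - y i)\<^sup>2)) =
        2 / (2 * real i + 1)\<^sup>2 * lambert1 ((2 * real i + 1) * t) / t\<^sup>2" for i
      using assms unfolding lambert1_def y_eq by (simp add: power_mult_distrib add.commute)
    then show "(\<lambda>i. 2 / real (2*i+1) * (real (2*i+1) * (y i / (1 - y i)\<^sup>2))) sums
        (\<Sum>i. 2 / (2 * real i + 1)\<^sup>2 * lambert1 ((2 * real i + 1) * t) / t\<^sup>2)"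
      using summable_sums[OF b1] by simp
  qed auto
  show "(\<lambda>N. log_coeff N * (real N ^ 2 * exp (-t) ^ N)) sums
           (\<Sum>i. 2 / (2 * real i + 1)\<^sup>2 * lambert2 ((2 * real i + 1) * t) / t^3)"
  proof (rule sums_log_coeff(1))
    fix i
    have "(\<lambda>l. real (2*i+1)^2 * (real (Suc l)^2 * y i ^ Suc l)) sums (real (2*i+1)^2 * (y i * (1 + y i) / (1 - y i)^3))"
      by (intro sums_mult sums_Suc_power(3) y)
    then show "(\<lambda>l. real ((2*i+1) * Suc l)^2 * exp (-t) ^ ((2*i+1) * Suc l)) sums (real (2*i+1)^2 * (y i * (1 + y i) / (1 - y i)^3))"
      unfolding pow by (simp only: of_nat_mult mult.assoc power_mult_distrib)
  next
    have "2 / real (2*i+1) * (real (2*i+1)^2 * (y i * (1 + y i) / (1 - y i)^3)) =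
        2 / (2 * real i + 1)\<^sup>2 * lambert2 ((2 * real i + 1) * t) / t^3" for i
      using assms unfolding lambert2_def y_eq
      by (simp add: power_mult_distrib power2_eq_square power3_eq_cube add.commute)
    then show "(\<lambda>i. 2 / real (2*i+1) * (real (2*i+1)^2 * (y i * (1 + y i) / (1 - y i)^3))) sums
        (\<Sum>i. 2 / (2 * real i + 1)\<^sup>2 * lambert2 ((2 * real i + 1) * t) / t^3)"
      using summable_sums[OF b2] by simp
  qed auto
qed

section \<open>The logarithm and its derivatives near zero\<close>

definition log_gf :: "real \<Rightarrow> real" where
  "log_gf t = (\<Sum>N. log_coeff N * exp (-t) ^ N)"

text \<open>Minus the first derivative of \<open>log_gf\<close>, as \<open>log_gf2\<close> is the
  second derivative; both are given directly by their series, the only form in which they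
  occur.\<close>

definition log_gf1 :: "real \<Rightarrow> real" where
  "log_gf1 t = (\<Sum>N. log_coeff N * (real N * exp (-t) ^ N))"

definition log_gf2 :: "real \<Rightarrow> real" where
  "log_gf2 t = (\<Sum>N. log_coeff N * (real N ^ 2 * exp (-t) ^ N))"

lemma sums_log_gf:
  assumes "t > 0"
  shows "(\<lambda>N. log_coeff N * exp (-t) ^ N) sums log_gf t"
    and "(\<lambda>N. log_coeff N * (real N * exp (-t) ^ N)) sums log_gf1 t"
    and "(\<lambda>N. log_coeff N * (real N ^ 2 * exp (-t) ^ N)) sums log_gf2 t"
    and "(\<lambda>l. ln ((1 + exp (-t) ^ Suc l) / (1 - exp (-t) ^ Suc l))) sums log_gf t"
  using sums_log_coeff_exp[OF assms] by (simp_all only: log_gf_def log_gf1_def log_gf2_def sums_iff)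

lemma log_gf_eq_odd:
  assumes "t > 0"
  shows "t * log_gf t = (\<Sum>i. 2 / (2 * real i + 1)\<^sup>2 * lambert0 ((2 * real i + 1) * t))"
    and "t\<^sup>2 * log_gf1 t = (\<Sum>i. 2 / (2 * real i + 1)\<^sup>2 * lambert1 ((2 * real i + 1) * t))"
    and "t^3 * log_gf2 t = (\<Sum>i. 2 / (2 * real i + 1)\<^sup>2 * lambert2 ((2 * real i + 1) * t))"
proof -
  have *: "K * (\<Sum>i. g i / K) = (\<Sum>i. g i)" if "K \<noteq> 0" "summable g" for K :: real and g :: "nat \<Rightarrow> real"
    using that by (subst suminf_divide) auto
  have "\<bar>lambert1 u\<bar> \<le> 1" if "u > 0" for u
    using lambert1_bounds[OF that] exp_gt_zero[of "-u"] by linarith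
  then show "t\<^sup>2 * log_gf1 t = (\<Sum>i. 2 / (2 * real i + 1)\<^sup>2 * lambert1 ((2 * real i + 1) * t))"
    using assms unfolding sums_unique[OF sums_log_coeff_exp(2)[OF assms], symmetric] log_gf1_def
    by (intro * summable_odd_square_sum) auto
  show "t * log_gf t = (\<Sum>i. 2 / (2 * real i + 1)\<^sup>2 * lambert0 ((2 * real i + 1) * t))"
    using assms lambert0_bounds unfolding sums_unique[OF sums_log_coeff_exp(1)[OF assms], symmetric] log_gf_def
    by (intro * summable_odd_square_sum[where M = 1]) auto
  show "t^3 * log_gf2 t = (\<Sum>i. 2 / (2 * real i + 1)\<^sup>2 * lambert2 ((2 * real i + 1) * t))"
    using assms lambert2_bounds unfolding sums_unique[OF sums_log_coeff_exp(3)[OF assms], symmetric] log_gf2_def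
    by (intro * summable_odd_square_sum[where M = 54]) auto
qed

text \<open>Every profile value is replaced by its bound 1. Unlike the limit below, this is an
  inequality for each t > 0; it enters the estimate of the exponential sums.\<close>

lemma log_gf_le:
  assumes "t > 0"
  shows "log_gf t \<le> pi\<^sup>2 / (4 * t)"
proof -
  have "t * log_gf t \<le> 2 * (pi\<^sup>2 / 8)"
    unfolding log_gf_eq_odd[OF assms]
  proof (rule sums_le[OF _ summable_sums sums_mult[OF sums_inverse_odd_squares]])
    show "2 / (2 * real i + 1)\<^sup>2 * lambert0 ((2 * real i + 1) * t) \<le> 2 * (1 / (2 * real i + 1)\<^sup>2)" for i
      using lambert0_bounds[of "(2 * real i + 1) * t"] assms by (simp add: divide_right_mono)
    show "summable (\<lambda>i. 2 / (2 * real i + 1)\<^sup>2 * lambert0 ((2 * real i + 1) * t))"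
      using assms lambert0_bounds by (intro summable_odd_square_sum[where M = 1]) auto
  qed
  then show ?thesis using assms by (simp add: field_simps)
qed

lemma tendsto_log_gf: "((\<lambda>t. t * log_gf t) \<longlongrightarrow> pi\<^sup>2 / 4) (at_right 0)"
proof -
  have "(lambert0 \<longlongrightarrow> 1) (at_right 0)" unfolding lambert0_def by real_asymp
  then have "((\<lambda>t. \<Sum>i. 2 / (2 * real i + 1)\<^sup>2 * lambert0 ((2 * real i + 1) * t)) \<longlongrightarrow> 1 * pi\<^sup>2 / 4) (at_right 0)"
    by (rule tendsto_odd_square_sum[where M = 1]) (use lambert0_bounds in auto)
  moreover have "eventually (\<lambda>t. t * log_gf t = (\<Sum>i. 2 / (2 * real i + 1)\<^sup>2 * lambert0 ((2 * real i + 1) * t))) (at_right 0)"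
    using eventually_at_right_less[of 0] by eventually_elim (rule log_gf_eq_odd)
  ultimately show ?thesis by (simp add: tendsto_cong)
qed

lemma tendsto_log_gf2: "((\<lambda>t. t^3 * log_gf2 t) \<longlongrightarrow> pi\<^sup>2 / 2) (at_right 0)"
proof -
  have "(lambert2 \<longlongrightarrow> 2) (at_right 0)" unfolding lambert2_def by real_asymp
  then have "((\<lambda>t. \<Sum>i. 2 / (2 * real i + 1)\<^sup>2 * lambert2 ((2 * real i + 1) * t)) \<longlongrightarrow> 2 * pi\<^sup>2 / 4) (at_right 0)"
    by (rule tendsto_odd_square_sum[where M = 54]) (use lambert2_bounds in auto)
  moreover have "eventually (\<lambda>t. t^3 * log_gf2 t = (\<Sum>i. 2 / (2 * real i + 1)\<^sup>2 * lambert2 ((2 * real i + 1) * t))) (at_right 0)"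
    using eventually_at_right_less[of 0] by eventually_elim (rule log_gf_eq_odd)
  ultimately show ?thesis by (simp add: tendsto_cong)
qed

lemma log_gf2_le:
  assumes "t > 0"
  shows "t^3 * log_gf2 t \<le> 54 * (pi\<^sup>2 / 4)"
  unfolding log_gf_eq_odd[OF assms]
proof (rule sums_le[OF _ summable_sums])
  show "(\<lambda>i. 108 * (1 / (2 * real i + 1)\<^sup>2)) sums (54 * (pi\<^sup>2 / 4))"
    using sums_mult[OF sums_inverse_odd_squares, of 108] by (simp add: field_simps)
  show "2 / (2 * real i + 1)\<^sup>2 * lambert2 ((2 * real i + 1) * t) \<le> 108 * (1 / (2 * real i + 1)\<^sup>2)" for i
    using lambert2_bounds[of "(2 * real i + 1) * t"] assms by (simp add: divide_right_mono)
  show "summable (\<lambda>i. 2 / (2 * real i + 1)\<^sup>2 * lambert2 ((2 * real i + 1) * t))"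
    using assms lambert2_bounds by (intro summable_odd_square_sum[where M = 54]) auto
qed

text \<open>A bare limit would not do: at the saddle point the error of t^2 \<open>log_gf1 t\<close>
  is multiplied by u / sqrt t, so it must be o(sqrt t). Any exponent strictly between 1/2 and 1
  serves; it has to stay below 1 for the sum of j^(3/4 - 2) over odd j to converge.\<close>

lemma log_gf1_approx:
  obtains C where "\<And>t. t > 0 \<Longrightarrow> \<bar>t\<^sup>2 * log_gf1 t - pi\<^sup>2 / 4\<bar> \<le> C * t powr (3/4)"
proof -
  define C where "C = (\<Sum>i. 2 * (2 * real i + 1) powr (-5/4))"
  have summ: "summable (\<lambda>i. 2 * (2 * real i + 1) powr (-5/4))"
  proof (rule summable_comparison_test')
    show "summable (\<lambda>i. 2 * real (i + 1) powr (-5/4))"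
      using summable_real_powr_iff[of "-5/4"]
      by (intro summable_mult) (subst summable_iff_shift[of "\<lambda>i. real i powr (-5/4)" 1], simp)
    show "norm (2 * (2 * real i + 1) powr (-5/4)) \<le> 2 * real (i + 1) powr (-5/4)" for i
      by (simp, rule powr_mono2') auto
  qed
  have "\<bar>t\<^sup>2 * log_gf1 t - pi\<^sup>2 / 4\<bar> \<le> C * t powr (3/4)" if t: "t > 0" for t
  proof -
    have "\<bar>lambert1 u\<bar> \<le> 1" if "u > 0" for u
      using lambert1_bounds[OF that] exp_gt_zero[of "-u"] by linarith
    then have "(\<lambda>i. 2 / (2 * real i + 1)\<^sup>2 * lambert1 ((2 * real i + 1) * t)) sums (t\<^sup>2 * log_gf1 t)"
      unfolding log_gf_eq_odd[OF t] using t by (intro summable_sums summable_odd_square_sum) auto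
    moreover have "(\<lambda>i. 2 / (2 * real i + 1)\<^sup>2) sums (pi\<^sup>2 / 4)"
      using sums_mult[OF sums_inverse_odd_squares, of 2] by simp
    ultimately have s: "(\<lambda>i. 2 / (2 * real i + 1)\<^sup>2 * lambert1 ((2 * real i + 1) * t) - 2 / (2 * real i + 1)\<^sup>2)
        sums (t\<^sup>2 * log_gf1 t - pi\<^sup>2 / 4)" (is "?d sums _")
      by (rule sums_diff)
    have bound: "norm (?d i) \<le> 2 * (2 * real i + 1) powr (-5/4) * t powr (3/4)" for i
    proof -
      define u where "u = (2 * real i + 1) * t"
      have u: "u > 0" using t by (simp add: u_def)
      \<comment> \<open>The left side is at most both u and 1, and u^(3/4) is at least the smaller
        of the two.\<close>
      have "1 - exp (-u) \<le> u powr (3/4)"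
      proof (cases "u \<le> 1")
        case True
        then have "u powr 1 \<le> u powr (3/4)" using u by (intro powr_mono') auto
        then show ?thesis using exp_ge_add_one_self[of "-u"] u by simp
      next
        case False
        then have "1 \<le> u powr (3/4)" by (intro ge_one_powr_ge_zero) auto
        then show ?thesis by (smt (verit) exp_gt_zero)
      qed
      then have "\<bar>lambert1 u - 1\<bar> \<le> u powr (3/4)"
        using lambert1_bounds[OF u] by linarith
      then have le: "2 / J\<^sup>2 * \<bar>lambert1 u - 1\<bar> \<le> 2 / J\<^sup>2 * u powr (3/4)" for J
        by (rule mult_left_mono) simp
      have eq: "2 / J\<^sup>2 * (J * t) powr (3/4) = 2 * J powr (-5/4) * t powr (3/4)" if "J > 0" for J
      proof -
        have "J powr (-5/4) = J powr (-2) * J powr (3/4)"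
          by (simp flip: powr_add)
        also have "J powr (-2) = 1 / J\<^sup>2"
          using that by (simp add: powr_minus divide_inverse)
        finally show ?thesis
          using that t by (simp add: powr_mult)
      qed
      have "?d i = 2 / (2 * real i + 1)\<^sup>2 * (lambert1 u - 1)"
        unfolding u_def by (simp only: right_diff_distrib mult_1_right)
      then have "norm (?d i) = 2 / (2 * real i + 1)\<^sup>2 * \<bar>lambert1 u - 1\<bar>"
        by (simp only: abs_mult real_norm_def) simp
      also note le
      also have "2 / (2 * real i + 1)\<^sup>2 * u powr (3/4) = 2 * (2 * real i + 1) powr (-5/4) * t powr (3/4)"
        unfolding u_def by (rule eq) simp
      finally show ?thesis .
    qed
    have "norm (t\<^sup>2 * log_gf1 t - pi\<^sup>2 / 4) \<le> (\<Sum>i. 2 * (2 * real i + 1) powr (-5/4) * t powr (3/4))"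
      unfolding sums_unique[OF s] by (intro norm_suminf_le[OF bound] summable_mult2 summ)
    also have "\<dots> = C * t powr (3/4)"
      unfolding C_def by (intro suminf_mult2[symmetric] summ)
    finally show ?thesis by simp
  qed
  then show ?thesis using that by blast
qed

section \<open>The constant term, from a q-analogue of Wallis' product\<close>

text \<open>Read backwards, the first hypothesis says that h s is h (s/2) / 2 up to a small error.
  Iterating k times leaves h (s/2^k) / 2^k and a geometric sum of errors. The former is x h x at x =
  s / 2^k, divided by s, and vanishes by the second hypothesis, which excludes the solutions c/t of
  h t = 2 h (2 t).\<close>

lemma tendsto_zero_of_doubling:
  fixes h :: "real \<Rightarrow> real"
  assumes double: "((\<lambda>t. h t - 2 * h (2 * t)) \<longlongrightarrow> 0) (at_right 0)"
    and small: "((\<lambda>t. t * h t) \<longlongrightarrow> 0) (at_right 0)"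
  shows "(h \<longlongrightarrow> 0) (at_right 0)"
proof (rule tendstoI)
  fix e :: real assume "e > 0"
  then have "eventually (\<lambda>t. \<bar>h t - 2 * h (2 * t)\<bar> < e / 2) (at_right 0)"
    using tendstoD[OF double, of "e / 2"] by (simp add: dist_real_def)
  then obtain d where d: "d > 0" "\<And>t. 0 < t \<Longrightarrow> t < d \<Longrightarrow> \<bar>h t - 2 * h (2 * t)\<bar> < e / 2"
    unfolding eventually_at_right_field by auto
  have "\<bar>h s\<bar> < e" if s: "0 < s" "s < 2 * d" for s
  proof -
    have step: "\<bar>h u\<bar> \<le> \<bar>h (u / 2)\<bar> / 2 + e / 4" if "0 < u" "u < 2 * d" for u
    proof -
      have "\<bar>2 * h u - h (u / 2)\<bar> < e / 2"
        using d(2)[of "u / 2"] that by (simp add: abs_minus_commute)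
      moreover have "\<bar>2 * h u\<bar> - \<bar>h (u / 2)\<bar> \<le> \<bar>2 * h u - h (u / 2)\<bar>"
        by (rule abs_triangle_ineq2)
      moreover have "\<bar>2 * h u\<bar> = 2 * \<bar>h u\<bar>" by simp
      ultimately show ?thesis by linarith
    qed
    have iter: "\<bar>h s\<bar> \<le> \<bar>h (s / 2 ^ k)\<bar> / 2 ^ k + e / 2" for k
    proof -
      have "\<bar>h s\<bar> \<le> \<bar>h (s / 2 ^ k)\<bar> / 2 ^ k + (1 - 1 / 2 ^ k) * (e / 2)"
      proof (induction k)
        case (Suc k)
        have "s / 2 ^ k \<le> s / 1" using s by (intro divide_left_mono) auto
        with s have "0 < s / 2 ^ k" "s / 2 ^ k < 2 * d" by simp_all
        from step[OF this] have "\<bar>h (s / 2 ^ k)\<bar> \<le> \<bar>h (s / 2 ^ Suc k)\<bar> / 2 + e / 4"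
          by (simp add: mult.commute)
        then have "\<bar>h (s / 2 ^ k)\<bar> / 2 ^ k \<le> (\<bar>h (s / 2 ^ Suc k)\<bar> / 2 + e / 4) / 2 ^ k"
          by (rule divide_right_mono) simp
        with Suc show ?case by (simp add: field_simps)
      qed simp
      moreover have "(1 - 1 / 2 ^ k) * (e / 2) \<le> 1 * (e / 2)"
        using \<open>e > 0\<close> by (intro mult_right_mono) auto
      ultimately show ?thesis by linarith
    qed
    have "filterlim (\<lambda>k. s / 2 ^ k) (at_right 0) sequentially"
      using s by real_asymp
    from filterlim_compose[OF small this] have "(\<lambda>k. \<bar>s / 2 ^ k * h (s / 2 ^ k)\<bar> / s + e / 2) \<longlonglongrightarrow> \<bar>0\<bar> / s + e / 2"
      by (intro tendsto_intros) (use s in auto)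
    then have "(\<lambda>k. \<bar>h (s / 2 ^ k)\<bar> / 2 ^ k + e / 2) \<longlonglongrightarrow> e / 2"
      using s by (simp add: abs_mult)
    from LIMSEQ_le_const[OF this] iter have "\<bar>h s\<bar> \<le> e / 2" by blast
    then show ?thesis using \<open>e > 0\<close> by simp
  qed
  then show "eventually (\<lambda>s. dist (h s) 0 < e) (at_right 0)"
    using d(1) by (auto simp: eventually_at_right_field dist_real_def intro!: exI[of _ "2 * d"])
qed

section \<open>The function ln coth (x/2) and Wallis' product\<close>

definition lncoth :: "real \<Rightarrow> real" where
  "lncoth x = ln ((1 + exp (-x)) / (1 - exp (-x)))"

lemma lncoth_eq:
  assumes "x > 0"
  shows "lncoth x = - ln (tanh (x / 2))"
proof -
  have "tanh (x / 2) = (exp (x/2) - exp (-(x/2))) / (exp (x/2) + exp (-(x/2)))"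
    by (simp add: tanh_altdef)
  also have "\<dots> = (exp (x/2) * (1 - exp (-x))) / (exp (x/2) * (1 + exp (-x)))"
    by (simp add: algebra_simps flip: exp_add)
  also have "\<dots> = (1 - exp (-x)) / (1 + exp (-x))"
    by (rule mult_divide_mult_cancel_left) simp
  finally show ?thesis
    using assms by (simp add: lncoth_def ln_div add_pos_pos)
qed

lemma tendsto_lncoth: "((\<lambda>x. lncoth x + ln x) \<longlongrightarrow> ln 2) (at_right 0)"
  unfolding lncoth_def by real_asymp

lemma tendsto_lncoth_at_top: "(lncoth \<longlongrightarrow> 0) at_top"
  unfolding lncoth_def by real_asymp

lemma sums_lncoth:
  assumes "t > 0"
  shows "(\<lambda>l. lncoth (real (Suc l) * t)) sums log_gf t"
  using sums_log_gf(4)[OF assms] by (simp add: lncoth_def algebra_simps flip: exp_of_nat_mult exp_add)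

lemma sinh_mult_ge:
  assumes "(b::real) \<ge> 0"
  shows "real n * sinh b \<le> sinh (real n * b)"
proof (induction n)
  case (Suc n)
  have "sinh (real n * b) * 1 + 1 * sinh b \<le> sinh (real n * b) * cosh b + cosh (real n * b) * sinh b"
    using assms by (intro add_mono mult_left_mono mult_right_mono cosh_real_ge_1) auto
  also have "\<dots> = sinh (real (Suc n) * b)"
    by (simp add: sinh_add algebra_simps)
  finally show ?case using Suc by (simp add: algebra_simps)
qed simp

text \<open>With a = (l+1) t and b = t/2 this is a second difference of -ln tanh at a - b, a, a + b.
  The product formulas for sinh and cosh turn it into ln (1 + \<beta> / (1 + S)) - ln (1 - \<beta> /
  S), and a = 2 (l+1) b forces \<beta> / S \<le> 1 / (4 (l+1)^2). The bound does not depend on t, as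
  Tannery's theorem demands.\<close>

lemma lncoth_second_difference:
  assumes "t > 0"
  defines "w \<equiv> \<lambda>l. lncoth (real (2*l+1) * t) + lncoth (real (2*l+3) * t) - 2 * lncoth (real (2*l+2) * t)"
  shows "\<bar>w l\<bar> \<le> 3/4 * (1 / (1 + real l)\<^sup>2)"
proof -
  define a where "a = real (l+1) * t"
  define b where "b = t / 2"
  define S where "S = (sinh a)\<^sup>2"
  define \<beta> where "\<beta> = (sinh b)\<^sup>2"
  have ab: "0 < b" "b < a" using assms by (auto simp: a_def b_def field_simps add_pos_nonneg)
  have pos: "S > 0" "\<beta> > 0" using ab by (auto simp: S_def \<beta>_def)
  have cosh2: "(cosh a)\<^sup>2 = 1 + S" "(cosh b)\<^sup>2 = 1 + \<beta>"
    by (simp_all add: S_def \<beta>_def cosh_square_eq)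
  have "a = real (2 * (l+1)) * b" by (simp add: a_def b_def)
  then have "real (2 * (l+1)) * sinh b \<le> sinh a" using sinh_mult_ge[of b "2 * (l+1)"] ab by simp
  then have "(real (2 * (l+1)) * sinh b)\<^sup>2 \<le> (sinh a)\<^sup>2"
    using ab by (intro power_mono) auto
  then have "4 * (1 + real l)\<^sup>2 * \<beta> \<le> S"
    by (simp add: S_def \<beta>_def power_mult_distrib algebra_simps) (simp add: power2_eq_square algebra_simps)
  then have ratio: "\<beta> / S \<le> 1/4 * (1 / (1 + real l)\<^sup>2)"
    using pos by (simp add: field_simps)
  also have "\<dots> \<le> 1/4 * 1" by (intro mult_left_mono) (auto simp: field_simps)
  finally have quarter: "\<beta> / S \<le> 1/4" by simp
  then have "\<beta> < S" using pos by (simp add: field_simps)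
  have sinhs: "sinh (a - b) * sinh (a + b) = S - \<beta>"
  proof -
    have "sinh (a - b) * sinh (a + b) = (sinh a)\<^sup>2 * (cosh b)\<^sup>2 - (cosh a)\<^sup>2 * (sinh b)\<^sup>2"
      by (simp add: sinh_add sinh_diff power2_eq_square algebra_simps)
    then show ?thesis unfolding cosh2 by (simp add: S_def \<beta>_def algebra_simps)
  qed
  have coshs: "cosh (a - b) * cosh (a + b) = 1 + S + \<beta>"
  proof -
    have "cosh (a - b) * cosh (a + b) = (cosh a)\<^sup>2 * (cosh b)\<^sup>2 - (sinh a)\<^sup>2 * (sinh b)\<^sup>2"
      by (simp add: cosh_add cosh_diff power2_eq_square algebra_simps)
    then show ?thesis unfolding cosh2 by (simp add: S_def \<beta>_def algebra_simps)
  qed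
  have "w l = - ln (tanh (a - b)) - ln (tanh (a + b)) + 2 * ln (tanh a)"
  proof -
    have "lncoth (real (2*l+1) * t) = - ln (tanh (a - b))" "lncoth (real (2*l+3) * t) = - ln (tanh (a + b))"
      "lncoth (real (2*l+2) * t) = - ln (tanh a)"
      using assms by (subst lncoth_eq; auto simp: a_def b_def field_simps add_pos_nonneg)+
    then show ?thesis by (simp add: w_def)
  qed
  also have "\<dots> = ln ((tanh a)\<^sup>2) - ln (tanh (a - b) * tanh (a + b))"
    using ab by (simp add: ln_mult ln_realpow)
  also have "(tanh a)\<^sup>2 = S / (1 + S)"
    by (simp add: tanh_def power_divide cosh2 S_def[symmetric])
  also have "tanh (a - b) * tanh (a + b) = (S - \<beta>) / (1 + S + \<beta>)"
    by (simp add: tanh_def sinhs coshs)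
  also have "ln (S / (1 + S)) - ln ((S - \<beta>) / (1 + S + \<beta>)) = ln (1 + \<beta> / (1 + S)) - ln (1 - \<beta> / S)"
  proof -
    have "1 + \<beta> / (1 + S) = (1 + S + \<beta>) / (1 + S)" "1 - \<beta> / S = (S - \<beta>) / S"
      using pos by (simp_all add: field_simps)
    then show ?thesis using pos \<open>\<beta> < S\<close> by (simp add: ln_div)
  qed
  finally have w: "w l = ln (1 + \<beta> / (1 + S)) - ln (1 - \<beta> / S)" .
  have "0 \<le> ln (1 + \<beta> / (1 + S))" using pos by simp
  moreover have "ln (1 + \<beta> / (1 + S)) \<le> \<beta> / (1 + S)" using pos by (intro ln_add_one_self_le_self) simp
  moreover have "\<beta> / (1 + S) \<le> \<beta> / S" using pos by (simp add: frac_le)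
  moreover have "ln (1 - \<beta> / S) \<le> 0" using pos \<open>\<beta> < S\<close> by (intro ln_le_zero_iff[THEN iffD2]) auto
  moreover have "- ln (1 - \<beta> / S) \<le> 2 * (\<beta> / S)"
  proof -
    have "- (\<beta> / S) - 2 * (\<beta> / S)\<^sup>2 \<le> ln (1 - \<beta> / S)"
      using quarter pos by (intro ln_one_minus_pos_lower_bound) auto
    moreover have "(\<beta> / S)\<^sup>2 \<le> 1/4 * (\<beta> / S)"
      unfolding power2_eq_square using quarter pos by (intro mult_right_mono) auto
    moreover have "\<beta> / S \<ge> 0" using pos by simp
    ultimately show ?thesis by linarith
  qed
  ultimately have "0 \<le> w l" "w l \<le> 3 * (\<beta> / S)" unfolding w by linarith+
  then show ?thesis using ratio by linarith
qed

text \<open>Subtracting the even-indexed terms twice leaves the alternating sum of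
  \<open>lncoth\<close> at the multiples of t. Its double, less the telescoping first term, is a
  series of second differences, which has a summable majorant independent of t.\<close>

lemma log_gf_doubling_eq:
  assumes "t > 0"
  shows "(\<lambda>l. lncoth (real (2*l+1) * t) + lncoth (real (2*l+3) * t) - 2 * lncoth (real (2*l+2) * t))
           sums (2 * (log_gf t - 2 * log_gf (2 * t)) - lncoth t)"
proof -
  have s1: "(\<lambda>l. \<Sum>k\<in>{l*2..<l*2+2}. lncoth (real (Suc k) * t)) sums log_gf t"
    by (intro sums_group sums_lncoth assms) auto
  then have s1: "(\<lambda>l. lncoth (real (2*l+1) * t) + lncoth (real (2*l+2) * t)) sums log_gf t"
    by (simp add: numeral_2_eq_2 mult.commute add_ac)
  have s2: "(\<lambda>l. lncoth (real (Suc l) * (2 * t))) sums log_gf (2 * t)"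
    using assms by (intro sums_lncoth) auto
  have "real (Suc l) * (2 * t) = real (2*l+2) * t" for l by (simp add: algebra_simps)
  then have s2: "(\<lambda>l. lncoth (real (2*l+2) * t)) sums log_gf (2 * t)" using s2 by (simp only:)
  have "filterlim (\<lambda>l. real (2*l+1) * t) at_top sequentially"
    using assms by real_asymp
  from filterlim_compose[OF tendsto_lncoth_at_top this]
  have "(\<lambda>l. lncoth (real (2*l+1) * t)) \<longlonglongrightarrow> 0" .
  from telescope_sums'[OF this]
  have s3: "(\<lambda>l. lncoth (real (2*l+1) * t) - lncoth (real (2*l+3) * t)) sums lncoth t"
    by (simp add: numeral_3_eq_3 add_ac)
  have "(\<lambda>l. 2 * ((lncoth (real (2*l+1) * t) + lncoth (real (2*l+2) * t)) - 2 * lncoth (real (2*l+2) * t))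
            - (lncoth (real (2*l+1) * t) - lncoth (real (2*l+3) * t)))
        sums (2 * (log_gf t - 2 * log_gf (2 * t)) - lncoth t)"
    by (intro sums_diff sums_mult s1 s2 s3)
  then show ?thesis by (simp add: algebra_simps)
qed

text \<open>The logarithm of Wallis' product, with factor (2k)^2 / ((2k-1) (2k+1)) at k = l +
  1.\<close>

lemma sums_ln_wallis:
  "(\<lambda>l. 2 * ln (real (2*l+2)) - ln (real (2*l+1)) - ln (real (2*l+3))) sums ln (pi / 2)"
proof -
  have "(\<lambda>n. ln (\<Prod>k=1..n. (4 * real k^2) / (4 * real k^2 - 1))) \<longlonglongrightarrow> ln (pi / 2)"
    by (intro tendsto_ln wallis) simp
  moreover have "ln (\<Prod>k=1..n. (4 * real k^2) / (4 * real k^2 - 1)) =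
      (\<Sum>l<n. 2 * ln (real (2*l+2)) - ln (real (2*l+1)) - ln (real (2*l+3)))" for n
  proof -
    have prod_eq: "(\<Prod>k=1..n. (4 * real k^2) / (4 * real k^2 - 1)) = (\<Prod>l<n. (real (2*l+2))^2 / (real (2*l+1) * real (2*l+3)))"
    proof (rule prod.reindex_bij_witness[of _ Suc "\<lambda>k. k - 1"])
      fix k assume "k \<in> {1..n}"
      then obtain l where "k = Suc l" by (cases k) auto
      then show "(real (2*(k-1)+2))^2 / (real (2*(k-1)+1) * real (2*(k-1)+3)) = (4 * real k^2) / (4 * real k^2 - 1)"
        by (simp add: power2_eq_square algebra_simps)
    qed auto
    have "ln (\<Prod>k=1..n. (4 * real k^2) / (4 * real k^2 - 1)) = (\<Sum>l<n. ln ((real (2*l+2))^2 / (real (2*l+1) * real (2*l+3))))"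
      unfolding prod_eq by (intro ln_prod) auto
    also have "\<dots> = (\<Sum>l<n. 2 * ln (real (2*l+2)) - ln (real (2*l+1)) - ln (real (2*l+3)))"
    proof (rule sum.cong[OF refl])
      fix l
      have ln3: "ln (a^2 / (b * c)) = 2 * ln a - ln b - ln c" if "a > 0" "b > 0" "c > 0" for a b c :: real
      proof -
        have "ln (a^2 / (b * c)) = ln (a^2) - ln (b * c)"
          using that by (intro ln_divide_pos) auto
        also have "ln (b * c) = ln b + ln c"
          using that by (intro ln_mult_pos)
        also have "ln (a^2) = 2 * ln a"
          using ln_realpow[of a 2] that by simp
        finally show ?thesis by simp
      qed
      show "ln ((real (2*l+2))^2 / (real (2*l+1) * real (2*l+3))) =
          2 * ln (real (2*l+2)) - ln (real (2*l+1)) - ln (real (2*l+3))"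
        by (rule ln3) auto
    qed
    finally show ?thesis .
  qed
  ultimately show ?thesis by (simp add: sums_def)
qed

text \<open>Near 0, \<open>lncoth x\<close> is ln 2 - ln x + o(1). In a second difference both ln 2
  and ln t cancel, so the series tends to ln (pi/2). The detached term \<open>lncoth t\<close>
  supplies ln 2 - ln t.\<close>

lemma tendsto_log_gf_doubling:
  "((\<lambda>t. 2 * (log_gf t - 2 * log_gf (2 * t)) + ln t) \<longlongrightarrow> ln pi) (at_right 0)"
proof -
  define w where "w = (\<lambda>l t. lncoth (real (2*l+1) * t) + lncoth (real (2*l+3) * t) - 2 * lncoth (real (2*l+2) * t))"
  have "((\<lambda>t. \<Sum>l. w l t) \<longlongrightarrow> (\<Sum>l. 2 * ln (real (2*l+2)) - ln (real (2*l+1)) - ln (real (2*l+3)))) (at_right 0)"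
  proof (rule tannerys_theorem[where M = "\<lambda>l. 3/4 * (1 / (1 + real l)\<^sup>2)", THEN conjunct2, THEN conjunct2])
    fix l
    have lim: "((\<lambda>t. lncoth (real m * t) + ln (real m * t)) \<longlongrightarrow> ln 2) (at_right 0)" if "m > 0" for m
    proof -
      have "filterlim (\<lambda>t. real m * t) (at_right 0) (at_right 0)"
        using that by real_asymp
      from filterlim_compose[OF tendsto_lncoth this] show ?thesis .
    qed
    have "((\<lambda>t. (lncoth (real (2*l+1) * t) + ln (real (2*l+1) * t)) + (lncoth (real (2*l+3) * t) + ln (real (2*l+3) * t))
             - 2 * (lncoth (real (2*l+2) * t) + ln (real (2*l+2) * t))
             + (2 * ln (real (2*l+2)) - ln (real (2*l+1)) - ln (real (2*l+3)))) \<longlongrightarrow>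
           ln 2 + ln 2 - 2 * ln 2 + (2 * ln (real (2*l+2)) - ln (real (2*l+1)) - ln (real (2*l+3)))) (at_right 0)"
      by (intro tendsto_intros lim) auto
    moreover have "eventually (\<lambda>t. (lncoth (real (2*l+1) * t) + ln (real (2*l+1) * t)) + (lncoth (real (2*l+3) * t) + ln (real (2*l+3) * t))
             - 2 * (lncoth (real (2*l+2) * t) + ln (real (2*l+2) * t))
             + (2 * ln (real (2*l+2)) - ln (real (2*l+1)) - ln (real (2*l+3))) = w l t) (at_right 0)"
      using eventually_at_right_less[of 0]
    proof eventually_elim
      case (elim t)
      have "ln (real m * t) = ln (real m) + ln t" if "m > 0" for m
        using elim that by (simp add: ln_mult)
      from this[of "2*l+1"] this[of "2*l+2"] this[of "2*l+3"] show ?case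
        by (simp only: w_def) simp
    qed
    ultimately show "(w l \<longlongrightarrow> 2 * ln (real (2*l+2)) - ln (real (2*l+1)) - ln (real (2*l+3))) (at_right 0)"
      by (simp add: tendsto_cong)
  next
    have "eventually (\<lambda>t::real. t > 0) (at_right 0)"
      by (rule eventually_at_right_less)
    then have "eventually (\<lambda>p::nat \<times> real. snd p > 0) (at_top \<times>\<^sub>F at_right 0)"
      by (rule eventually_compose_filterlim) (rule filterlim_snd)
    then show "eventually (\<lambda>(l, t). norm (w l t) \<le> 3/4 * (1 / (1 + real l)\<^sup>2)) (at_top \<times>\<^sub>F at_right 0)"
    proof eventually_elim
      case (elim p)
      then show ?case
        using lncoth_second_difference[OF elim, of "fst p"]
        by (simp add: case_prod_unfold w_def)
    qed
  next
    show "summable (\<lambda>l. 3/4 * (1 / (1 + real l)\<^sup>2))"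
      using inverse_squares_sums by (intro summable_mult) (simp add: sums_iff add.commute)
  qed auto
  then have "((\<lambda>t. (\<Sum>l. w l t) + (lncoth t + ln t)) \<longlongrightarrow> ln (pi / 2) + ln 2) (at_right 0)"
    unfolding sums_unique[OF sums_ln_wallis, symmetric] by (intro tendsto_add tendsto_lncoth)
  moreover have "eventually (\<lambda>t. (\<Sum>l. w l t) + (lncoth t + ln t) = 2 * (log_gf t - 2 * log_gf (2 * t)) + ln t) (at_right 0)"
    using eventually_at_right_less[of 0]
  proof eventually_elim
    case (elim t)
    show ?case using sums_unique[OF log_gf_doubling_eq[OF elim]] by (simp add: w_def)
  qed
  moreover have "ln (pi / 2) + ln 2 = ln pi" by (simp add: ln_div)
  ultimately show ?thesis by (simp add: tendsto_cong)
qed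

text \<open>The term pi^2 / (4 t) disappears from h t - 2 h (2 t) and is accounted for by
  \<open>tendsto_log_gf\<close>. The logarithm contributes (ln pi - ln t) / 2 to that difference;
  the denominator 4 pi is chosen so that this matches the doubling limit.\<close>

lemma log_gf_asymptotic:
  "((\<lambda>t. log_gf t - pi\<^sup>2 / (4 * t) - ln (t / (4 * pi)) / 2) \<longlongrightarrow> 0) (at_right 0)"
proof (rule tendsto_zero_of_doubling)
  let ?h = "\<lambda>t. log_gf t - pi\<^sup>2 / (4 * t) - ln (t / (4 * pi)) / 2"
  have "((\<lambda>t. (2 * (log_gf t - 2 * log_gf (2 * t)) + ln t - ln pi) / 2) \<longlongrightarrow> (ln pi - ln pi) / 2) (at_right 0)"
    by (intro tendsto_intros tendsto_log_gf_doubling) auto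
  moreover have "eventually (\<lambda>t. (2 * (log_gf t - 2 * log_gf (2 * t)) + ln t - ln pi) / 2 = ?h t - 2 * ?h (2 * t)) (at_right 0)"
    using eventually_at_right_less[of 0]
  proof eventually_elim
    case (elim t)
    have "ln (t / (4 * pi)) = ln t - ln 4 - ln pi"
      using elim by (simp add: ln_div ln_mult)
    moreover have "ln (2 * t / (4 * pi)) = ln (2 * t) - ln (4 * pi)"
      using elim by (intro ln_divide_pos) auto
    then have "ln (2 * t / (4 * pi)) = ln 2 + ln t - ln 4 - ln pi"
      using elim by (simp add: ln_mult)
    moreover have "ln 4 = 2 * ln (2::real)" using ln_realpow[of 2 2] by simp
    moreover have "pi\<^sup>2 / (4 * t) = 2 * (pi\<^sup>2 / (4 * (2 * t)))" using elim by simp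
    ultimately show ?case by (simp add: field_simps)
  qed
  ultimately show "((\<lambda>t. ?h t - 2 * ?h (2 * t)) \<longlongrightarrow> 0) (at_right 0)"
    by (subst (asm) tendsto_cong) simp_all
  have "((\<lambda>t. t * log_gf t - pi\<^sup>2 / 4 - t * ln (t / (4 * pi)) / 2) \<longlongrightarrow> pi\<^sup>2 / 4 - pi\<^sup>2 / 4 - 0) (at_right 0)"
  proof (intro tendsto_diff tendsto_log_gf tendsto_const)
    show "((\<lambda>t. t * ln (t / (4 * pi)) / 2) \<longlongrightarrow> 0) (at_right 0)"
      using pi_gt_zero by real_asymp
  qed
  moreover have "eventually (\<lambda>t. t * log_gf t - pi\<^sup>2 / 4 - t * ln (t / (4 * pi)) / 2 = t * ?h t) (at_right 0)"
    using eventually_at_right_less[of 0] by eventually_elim (simp add: field_simps)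
  ultimately show "((\<lambda>t. t * ?h t) \<longlongrightarrow> 0) (at_right 0)"
    by (simp add: tendsto_cong)
qed

section \<open>Overpartitions by their largest part\<close>

text \<open>Folds the ordering of the parts and the rule for overlines into one pairwise relation,
  so that splitting and appending lists is governed by \<open>sorted_wrt\<close> alone.\<close>

definition part_order :: "nat \<times> bool \<Rightarrow> nat \<times> bool \<Rightarrow> bool" where
  "part_order x y \<longleftrightarrow> fst y < fst x \<or> (fst x = fst y \<and> \<not> snd y)"

lemma overpartitions_altdef:
  "overpartitions n = {xs. sorted_wrt part_order xs \<and> (\<forall>x\<in>set xs. 0 < fst x) \<and> sum_list (map fst xs) = n}"
proof -
  have "(sorted_wrt (\<ge>) (map fst xs) \<and>
         (\<forall>i<length xs. snd (xs ! i) \<longrightarrow> (\<forall>j<i. fst (xs ! j) \<noteq> fst (xs ! i)))) \<longleftrightarrow>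
        sorted_wrt part_order xs" for xs :: overpartition
  proof -
    have "part_order x y \<longleftrightarrow> fst y \<le> fst x \<and> (snd y \<longrightarrow> fst x \<noteq> fst y)" for x y
      unfolding part_order_def by auto
    then have "sorted_wrt part_order xs \<longleftrightarrow>
        (\<forall>i j. i < j \<longrightarrow> j < length xs \<longrightarrow> fst (xs ! j) \<le> fst (xs ! i)) \<and>
        (\<forall>i j. i < j \<longrightarrow> j < length xs \<longrightarrow> snd (xs ! j) \<longrightarrow> fst (xs ! i) \<noteq> fst (xs ! j))"
      unfolding sorted_wrt_iff_nth_less by simp blast
    moreover have "sorted_wrt (\<ge>) (map fst xs) \<longleftrightarrow>
        (\<forall>i j. i < j \<longrightarrow> j < length xs \<longrightarrow> fst (xs ! j) \<le> fst (xs ! i))"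
      unfolding sorted_wrt_map sorted_wrt_iff_nth_less by simp
    ultimately show ?thesis by blast
  qed
  then show ?thesis unfolding overpartitions_def by blast
qed

section \<open>The recursion on the largest part\<close>

definition bounded_overpartitions :: "nat \<Rightarrow> nat \<Rightarrow> overpartition set" where
  "bounded_overpartitions m n = {xs \<in> overpartitions n. \<forall>x\<in>set xs. fst x \<le> m}"

lemma finite_bounded_overpartitions [simp]: "finite (bounded_overpartitions m n)"
  unfolding bounded_overpartitions_def by (rule finite_subset[OF _ finite_overpartitions]) auto

lemma bounded_overpartitions_0: "bounded_overpartitions 0 n = (if n = 0 then {[]} else {})"
proof -
  have "xs = []" if "xs \<in> bounded_overpartitions 0 n" for xs
    using that by (cases xs) (auto simp: bounded_overpartitions_def overpartitions_altdef)
  then have "bounded_overpartitions 0 n \<subseteq> {[]}" by blast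
  moreover have "[] \<in> bounded_overpartitions 0 n \<longleftrightarrow> n = 0"
    by (auto simp: bounded_overpartitions_def overpartitions_altdef)
  ultimately show ?thesis by auto
qed

lemma bounded_overpartitions_eq:
  assumes "n \<le> m"
  shows "bounded_overpartitions m n = overpartitions n"
proof -
  have "fst x \<le> m" if "xs \<in> overpartitions n" "x \<in> set xs" for xs x
    using that assms member_le_sum_list[of "fst x" "map fst xs"]
    by (auto simp: overpartitions_altdef)
  then show ?thesis by (auto simp: bounded_overpartitions_def)
qed

lemma sorted_split_replicate:
  assumes "sorted_wrt part_order xs" "\<forall>x\<in>set xs. fst x < k \<or> x = (k, False)"
  shows "\<exists>j ys. xs = replicate j (k, False) @ ys \<and> (\<forall>y\<in>set ys. fst y < k)"
  using assms
proof (induction xs)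
  case (Cons x xs)
  show ?case
  proof (cases "x = (k, False)")
    case True
    with Cons obtain j ys where "xs = replicate j (k, False) @ ys" "\<forall>y\<in>set ys. fst y < k" by auto
    with True have "x # xs = replicate (Suc j) (k, False) @ ys" by simp
    with \<open>\<forall>y\<in>set ys. fst y < k\<close> show ?thesis by blast
  next
    case False
    with Cons.prems have "\<forall>y\<in>set (x # xs). fst y < k" by (auto simp: part_order_def)
    then show ?thesis by (intro exI[of _ 0] exI[of _ "x # xs"]) auto
  qed
qed simp

lemma sorted_split_largest:
  assumes sorted: "sorted_wrt part_order xs" and le: "\<forall>x\<in>set xs. fst x \<le> k" and ex: "\<exists>x\<in>set xs. fst x = k"
  shows "\<exists>j b ys. xs = (k, b) # replicate j (k, False) @ ys \<and> (\<forall>y\<in>set ys. fst y < k)"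
proof (cases xs)
  case (Cons x xs')
  have "fst x = k"
    using sorted le ex Cons by (auto simp: part_order_def)
  then have "\<forall>y\<in>set xs'. fst y < k \<or> y = (k, False)"
    using sorted Cons by (auto simp: part_order_def prod_eq_iff)
  with sorted_split_replicate[of xs' k] sorted Cons
  obtain j ys where "xs' = replicate j (k, False) @ ys" "\<forall>y\<in>set ys. fst y < k" by auto
  with \<open>fst x = k\<close> Cons show ?thesis
    by (intro exI[of _ j] exI[of _ "snd x"] exI[of _ ys]) (auto simp: prod_eq_iff)
qed (use ex in auto)

text \<open>A largest part Suc m occurs as a head with flag b, followed by j copies without overline
  and by an overpartition with parts at most m. Stated for an arbitrary summand, so that counting
  and exponential sums obey the same recursion.\<close>

lemma sum_bounded_overpartitions_Suc:
  fixes \<phi> :: "overpartition \<Rightarrow> 'a :: comm_monoid_add"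
  shows "sum \<phi> (bounded_overpartitions (Suc m) n) = sum \<phi> (bounded_overpartitions m n) +
    (\<Sum>j | Suc j * Suc m \<le> n. \<Sum>b\<in>UNIV. \<Sum>ys\<in>bounded_overpartitions m (n - Suc j * Suc m).
       \<phi> ((Suc m, b) # replicate j (Suc m, False) @ ys))"
proof -
  let ?A = "bounded_overpartitions (Suc m) n" and ?B = "bounded_overpartitions m n"
  define J where "J = {j. Suc j * Suc m \<le> n}"
  have "j \<le> n" if "j \<in> J" for j
  proof -
    have "j \<le> Suc j * Suc m" by simp
    with that show ?thesis unfolding J_def by (meson mem_Collect_eq order_trans)
  qed
  then have fin: "finite J" by (meson finite_nat_set_iff_bounded_le)
  have sub: "?B \<subseteq> ?A" by (auto simp: bounded_overpartitions_def)
  have "sum \<phi> (?A - ?B) = (\<Sum>(j, (b, ys))\<in>Sigma J (\<lambda>j. (UNIV :: bool set) \<times> bounded_overpartitions m (n - Suc j * Suc m)).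
       \<phi> ((Suc m, b) # replicate j (Suc m, False) @ ys))"
  \<comment> \<open>The inverse map counts the copies of Suc m, less one for the head, reads the
    flag off the head, and keeps the other parts.\<close>
  proof (rule sum.reindex_bij_witness[where
        i = "\<lambda>(j, (b, ys)). (Suc m, b) # replicate j (Suc m, False) @ ys" and
        j = "\<lambda>xs. (length (filter (\<lambda>x. fst x = Suc m) xs) - 1, (snd (hd xs), filter (\<lambda>x. fst x \<noteq> Suc m) xs))"])
    fix xs assume xs: "xs \<in> ?A - ?B"
    then have sorted: "sorted_wrt part_order xs" and le: "\<forall>x\<in>set xs. fst x \<le> Suc m"
      and ex: "\<exists>x\<in>set xs. fst x = Suc m"
      by (auto simp: bounded_overpartitions_def overpartitions_altdef le_Suc_eq)
    obtain j b ys where eq: "xs = (Suc m, b) # replicate j (Suc m, False) @ ys" and lt: "\<forall>y\<in>set ys. fst y < Suc m"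
      using sorted_split_largest[OF sorted le ex] by blast
    have f1: "filter (\<lambda>x. fst x = Suc m) ys = []" and f2: "filter (\<lambda>x. fst x \<noteq> Suc m) ys = ys"
      using lt by (auto simp: filter_empty_conv filter_id_conv)
    have *: "(\<lambda>xs. (length (filter (\<lambda>x. fst x = Suc m) xs) - 1, (snd (hd xs), filter (\<lambda>x. fst x \<noteq> Suc m) xs))) xs = (j, (b, ys))"
      using f1 f2 by (simp add: eq filter_replicate)
    show "(\<lambda>(j, (b, ys)). (Suc m, b) # replicate j (Suc m, False) @ ys)
        ((\<lambda>xs. (length (filter (\<lambda>x. fst x = Suc m) xs) - 1, (snd (hd xs), filter (\<lambda>x. fst x \<noteq> Suc m) xs))) xs) = xs"
      unfolding * by (simp add: eq)
    have sum_eq: "Suc j * Suc m + sum_list (map fst ys) = n"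
      using xs by (simp add: eq bounded_overpartitions_def overpartitions_altdef sum_list_replicate)
    then have "j \<in> J" "sum_list (map fst ys) = n - Suc j * Suc m" by (auto simp: J_def)
    moreover have "sorted_wrt part_order ys" "\<forall>y\<in>set ys. 0 < fst y"
      using xs by (auto simp: eq bounded_overpartitions_def overpartitions_altdef sorted_wrt_append)
    ultimately show "(\<lambda>xs. (length (filter (\<lambda>x. fst x = Suc m) xs) - 1, (snd (hd xs), filter (\<lambda>x. fst x \<noteq> Suc m) xs))) xs
        \<in> Sigma J (\<lambda>j. UNIV \<times> bounded_overpartitions m (n - Suc j * Suc m))"
      unfolding * using lt by (auto simp: bounded_overpartitions_def overpartitions_altdef less_Suc_eq_le)
    show "(\<lambda>(j, (b, ys)). \<phi> ((Suc m, b) # replicate j (Suc m, False) @ ys))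
        ((\<lambda>xs. (length (filter (\<lambda>x. fst x = Suc m) xs) - 1, (snd (hd xs), filter (\<lambda>x. fst x \<noteq> Suc m) xs))) xs) = \<phi> xs"
      unfolding * by (simp add: eq)
  next
    fix p assume "p \<in> Sigma J (\<lambda>j. (UNIV :: bool set) \<times> bounded_overpartitions m (n - Suc j * Suc m))"
    then obtain j b ys where p: "p = (j, (b, ys))" and j: "Suc j * Suc m \<le> n"
      and ys: "ys \<in> bounded_overpartitions m (n - Suc j * Suc m)"
      unfolding J_def by auto
    have lt: "\<forall>y\<in>set ys. fst y < Suc m" using ys by (auto simp: bounded_overpartitions_def less_Suc_eq_le)
    have f1: "filter (\<lambda>x. fst x = Suc m) ys = []" and f2: "filter (\<lambda>x. fst x \<noteq> Suc m) ys = ys"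
      using lt by (auto simp: filter_empty_conv filter_id_conv)
    show "(\<lambda>xs. (length (filter (\<lambda>x. fst x = Suc m) xs) - 1, (snd (hd xs), filter (\<lambda>x. fst x \<noteq> Suc m) xs)))
        ((\<lambda>(j, (b, ys)). (Suc m, b) # replicate j (Suc m, False) @ ys) p) = p"
      using f1 f2 by (simp add: p filter_replicate)
    have "sum_list (map fst ys) = n - Suc j * Suc m" "sorted_wrt part_order ys" "\<forall>y\<in>set ys. 0 < fst y"
      using ys by (auto simp: bounded_overpartitions_def overpartitions_altdef)
    moreover have "sorted_wrt part_order (replicate j (Suc m, False))"
      by (induction j) (auto simp: part_order_def)
    moreover have "Suc m + j * Suc m + (n - Suc j * Suc m) = n" using j by simp
    ultimately have "(Suc m, b) # replicate j (Suc m, False) @ ys \<in> overpartitions n"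
      using lt by (auto simp: overpartitions_altdef sorted_wrt_append part_order_def sum_list_replicate
          simp del: mult_Suc mult_Suc_right)
    then show "(\<lambda>(j, (b, ys)). (Suc m, b) # replicate j (Suc m, False) @ ys) p \<in> ?A - ?B"
      using lt by (auto simp: p bounded_overpartitions_def)
  qed
  also have "\<dots> = (\<Sum>j\<in>J. \<Sum>b\<in>UNIV. \<Sum>ys\<in>bounded_overpartitions m (n - Suc j * Suc m).
       \<phi> ((Suc m, b) # replicate j (Suc m, False) @ ys))"
    using fin by (subst sum.Sigma[symmetric]) (auto simp: sum.cartesian_product)
  finally show ?thesis
    using sum.subset_diff[OF sub finite_bounded_overpartitions, of \<phi>] by (simp add: J_def add.commute)
qed

text \<open>
  Counts overpartitions with parts at most m, every occurring part size k weighted by g k; the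
  factor 2 accounts for the optional overline.
\<close>

fun weight_count :: "(nat \<Rightarrow> real) \<Rightarrow> nat \<Rightarrow> nat \<Rightarrow> real" where
  "weight_count g 0 n = (if n = 0 then 1 else 0)"
| "weight_count g (Suc m) n = weight_count g m n +
     2 * g (Suc m) * (\<Sum>j | Suc j * Suc m \<le> n. weight_count g m (n - Suc j * Suc m))"

lemma weight_count_nonneg:
  assumes "\<And>k. g k \<ge> 0"
  shows "weight_count g m n \<ge> 0"
  by (induction m arbitrary: n) (auto simp: assms intro!: add_nonneg_nonneg mult_nonneg_nonneg sum_nonneg)

text \<open>A part size k contributes 1 + 2 g k (x^k + x^(2k) + ...). In the induction step the
  product of the geometric series and the series for m is regrouped by total size, which is
  legitimate because all terms are nonnegative.\<close>

lemma sums_weight_count: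
  assumes g: "\<And>k. g k \<ge> 0" and x: "0 < x" "x < 1"
  shows "(\<lambda>n. weight_count g m n * x ^ n) sums (\<Prod>k=1..m. 1 + 2 * g k * (x ^ k / (1 - x ^ k)))"
proof (induction m)
  case 0
  have "(\<lambda>n. weight_count g 0 n * x ^ n) = (\<lambda>n. if n = 0 then 1 else 0)" by auto
  then show ?case using sums_single[of 0 "\<lambda>_. 1::real"] by simp
next
  case (Suc m)
  let ?P = "\<Prod>k=1..m. 1 + 2 * g k * (x ^ k / (1 - x ^ k))"
  let ?V = "\<lambda>n. weight_count g m n"
  define y where "y = x ^ Suc m"
  have y: "0 < y" "y < 1" using x unfolding y_def by (auto intro!: power_Suc_less_one simp del: power_Suc)
  have V0: "?V n * x ^ n \<ge> 0" for n using weight_count_nonneg[of g, OF g] x by simp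
  have hs: "((\<lambda>n. ?V n * x ^ n) has_sum ?P) UNIV"
    by (rule sums_nonneg_imp_has_sum[OF Suc V0])
  have hsy: "((\<lambda>j. y ^ Suc j) has_sum (y / (1 - y))) UNIV"
    by (rule sums_nonneg_imp_has_sum[OF sums_Suc_power(1)]) (use y in auto)
  define h where "h = (\<lambda>(j, n). y ^ Suc j * (?V n * x ^ n))"
  have inner: "((\<lambda>n. h (j, n)) has_sum (y ^ Suc j * ?P)) UNIV" for j
    unfolding h_def prod.case by (rule has_sum_cmult_right[OF hs])
  have outer: "((\<lambda>j. y ^ Suc j * ?P) has_sum (y / (1 - y) * ?P)) UNIV"
    by (rule has_sum_cmult_left[OF hsy])
  have "h summable_on (UNIV \<times> UNIV)"
    by (rule summable_on_SigmaI[OF inner])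
      (use outer V0 y in \<open>auto simp: summable_on_def h_def intro!: mult_nonneg_nonneg\<close>)
  then have h: "(h has_sum (y / (1 - y) * ?P)) (UNIV \<times> UNIV)"
    by (intro has_sum_SigmaI[OF inner outer]) auto
  have "((\<lambda>(n, j). ?V (n - Suc j * Suc m) * x ^ n) has_sum (y / (1 - y) * ?P)) (Sigma UNIV (\<lambda>n. {j. Suc j * Suc m \<le> n}))
      \<longleftrightarrow> (h has_sum (y / (1 - y) * ?P)) (UNIV \<times> UNIV)"
  proof (rule has_sum_reindex_bij_witness[where
        i = "\<lambda>(j, n). (n + Suc j * Suc m, j)" and j = "\<lambda>(n, j). (j, n - Suc j * Suc m)"])
    fix p assume "p \<in> Sigma UNIV (\<lambda>n. {j. Suc j * Suc m \<le> n})"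
    then obtain n j where p: "p = (n, j)" "Suc j * Suc m \<le> n" by auto
    have "x ^ n = x ^ (Suc j * Suc m) * x ^ (n - Suc j * Suc m)"
      using p(2) by (simp flip: power_add del: mult_Suc mult_Suc_right)
    also have "x ^ (Suc j * Suc m) = y ^ Suc j"
      unfolding y_def power_mult[symmetric] by (simp only: mult.commute)
    finally show "h ((\<lambda>(n, j). (j, n - Suc j * Suc m)) p) = (\<lambda>(n, j). ?V (n - Suc j * Suc m) * x ^ n) p"
      by (simp add: h_def p del: mult_Suc mult_Suc_right power_Suc)
  qed (auto simp del: mult_Suc mult_Suc_right)
  with h have "((\<lambda>(n, j). ?V (n - Suc j * Suc m) * x ^ n) has_sum (y / (1 - y) * ?P)) (Sigma UNIV (\<lambda>n. {j. Suc j * Suc m \<le> n}))"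
    by simp
  then have "((\<lambda>n. (\<Sum>j | Suc j * Suc m \<le> n. ?V (n - Suc j * Suc m)) * x ^ n) has_sum (y / (1 - y) * ?P)) UNIV"
  proof (rule has_sum_SigmaD)
    fix n :: nat
    have "{j. Suc j * Suc m \<le> n} \<subseteq> {..n}"
    proof
      fix j assume "j \<in> {j. Suc j * Suc m \<le> n}"
      moreover have "j \<le> Suc j * Suc m" by simp
      ultimately show "j \<in> {..n}" by (meson atMost_iff mem_Collect_eq order_trans)
    qed
    then have "finite {j. Suc j * Suc m \<le> n}" by (rule finite_subset) simp
    then have "((\<lambda>j. ?V (n - Suc j * Suc m) * x ^ n) has_sum
        (\<Sum>j | Suc j * Suc m \<le> n. ?V (n - Suc j * Suc m) * x ^ n)) {j. Suc j * Suc m \<le> n}"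
      by (rule has_sum_finite)
    then show "((\<lambda>j. case (n, j) of (n, j) \<Rightarrow> ?V (n - Suc j * Suc m) * x ^ n) has_sum
        (\<Sum>j | Suc j * Suc m \<le> n. ?V (n - Suc j * Suc m)) * x ^ n) {j. Suc j * Suc m \<le> n}"
      by (simp only: sum_distrib_right prod.case)
  qed
  then have "(\<lambda>n. (\<Sum>j | Suc j * Suc m \<le> n. ?V (n - Suc j * Suc m)) * x ^ n) sums (y / (1 - y) * ?P)"
    by (rule has_sum_imp_sums)
  then have "(\<lambda>n. ?V n * x ^ n + 2 * g (Suc m) * ((\<Sum>j | Suc j * Suc m \<le> n. ?V (n - Suc j * Suc m)) * x ^ n)) sums
      (?P + 2 * g (Suc m) * (y / (1 - y) * ?P))"
    by (intro sums_add sums_mult Suc)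
  moreover have "?P + 2 * g (Suc m) * (y / (1 - y) * ?P) = (\<Prod>k=1..Suc m. 1 + 2 * g k * (x ^ k / (1 - x ^ k)))"
    by (simp add: y_def algebra_simps)
  ultimately show ?case
    by (simp only: weight_count.simps distrib_right mult.assoc)
qed

section \<open>The generating function as an infinite product\<close>

lemma card_bounded_overpartitions: "real (card (bounded_overpartitions m n)) = weight_count (\<lambda>_. 1) m n"
proof (induction m arbitrary: n)
  case (Suc m)
  have "real (card (bounded_overpartitions (Suc m) n)) = (\<Sum>xs\<in>bounded_overpartitions (Suc m) n. 1)" by simp
  also have "\<dots> = weight_count (\<lambda>_. 1) (Suc m) n"
    unfolding sum_bounded_overpartitions_Suc
    by (simp add: Suc UNIV_bool sum_distrib_left flip: mult_2 del: mult_Suc mult_Suc_right)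
  finally show ?case .
qed (simp add: bounded_overpartitions_0)

text \<open>The finite products F m squeeze the series. A part of n is at most n, so the partial sum
  below M already occurs in the series of F M, and F M is at most its limit. Conversely, restricting
  the parts lowers every coefficient, so each F m is at most the full series.\<close>

lemma sums_overpartition_count:
  assumes "t > 0"
  shows "(\<lambda>n. real (overpartition_count n) * exp (-t) ^ n) sums exp (log_gf t)"
proof -
  define x where "x = exp (-t)"
  have x: "0 < x" "x < 1" using assms by (auto simp: x_def)
  let ?p = "\<lambda>n. real (overpartition_count n)"
  define F where "F = (\<lambda>m. \<Prod>k=1..m. 1 + 2 * (x ^ k / (1 - x ^ k)))"
  have sums_F: "(\<lambda>n. real (card (bounded_overpartitions m n)) * x ^ n) sums F m" for m
    unfolding card_bounded_overpartitions F_def using sums_weight_count[of "\<lambda>_. 1" x m] x by simp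
  have F_eq: "F m = exp (\<Sum>l<m. ln ((1 + x ^ Suc l) / (1 - x ^ Suc l)))" for m
  proof -
    have "F m = (\<Prod>l<m. 1 + 2 * (x ^ Suc l / (1 - x ^ Suc l)))"
      unfolding F_def by (rule prod.reindex_bij_witness[of _ Suc "\<lambda>k. k - 1"]) auto
    also have "\<dots> = (\<Prod>l<m. exp (ln ((1 + x ^ Suc l) / (1 - x ^ Suc l))))"
    proof (rule prod.cong[OF refl])
      fix l
      have "x ^ Suc l < 1" "x ^ Suc l > 0" using x by (auto intro!: power_Suc_less_one simp del: power_Suc)
      then show "1 + 2 * (x ^ Suc l / (1 - x ^ Suc l)) = exp (ln ((1 + x ^ Suc l) / (1 - x ^ Suc l)))"
        by (simp add: exp_ln field_simps del: power_Suc)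
    qed
    also have "\<dots> = exp (\<Sum>l<m. ln ((1 + x ^ Suc l) / (1 - x ^ Suc l)))"
      by (rule exp_sum[symmetric]) simp
    finally show ?thesis .
  qed
  have lim: "F \<longlonglongrightarrow> exp (log_gf t)"
    unfolding F_eq by (intro tendsto_exp) (use sums_log_gf(4)[OF assms] in \<open>simp add: x_def sums_def\<close>)
  have nonneg: "ln ((1 + x ^ Suc l) / (1 - x ^ Suc l)) \<ge> 0" for l
    using x power_Suc_less_one[of x l] by (intro ln_ge_zero) (simp add: field_simps)
  have F_le: "F m \<le> exp (log_gf t)" for m
    unfolding F_eq exp_le_cancel_iff
    using sum_le_suminf[of "\<lambda>l. ln ((1 + x ^ Suc l) / (1 - x ^ Suc l))" "{..<m}"] nonneg sums_log_gf(4)[OF assms]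
    by (simp add: sums_iff x_def)
  have partial: "(\<Sum>n<M. ?p n * x ^ n) \<le> exp (log_gf t)" for M
  proof -
    have "(\<Sum>n<M. ?p n * x ^ n) = (\<Sum>n<M. real (card (bounded_overpartitions M n)) * x ^ n)"
      by (intro sum.cong refl) (simp add: bounded_overpartitions_eq overpartition_count_def)
    also have "\<dots> \<le> F M"
      using sum_le_suminf[of "\<lambda>n. real (card (bounded_overpartitions M n)) * x ^ n" "{..<M}"] sums_F[of M] x
      by (simp add: sums_iff)
    finally show ?thesis using F_le[of M] by simp
  qed
  have summ: "summable (\<lambda>n. ?p n * x ^ n)"
    by (rule summableI_nonneg_bounded[OF _ partial]) (use x in auto)
  moreover have "F m \<le> (\<Sum>n. ?p n * x ^ n)" for m
  proof (rule sums_le[OF _ sums_F summable_sums[OF summ]])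
    fix n
    have "card (bounded_overpartitions m n) \<le> overpartition_count n"
      unfolding overpartition_count_def by (intro card_mono finite_overpartitions) (auto simp: bounded_overpartitions_def)
    then show "real (card (bounded_overpartitions m n)) * x ^ n \<le> ?p n * x ^ n"
      using x by (intro mult_right_mono) auto
  qed
  then have "exp (log_gf t) \<le> (\<Sum>n. ?p n * x ^ n)"
    using LIMSEQ_le_const2[OF lim] by blast
  moreover have "(\<Sum>n. ?p n * x ^ n) \<le> exp (log_gf t)"
    by (rule suminf_le_const[OF summ partial])
  ultimately show ?thesis by (simp add: sums_iff x_def)
qed

section \<open>The saddle point method\<close>

lemma summable_norm_power_of_exp:
  fixes a :: "nat \<Rightarrow> real" and q :: complex
  assumes summ: "\<And>t. t > 0 \<Longrightarrow> summable (\<lambda>n. a n * exp (-t) ^ n)" and q: "norm q < 1"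
  shows "summable (\<lambda>n. norm (of_real (a n) * q ^ n))"
proof -
  obtain x where x: "norm q < x" "x < 1" using dense[OF q] by blast
  have x0: "x > 0" using x norm_ge_zero[of q] by linarith
  have "summable (\<lambda>n. a n * x ^ n)"
    using summ[of "- ln x"] x x0 by simp
  then have "summable (\<lambda>n. norm (a n * (norm q) ^ n))"
    by (rule powser_insidea) (use x x0 in simp)
  then show ?thesis by (simp add: norm_mult norm_power abs_mult)
qed

text \<open>Both sides are holomorphic on the unit disc and agree on the real interval (0, 1), which
  accumulates at 0. The identity theorem thus extends the real formula without another look at the
  product.\<close>

lemma sums_overpartition_count_complex:
  fixes q :: complex
  assumes "norm q < 1"
  shows "(\<lambda>n. of_real (real (overpartition_count n)) * q ^ n) sums exp (\<Sum>N. of_real (log_coeff N) * q ^ N)"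
proof -
  define A where "A = (\<lambda>q::complex. \<Sum>n. of_real (real (overpartition_count n)) * q ^ n)"
  define L where "L = (\<lambda>q::complex. \<Sum>N. of_real (log_coeff N) * q ^ N)"
  have A: "(\<lambda>n. of_real (real (overpartition_count n)) * q ^ n) sums A q" if "norm q < 1" for q
    unfolding A_def
    by (intro summable_sums summable_norm_cancel[OF summable_norm_power_of_exp[OF _ that]])
      (auto dest: sums_overpartition_count simp: sums_iff)
  have L: "(\<lambda>N. of_real (log_coeff N) * q ^ N) sums L q" if "norm q < 1" for q
    unfolding L_def
    by (intro summable_sums summable_norm_cancel[OF summable_norm_power_of_exp[OF _ that]])
      (auto dest: sums_log_gf(1) simp: sums_iff)
  have holA: "A holomorphic_on ball 0 1"
    by (rule power_series_holomorphic[where a = "\<lambda>n. of_real (real (overpartition_count n))"]) (use A in simp)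
  have holL: "L holomorphic_on ball 0 1"
    by (rule power_series_holomorphic[where a = "\<lambda>n. of_real (log_coeff n)"]) (use L in simp)
  have "A q - exp (L q) = 0"
  proof (rule analytic_continuation[where f = "\<lambda>q. A q - exp (L q)" and w = q and S = "ball 0 1" and U = "complex_of_real ` {0<..<1}" and \<xi> = 0])
    show "(\<lambda>q. A q - exp (L q)) holomorphic_on ball 0 1"
      by (intro holomorphic_intros holA holL)
    show "(0::complex) islimpt complex_of_real ` {0<..<1}"
      unfolding islimpt_approachable
    proof (intro allI impI)
      fix e :: real assume "e > 0"
      then show "\<exists>x'\<in>complex_of_real ` {0<..<1}. x' \<noteq> 0 \<and> dist x' 0 < e"
        by (intro bexI[of _ "complex_of_real (min (e/2) (1/2))"] imageI) (auto simp: min_def)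
    qed
    fix z assume "z \<in> complex_of_real ` {0<..<1}"
    then obtain x where z: "z = of_real x" and x: "0 < x" "x < 1" by auto
    define t where "t = - ln x"
    have t: "t > 0" "exp (-t) = x" using x by (auto simp: t_def)
    have "(\<lambda>n. complex_of_real (real (overpartition_count n) * x ^ n)) sums of_real (exp (log_gf t))"
      using sums_overpartition_count[OF t(1)] t(2) by (intro sums_of_real) simp
    then have "A z = of_real (exp (log_gf t))"
      using A[of z] x by (intro sums_unique2[of _ "A z"]) (auto simp: z)
    moreover have "(\<lambda>n. complex_of_real (log_coeff n * x ^ n)) sums of_real (log_gf t)"
      using sums_log_gf(1)[OF t(1)] t(2) by (intro sums_of_real) simp
    then have "L z = of_real (log_gf t)"
      using L[of z] x by (intro sums_unique2[of _ "L z"]) (auto simp: z)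
    ultimately show "A z - exp (L z) = 0" by (simp add: exp_of_real)
  qed (use assms in auto)
  then show ?thesis using A[OF assms] by (simp add: L_def)
qed

text \<open>
  The logarithm of the generating function at exp (-t + i y) has real part log_gf t - gf_re t y and
  imaginary part gf_im t y.
\<close>

definition gf_re :: "real \<Rightarrow> real \<Rightarrow> real" where
  "gf_re t y = (\<Sum>N. log_coeff N * exp (-t) ^ N * (1 - cos (real N * y)))"

definition gf_im :: "real \<Rightarrow> real \<Rightarrow> real" where
  "gf_im t y = (\<Sum>N. log_coeff N * exp (-t) ^ N * sin (real N * y))"

lemma sums_gf_re:
  assumes "t > 0"
  shows "(\<lambda>N. log_coeff N * exp (-t) ^ N * (1 - cos (real N * y))) sums gf_re t y"
  unfolding gf_re_def
proof (rule summable_sums, rule summable_comparison_test'[where N = 0])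
  show "summable (\<lambda>N. 2 * (log_coeff N * exp (-t) ^ N))"
    using sums_log_gf(1)[OF assms] by (intro summable_mult) (simp add: sums_iff)
  show "norm (log_coeff N * exp (-t) ^ N * (1 - cos (real N * y))) \<le> 2 * (log_coeff N * exp (-t) ^ N)" for N
  proof -
    have "\<bar>1 - cos (real N * y)\<bar> \<le> 2" using abs_cos_le_one[of "real N * y"] by linarith
    then have "(log_coeff N * exp (-t) ^ N) * \<bar>1 - cos (real N * y)\<bar> \<le> (log_coeff N * exp (-t) ^ N) * 2"
      by (intro mult_left_mono) (auto simp: log_coeff_nonneg)
    then show ?thesis by (simp add: abs_mult log_coeff_nonneg mult_ac)
  qed
qed

lemma sums_gf_im:
  assumes "t > 0"
  shows "(\<lambda>N. log_coeff N * exp (-t) ^ N * sin (real N * y)) sums gf_im t y"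
  unfolding gf_im_def
proof (rule summable_sums, rule summable_comparison_test'[where N = 0])
  show "summable (\<lambda>N. log_coeff N * exp (-t) ^ N)"
    using sums_log_gf(1)[OF assms] by (simp add: sums_iff)
  show "norm (log_coeff N * exp (-t) ^ N * sin (real N * y)) \<le> log_coeff N * exp (-t) ^ N" for N
  proof -
    have "(log_coeff N * exp (-t) ^ N) * \<bar>sin (real N * y)\<bar> \<le> (log_coeff N * exp (-t) ^ N) * 1"
      by (intro mult_left_mono) (auto simp: log_coeff_nonneg)
    then show ?thesis by (simp add: abs_mult log_coeff_nonneg)
  qed
qed

lemma measurable_gf_re [measurable]: "gf_re t \<in> borel_measurable borel"
  unfolding gf_re_def[abs_def] by measurable

lemma measurable_gf_im [measurable]: "gf_im t \<in> borel_measurable borel"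
  unfolding gf_im_def[abs_def] by measurable

text \<open>The real part of exp (-i n y) times the generating function at q = exp (-t + i y). The
  coefficients being real, the real part is all that Cauchy's formula needs.\<close>

lemma sums_overpartition_count_cos:
  assumes "t > 0"
  shows "(\<lambda>m. real (overpartition_count m) * exp (-t) ^ m * cos ((real m - real n) * y)) sums
           (exp (log_gf t) * (exp (- gf_re t y) * cos (gf_im t y - real n * y)))"
proof -
  define r where "r = exp (-t)"
  define q where "q = of_real r * cis y"
  have q: "norm q < 1" using assms by (simp add: q_def r_def norm_mult)
  have qpow: "q ^ m = of_real (r ^ m) * cis (real m * y)" for m
    by (simp add: q_def power_mult_distrib Complex.DeMoivre)
  define L where "L = (\<Sum>N. of_real (log_coeff N) * q ^ N)"
  have L: "(\<lambda>N. of_real (log_coeff N) * q ^ N) sums L"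
    unfolding L_def
    by (intro summable_sums summable_norm_cancel[OF summable_norm_power_of_exp[OF _ q]])
      (auto dest: sums_log_gf(1) simp: sums_iff)
  have "(\<lambda>N. log_coeff N * r ^ N - log_coeff N * r ^ N * (1 - cos (real N * y))) sums (log_gf t - gf_re t y)"
    unfolding r_def by (intro sums_diff sums_log_gf sums_gf_re assms)
  moreover have "Re (of_real (log_coeff N) * q ^ N) = log_coeff N * r ^ N - log_coeff N * r ^ N * (1 - cos (real N * y))" for N
    by (simp add: qpow algebra_simps)
  ultimately have "(\<lambda>N. Re (of_real (log_coeff N) * q ^ N)) sums (log_gf t - gf_re t y)"
    by (simp only:)
  with sums_Re[OF L] have ReL: "Re L = log_gf t - gf_re t y"
    by (rule sums_unique2)
  have "Im (of_real (log_coeff N) * q ^ N) = log_coeff N * r ^ N * sin (real N * y)" for N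
    by (simp add: qpow)
  then have "(\<lambda>N. Im (of_real (log_coeff N) * q ^ N)) sums gf_im t y"
    using sums_gf_im[OF assms, of y] by (simp only: r_def)
  with sums_Im[OF L] have ImL: "Im L = gf_im t y"
    by (rule sums_unique2)
  have "(\<lambda>m. of_real (real (overpartition_count m)) * q ^ m * cis (- (real n * y))) sums (exp L * cis (- (real n * y)))"
    unfolding L_def by (intro sums_mult2 sums_overpartition_count_complex q)
  then have "(\<lambda>m. Re (of_real (real (overpartition_count m)) * q ^ m * cis (- (real n * y)))) sums Re (exp L * cis (- (real n * y)))"
    by (rule sums_Re)
  moreover have "Re (of_real (real (overpartition_count m)) * q ^ m * cis (- (real n * y))) =
      real (overpartition_count m) * exp (-t) ^ m * cos ((real m - real n) * y)" for m
  proof -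
    have *: "of_real (real (overpartition_count m)) * q ^ m * cis (- (real n * y)) =
        of_real (real (overpartition_count m) * r ^ m) * cis ((real m - real n) * y)"
      by (simp add: qpow cis_mult left_diff_distrib mult.assoc)
    show ?thesis unfolding * by (simp add: r_def)
  qed
  moreover have eqL: "exp L * cis (- (real n * y)) = of_real (exp (log_gf t - gf_re t y)) * cis (gf_im t y - real n * y)"
    by (simp add: exp_eq_polar[of L] ReL ImL cis_mult mult.assoc)
  have "Re (exp L * cis (- (real n * y))) = exp (log_gf t) * (exp (- gf_re t y) * cos (gf_im t y - real n * y))"
    unfolding eqL by (simp add: mult.assoc flip: exp_add)
  ultimately show ?thesis by simp
qed

section \<open>Cauchy's integral in real form\<close>

lemma integral_cos_orthogonal:
  "has_bochner_integral lborel (\<lambda>y. cos ((real m - real n) * y) * indicator {-pi..pi} y) (if m = n then 2 * pi else 0)"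
proof (cases "m = n")
  case True
  have "has_bochner_integral lborel (\<lambda>y::real. 1 * indicator {-pi..pi} y) (pi - (-pi))"
    by (rule has_bochner_integral_FTC_Icc_real[where F = "\<lambda>y. y"]) (auto intro!: derivative_eq_intros)
  with True show ?thesis by simp
next
  case False
  define k where "k = real m - real n"
  have k: "k \<noteq> 0" using False by (simp add: k_def)
  have "has_bochner_integral lborel (\<lambda>y. cos (k * y) * indicator {-pi..pi} y) (sin (k * pi) / k - sin (k * (-pi)) / k)"
    by (rule has_bochner_integral_FTC_Icc_real[where F = "\<lambda>y. sin (k * y) / k"])
      (use k in \<open>auto intro!: derivative_eq_intros continuous_intros\<close>)
  moreover have "sin (k * pi) = 0"
    by (simp add: k_def left_diff_distrib sin_diff)
  ultimately show ?thesis using False by (simp add: k_def)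
qed

text \<open>Cauchy's coefficient formula on the circle of radius exp (-t): orthogonality of the
  cosines isolates m = n. Termwise integration is justified by the convergence of the generating
  function at exp (-t), which dominates all the cosines.\<close>

lemma overpartition_count_integral:
  assumes "t > 0"
  shows "2 * pi * real (overpartition_count n) * exp (-t) ^ n =
    exp (log_gf t) * (\<integral>y. exp (- gf_re t y) * cos (gf_im t y - real n * y) * indicator {-pi..pi} y \<partial>lborel)"
proof -
  let ?p = "\<lambda>m. real (overpartition_count m) * exp (-t) ^ m"
  let ?f = "\<lambda>m y. ?p m * (cos ((real m - real n) * y) * indicator {-pi..pi} y)"
  have hb: "has_bochner_integral lborel (?f m) (?p m * (if m = n then 2 * pi else 0))" for m
    by (intro has_bochner_integral_mult_right integral_cos_orthogonal)
  have p0: "?p m \<ge> 0" for m by simp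
  have summp: "summable ?p"
    using sums_overpartition_count[OF assms] by (simp add: sums_iff)
  have normf: "norm (?f m y) \<le> ?p m * indicator {-pi..pi} y" for m y
  proof -
    have "\<bar>cos ((real m - real n) * y) * indicator {-pi..pi} y\<bar> \<le> indicator {-pi..pi} y"
      by (auto simp: abs_mult split: split_indicator)
    then have "?p m * \<bar>cos ((real m - real n) * y) * indicator {-pi..pi} y\<bar> \<le> ?p m * indicator {-pi..pi} y"
      by (intro mult_left_mono p0)
    then show ?thesis by (simp add: abs_mult)
  qed
  have int_ind: "integrable lborel (indicator {-pi..pi} :: real \<Rightarrow> real)"
    by simp
  have "(\<lambda>m. integral\<^sup>L lborel (?f m)) sums (\<integral>y. (\<Sum>m. ?f m y) \<partial>lborel)"
  proof (rule sums_integral)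
    show "integrable lborel (?f m)" for m
      using hb[of m] by (simp add: has_bochner_integral_iff)
    show "AE y in lborel. summable (\<lambda>m. norm (?f m y))"
    proof (rule AE_I2)
      fix y
      show "summable (\<lambda>m. norm (?f m y))"
        by (rule summable_comparison_test'[where N = 0, OF summable_mult2[OF summp]]) (use normf in auto)
    qed
    show "summable (\<lambda>m. \<integral>y. norm (?f m y) \<partial>lborel)"
    proof (rule summable_comparison_test'[where N = 0])
      show "summable (\<lambda>m. ?p m * (2 * pi))" by (intro summable_mult2 summp)
      fix m
      have "(\<integral>y. norm (?f m y) \<partial>lborel) \<le> (\<integral>y. ?p m * indicator {-pi..pi} y \<partial>lborel)"
        by (intro integral_mono integrable_norm normf) (use hb[of m] in \<open>auto simp: has_bochner_integral_iff\<close>)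
      also have "\<dots> = ?p m * (2 * pi)"
        by simp
      finally show "norm (\<integral>y. norm (?f m y) \<partial>lborel) \<le> ?p m * (2 * pi)"
        by simp
    qed
  qed
  moreover have eq: "(\<lambda>m. integral\<^sup>L lborel (?f m)) = (\<lambda>m. if m = n then ?p n * (2 * pi) else 0)"
    unfolding has_bochner_integral_integral_eq[OF hb] by auto
  have "(\<lambda>m. integral\<^sup>L lborel (?f m)) sums (?p n * (2 * pi))"
    unfolding eq by (rule sums_single)
  ultimately have "?p n * (2 * pi) = (\<integral>y. (\<Sum>m. ?f m y) \<partial>lborel)"
    by (rule sums_unique2[rotated])
  moreover have "(\<Sum>m. ?f m y) = exp (log_gf t) * (exp (- gf_re t y) * cos (gf_im t y - real n * y) * indicator {-pi..pi} y)" for y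
    using sums_unique[OF sums_mult2[OF sums_overpartition_count_cos[OF assms, of n y], of "indicator {-pi..pi} y"]]
    by (simp add: mult.assoc)
  ultimately show ?thesis by (simp add: mult_ac)
qed

section \<open>Decay of the integrand away from the saddle point\<close>

lemma one_minus_cos_ge:
  assumes "\<bar>y\<bar> \<le> pi"
  shows "y\<^sup>2 / 12 \<le> 1 - cos y"
proof -
  \<comment> \<open>Quartering brings y into [-1, 1], where a Taylor bound for sin is effective.
    Doubling twice gives 1 - cos y = 8 (sin z)^2 (cos z)^2, which is at least 25/288 y^2, just above
    y^2 / 12.\<close>
  define z where "z = y / 4"
  have z: "\<bar>z\<bar> \<le> 1" using assms pi_less_4 by (simp add: z_def)
  then have z2: "z\<^sup>2 \<le> 1" by (simp add: abs_square_le_1)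
  have "\<bar>sin z - z\<bar> \<le> \<bar>z\<bar> ^ 3 / 6"
    using Maclaurin_sin_bound[of z 3] by (simp add: numeral_3_eq_3 sin_coeff_def fact_numeral)
  also have "\<bar>z\<bar> ^ 3 = z\<^sup>2 * \<bar>z\<bar>" by (simp add: power3_eq_cube power2_eq_square abs_mult_self_eq)
  also have "z\<^sup>2 * \<bar>z\<bar> / 6 \<le> 1 * \<bar>z\<bar> / 6" using z2 by (intro divide_right_mono mult_right_mono) auto
  finally have "5/6 * \<bar>z\<bar> \<le> \<bar>sin z\<bar>" by linarith
  then have "(5/6 * \<bar>z\<bar>)\<^sup>2 \<le> \<bar>sin z\<bar>\<^sup>2" by (intro power_mono) auto
  then have s: "25/36 * z\<^sup>2 \<le> (sin z)\<^sup>2" by (simp add: power_mult_distrib power_divide)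
  have "(sin (2 * z))\<^sup>2 = 4 * (sin z)\<^sup>2 * (cos z)\<^sup>2"
    by (simp add: sin_double power_mult_distrib)
  have cosz: "1/2 \<le> cos z"
  proof -
    have "1 - cos z = 2 * (sin (z/2))\<^sup>2" using cos_double_sin[of "z/2"] by simp
    also have "(sin (z/2))\<^sup>2 \<le> (z/2)\<^sup>2"
      using abs_sin_x_le_abs_x[of "z/2"] abs_le_square_iff by blast
    also have "2 * (z/2)\<^sup>2 = z\<^sup>2 / 2" by (simp add: power_divide)
    finally show ?thesis using z2 by simp
  qed
  then have "(1/2)\<^sup>2 \<le> (cos z)\<^sup>2" by (intro power_mono) auto
  then have "(25/36 * z\<^sup>2) * (1/4) \<le> (sin z)\<^sup>2 * (cos z)\<^sup>2"
    using s by (intro mult_mono) (auto simp: power_divide)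
  moreover have "1 - cos y = 2 * (sin (2 * z))\<^sup>2"
    using cos_double_sin[of "2 * z"] by (simp add: z_def)
  moreover have "y\<^sup>2 = 16 * z\<^sup>2" by (simp add: z_def power_divide)
  moreover have "0 \<le> (sin z)\<^sup>2 * (cos z)\<^sup>2" by simp
  moreover note \<open>(sin (2 * z))\<^sup>2 = 4 * (sin z)\<^sup>2 * (cos z)\<^sup>2\<close>
  ultimately show ?thesis by linarith
qed

lemma sums_geometric_cos:
  fixes r y :: real
  assumes r: "0 < r" "r < 1"
  shows "(\<lambda>N. r ^ N * (1 - cos (real N * y))) sums
    (r * (1 - cos y) * (1 + r) / ((1 - r) * ((1 - r)\<^sup>2 + 2 * (r * (1 - cos y)))))"
proof -
  define q where "q = of_real r * cis y"
  have q: "norm q < 1" using r by (simp add: q_def norm_mult)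
  have "(\<lambda>N. Re (q ^ N)) sums Re (1 / (1 - q))"
    by (intro sums_Re geometric_sums q)
  moreover have "Re (q ^ N) = r ^ N * cos (real N * y)" for N
    by (simp add: q_def power_mult_distrib Complex.DeMoivre flip: of_real_power)
  ultimately have "(\<lambda>N. r ^ N - r ^ N * cos (real N * y)) sums (1 / (1 - r) - Re (1 / (1 - q)))"
    using r by (intro sums_diff geometric_sums) auto
  moreover have "Re (1 / (1 - q)) = (1 - r * cos y) / ((1 - r)\<^sup>2 + 2 * (r * (1 - cos y)))"
  proof -
    have "(1 - r * cos y)\<^sup>2 + (r * sin y)\<^sup>2 = 1 - 2 * r * cos y + r\<^sup>2 * ((sin y)\<^sup>2 + (cos y)\<^sup>2)"
      by algebra
    also have "\<dots> = (1 - r)\<^sup>2 + 2 * (r * (1 - cos y))"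
      by (simp only: sin_cos_squared_add) (simp add: power2_eq_square algebra_simps)
    finally show ?thesis by (simp add: Re_divide q_def)
  qed
  moreover have "1 / a - (a + v) / (a\<^sup>2 + 2 * v) = v * (2 - a) / (a * (a\<^sup>2 + 2 * v))" if "a > 0" "v \<ge> 0" for a v :: real
  proof -
    have "a\<^sup>2 + 2 * v > 0" using that by (simp add: add_pos_nonneg)
    then show ?thesis using that by (simp add: field_simps power2_eq_square)
  qed
  from this[of "1 - r" "r * (1 - cos y)"]
  have "1 / (1 - r) - (1 - r * cos y) / ((1 - r)\<^sup>2 + 2 * (r * (1 - cos y))) =
      r * (1 - cos y) * (1 + r) / ((1 - r) * ((1 - r)\<^sup>2 + 2 * (r * (1 - cos y))))"
    using r by (simp add: algebra_simps)
  ultimately show ?thesis by (simp add: right_diff_distrib)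
qed

text \<open>Replacing \<open>log_coeff N\<close> by its lower bound 2 leaves a geometric sum with
  closed form. Since v / (a^2 + 2 v) increases in v and decreases in a, one may put t for a = 1 -
  exp (-t) and y^2 / 108 for v; here 108 = 9 * 12, from exp (-t) \<ge> 1/9 and 1 - cos y \<ge> y^2 /
  12.\<close>

lemma gf_re_ge:
  assumes t: "0 < t" "t \<le> 2" and y: "\<bar>y\<bar> \<le> pi"
  shows "y\<^sup>2 / 54 / (t * (t\<^sup>2 + y\<^sup>2 / 54)) \<le> gf_re t y"
proof -
  define r where "r = exp (-t)"
  define v where "v = r * (1 - cos y)"
  define a where "a = 1 - r"
  define w where "w = y\<^sup>2 / 108"
  have r: "0 < r" "r < 1" using t by (auto simp: r_def)
  have "1 / 9 \<le> r"
  proof -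
    have "exp t \<le> exp 2" using t by simp
    also have "\<dots> = exp 1 ^ 2" by (simp flip: exp_of_nat_mult)
    also have "\<dots> \<le> 3 ^ 2" by (intro power_mono exp_le) auto
    finally show ?thesis by (simp add: r_def exp_minus field_simps)
  qed
  then have "1/9 * (y\<^sup>2 / 12) \<le> v"
    unfolding v_def using one_minus_cos_ge[OF y] by (intro mult_mono) auto
  then have v: "w \<le> v" by (simp add: w_def)
  have w0: "w \<ge> 0" by (simp add: w_def)
  have a: "0 < a" "a \<le> t" using r exp_ge_add_one_self[of "-t"] by (auto simp: a_def r_def)
  have "w * (a\<^sup>2 + 2 * v) \<le> v * (t\<^sup>2 + 2 * w)"
  proof -
    have "a\<^sup>2 \<le> t\<^sup>2" using a by (intro power_mono) auto
    then have "w * a\<^sup>2 \<le> v * t\<^sup>2" using v w0 by (intro mult_mono) auto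
    then show ?thesis by (simp add: algebra_simps)
  qed
  then have "w / (t\<^sup>2 + 2 * w) \<le> v / (a\<^sup>2 + 2 * v)"
    using a t v w0 by (simp add: divide_simps add_pos_nonneg add_nonneg_eq_0_iff zero_less_mult_iff mult.commute)
  then have "w / (t\<^sup>2 + 2 * w) / t \<le> v / (a\<^sup>2 + 2 * v) / a"
    using a v w0 by (intro frac_le[OF _ _ a]) auto
  also have "\<dots> \<le> v / (a\<^sup>2 + 2 * v) / a * (1 + r)"
  proof -
    have "v / (a\<^sup>2 + 2 * v) / a * 1 \<le> v / (a\<^sup>2 + 2 * v) / a * (1 + r)"
      using a r v w0 by (intro mult_left_mono) auto
    then show ?thesis by simp
  qed
  also have "\<dots> = v * (1 + r) / (a * (a\<^sup>2 + 2 * v))" by simp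
  finally have "2 * (w / (t\<^sup>2 + 2 * w) / t) \<le> 2 * (v * (1 + r) / (a * (a\<^sup>2 + 2 * v)))" by simp
  moreover have "2 * (v * (1 + r) / (a * (a\<^sup>2 + 2 * v))) \<le> gf_re t y"
  proof (rule sums_le[OF _ sums_mult[OF sums_geometric_cos[OF r, of y]] sums_gf_re[OF t(1)], folded v_def a_def])
    fix N
    show "2 * (r ^ N * (1 - cos (real N * y))) \<le> log_coeff N * exp (-t) ^ N * (1 - cos (real N * y))"
    proof (cases "N = 0")
      case False
      then have "2 * (r ^ N * (1 - cos (real N * y))) \<le> log_coeff N * (r ^ N * (1 - cos (real N * y)))"
        using r by (intro mult_right_mono log_coeff_ge_2) auto
      then show ?thesis by (simp add: r_def mult.assoc)
    qed simp
  qed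
  moreover have "2 * (w / (t\<^sup>2 + 2 * w) / t) = y\<^sup>2 / 54 / (t * (t\<^sup>2 + y\<^sup>2 / 54))"
  proof -
    have "2 * w = y\<^sup>2 / 54" by (simp add: w_def)
    moreover have "2 * (w / (t\<^sup>2 + 2 * w) / t) = (2 * w) / (t * (t\<^sup>2 + 2 * w))"
      by (simp add: mult.commute)
    ultimately show ?thesis by (simp only:)
  qed
  ultimately show ?thesis by simp
qed

text \<open>
  For large u the constraint that t^(3/2) u is at most pi forces t to be at most 1 / sqrt u, and
  then gf_re grows at least like sqrt u; for small u the trivial bound 1 suffices.
\<close>

lemma exp_gf_re_dominated:
  assumes t: "0 < t" "t \<le> 2" and y: "\<bar>t * sqrt t * u\<bar> \<le> pi"
  shows "exp (- gf_re t (t * sqrt t * u)) \<le> (1 + 256\<^sup>2 + 512 * 108 ^ 4) * inverse (1 + u\<^sup>2)"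
proof -
  define \<kappa> :: real where "\<kappa> = 1 / 108"
  define y where "y = t * sqrt t * u"
  have y2: "y\<^sup>2 = t^3 * u\<^sup>2"
    using t by (simp add: y_def power_mult_distrib power2_eq_square power3_eq_cube)
  have "y\<^sup>2 / 54 / (t * (t\<^sup>2 + y\<^sup>2 / 54)) = t^3 * (2 * \<kappa> * u\<^sup>2) / (t^3 * (1 + 2 * \<kappa> * (t * u\<^sup>2)))"
    unfolding y2 \<kappa>_def by (simp add: power2_eq_square power3_eq_cube algebra_simps)
  also have "\<dots> = 2 * \<kappa> * u\<^sup>2 / (1 + 2 * \<kappa> * (t * u\<^sup>2))"
    using t by simp
  finally have ge: "2 * \<kappa> * u\<^sup>2 / (1 + 2 * \<kappa> * (t * u\<^sup>2)) \<le> gf_re t y"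
    using gf_re_ge[OF t, of y] assms(3) by (simp add: y_def)
  show ?thesis
  proof (cases "\<bar>u\<bar> \<le> 256")
    case True
    have "0 \<le> 2 * \<kappa> * u\<^sup>2 / (1 + 2 * \<kappa> * (t * u\<^sup>2))"
      using t by (simp add: \<kappa>_def)
    then have "exp (- gf_re t y) \<le> 1" using ge by simp
    moreover have "u\<^sup>2 \<le> 256\<^sup>2" using True by (metis abs_ge_zero power2_abs power_mono)
    then have "1 \<le> (1 + 256\<^sup>2 + 512 * 108 ^ 4) * inverse (1 + u\<^sup>2)"
      by (simp add: field_simps add_pos_nonneg)
    ultimately show ?thesis unfolding y_def by (rule order_trans)
  next
    case False
    define s where "s = sqrt \<bar>u\<bar>"
    have s2: "s\<^sup>2 = \<bar>u\<bar>" by (simp add: s_def)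
    have u2: "u\<^sup>2 = s^4"
    proof -
      have "u\<^sup>2 = (s\<^sup>2)\<^sup>2" unfolding s2 by simp
      then show ?thesis by simp
    qed
    \<comment> \<open>The origin of the cutoff 256 = 16^2: if t s exceeded 1, then s < (t s)^3 s =
      y^2 \<le> pi^2 \<le> 16.\<close>
    have s: "s > 16"
      unfolding s_def using False real_less_rsqrt[of 16 "\<bar>u\<bar>"] by simp
    have "t * s \<le> 1"
    proof (rule ccontr)
      assume "\<not> t * s \<le> 1"
      then have "1 < (t * s)^3" by (intro one_less_power) auto
      then have "1 * s < (t * s)^3 * s" using s by (intro mult_strict_right_mono) auto
      also have "\<dots> = y\<^sup>2" unfolding y2 u2 by (simp add: power_mult_distrib eval_nat_numeral)
      also have "\<dots> \<le> pi\<^sup>2" using assms(3) by (metis y_def abs_ge_zero power2_abs power_mono)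
      also have "\<dots> \<le> 4\<^sup>2" using pi_less_4 by (intro power_mono) auto
      finally show False using s by simp
    qed
    then have "t * s * s^3 \<le> 1 * s^3" using s by (intro mult_right_mono) auto
    then have tu: "t * u\<^sup>2 \<le> s^3" unfolding u2 by (simp add: eval_nat_numeral mult_ac)
    have s3: "1 \<le> s^3" using s by (intro one_le_power) auto
    have "\<kappa> * s \<le> 2 * \<kappa> * u\<^sup>2 / (1 + 2 * \<kappa> * (t * u\<^sup>2))"
    proof -
      have "1 + 2 * \<kappa> * (t * u\<^sup>2) \<le> 1 + 2 * \<kappa> * s^3"
        using tu by (simp add: \<kappa>_def)
      also have "\<dots> \<le> 2 * s^3" using s3 by (simp add: \<kappa>_def)
      finally have "\<kappa> * s * (1 + 2 * \<kappa> * (t * u\<^sup>2)) \<le> \<kappa> * s * (2 * s^3)"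
        using s by (intro mult_left_mono) (auto simp: \<kappa>_def)
      also have "\<dots> = 2 * \<kappa> * u\<^sup>2" unfolding u2 by (simp add: eval_nat_numeral)
      finally have "\<kappa> * s * (1 + 2 * \<kappa> * (t * u\<^sup>2)) \<le> 2 * \<kappa> * u\<^sup>2" .
      moreover have "0 < 1 + 2 * \<kappa> * (t * u\<^sup>2)"
        using t by (intro add_pos_nonneg) (auto simp: \<kappa>_def)
      ultimately show ?thesis by (simp only: pos_le_divide_eq)
    qed
    then have "\<kappa> * s \<le> gf_re t y" using ge by simp
    then have "exp (- gf_re t y) \<le> exp (- (\<kappa> * s))" by simp
    \<comment> \<open>The fourth power turns decay in s = sqrt |u| into decay like 1 / u^2, which is
      integrable.\<close>
    also have "\<dots> \<le> 256 / (\<kappa> * s)^4"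
    proof -
      have "\<kappa> * s / 4 \<le> exp (\<kappa> * s / 4)"
        using exp_ge_add_one_self[of "\<kappa> * s / 4"] by linarith
      then have "(\<kappa> * s / 4)^4 \<le> exp (\<kappa> * s / 4)^4"
        using s by (intro power_mono) (auto simp: \<kappa>_def)
      also have "\<dots> = exp (\<kappa> * s)" by (simp flip: exp_of_nat_mult)
      finally have "(\<kappa> * s)^4 / 256 \<le> exp (\<kappa> * s)" by (simp add: power_divide)
      moreover have "(\<kappa> * s)^4 > 0" using s by (simp add: \<kappa>_def)
      ultimately show ?thesis by (simp add: exp_minus field_simps)
    qed
    also have "\<dots> = 256 * 108^4 * inverse (u\<^sup>2)"
    proof -
      have "(\<kappa> * s)^4 = u\<^sup>2 / 108^4" unfolding u2 by (simp only: \<kappa>_def power_mult_distrib power_divide) simp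
      then show ?thesis by (simp only: divide_divide_eq_right divide_inverse inverse_mult_distrib inverse_inverse_eq mult_ac)
    qed
    also have "\<dots> \<le> 256 * 108^4 * (2 * inverse (1 + u\<^sup>2))"
    proof (rule mult_left_mono)
      have "1 \<le> u\<^sup>2" unfolding u2 using s by (intro one_le_power) auto
      moreover have "inverse x \<le> 2 * inverse (1 + x)" if "1 \<le> x" for x :: real
        using that by (simp add: field_simps)
      ultimately show "inverse (u\<^sup>2) \<le> 2 * inverse (1 + u\<^sup>2)" by blast
    qed simp
    also have "\<dots> \<le> (1 + 256\<^sup>2 + 512 * 108 ^ 4) * inverse (1 + u\<^sup>2)"
      by (simp add: mult_right_mono)
    finally show ?thesis by (simp add: y_def)
  qed
qed

section \<open>Taylor expansion at the saddle point\<close>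

lemma suminf_cubic_bound:
  assumes t: "t > 0" and e: "\<And>x::real. \<bar>e x\<bar> \<le> \<bar>x\<bar> ^ 3"
    and S: "(\<lambda>N. log_coeff N * exp (-t) ^ N * e (real N * y)) sums S"
  shows "\<bar>S\<bar> \<le> 216 * pi\<^sup>2 * \<bar>y\<bar> ^ 3 / t ^ 4"
proof -
  \<comment> \<open>Half of the exponential absorbs one factor N, since N exp (-t N / 2) \<le> 2 /
    t; the other half leaves the second derivative at t/2, which is O(t^(-3)). For y = t^(3/2) u the
    resulting bound |y|^3 / t^4 is of order sqrt t.\<close>
  let ?b = "\<lambda>N. log_coeff N * (real N ^ 2 * exp (-(t/2)) ^ N) * (2 / t * \<bar>y\<bar> ^ 3)"
  have b: "?b sums (log_gf2 (t/2) * (2 / t * \<bar>y\<bar> ^ 3))"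
    using t by (intro sums_mult2 sums_log_gf(3)) auto
  have bound: "norm (log_coeff N * exp (-t) ^ N * e (real N * y)) \<le> ?b N" for N
  proof -
    have half: "exp (-t) ^ N = exp (-(t/2)) ^ N * exp (-(t/2)) ^ N"
      by (simp add: power_mult_distrib[symmetric] flip: exp_add)
    define E where "E = exp (real N * (t/2))"
    have "real N * (t/2) \<le> E"
      using exp_ge_add_one_self[of "real N * (t/2)"] unfolding E_def by linarith
    then have "real N * (1 / E) \<le> 2 / t"
      using t by (simp add: E_def field_simps)
    moreover have "exp (-(t/2)) ^ N = 1 / E"
      by (simp add: E_def exp_minus field_simps flip: exp_of_nat_mult)
    ultimately have small: "real N * exp (-(t/2)) ^ N \<le> 2 / t" by (simp only:)
    have "\<bar>e (real N * y)\<bar> \<le> real N ^ 3 * \<bar>y\<bar> ^ 3"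
      using e[of "real N * y"] by (simp add: abs_mult power_mult_distrib)
    then have "log_coeff N * exp (-t) ^ N * \<bar>e (real N * y)\<bar> \<le> log_coeff N * exp (-t) ^ N * (real N ^ 3 * \<bar>y\<bar> ^ 3)"
      by (intro mult_left_mono) (auto simp: log_coeff_nonneg)
    also have "\<dots> = log_coeff N * (real N ^ 2 * exp (-(t/2)) ^ N) * ((real N * exp (-(t/2)) ^ N) * \<bar>y\<bar> ^ 3)"
      unfolding half by (simp add: power2_eq_square power3_eq_cube mult_ac)
    also have "\<dots> \<le> ?b N"
      using small by (intro mult_left_mono mult_right_mono) (auto simp: log_coeff_nonneg)
    finally show ?thesis by (simp add: abs_mult log_coeff_nonneg)
  qed
  have "norm S \<le> suminf ?b"
    unfolding sums_unique[OF S] by (rule norm_suminf_le[OF bound]) (use b in \<open>simp add: sums_iff\<close>)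
  also have "suminf ?b = log_gf2 (t/2) * (2 / t * \<bar>y\<bar> ^ 3)"
    using b by (simp add: sums_iff)
  also have "\<dots> \<le> (108 * pi\<^sup>2 / t^3) * (2 / t * \<bar>y\<bar> ^ 3)"
  proof (rule mult_right_mono)
    have "(t/2)^3 * log_gf2 (t/2) \<le> 54 * (pi\<^sup>2 / 4)" using t by (intro log_gf2_le) auto
    then show "log_gf2 (t/2) \<le> 108 * pi\<^sup>2 / t^3"
      using t by (simp add: field_simps power_divide)
  qed (use t in auto)
  also have "\<dots> = 216 * pi\<^sup>2 * \<bar>y\<bar> ^ 3 / t ^ 4"
    using t by (simp add: field_simps eval_nat_numeral)
  finally show ?thesis by simp
qed

lemma gf_im_approx:
  assumes "t > 0"
  shows "\<bar>gf_im t y - log_gf1 t * y\<bar> \<le> 216 * pi\<^sup>2 * \<bar>y\<bar> ^ 3 / t ^ 4"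
proof (rule suminf_cubic_bound[OF assms])
  show "\<bar>sin x - x\<bar> \<le> \<bar>x\<bar> ^ 3" for x :: real
  proof -
    have "\<bar>sin x - x\<bar> \<le> \<bar>x\<bar> ^ 3 / 6"
      using Maclaurin_sin_bound[of x 3] by (simp add: numeral_3_eq_3 sin_coeff_def fact_numeral)
    also have "\<dots> \<le> \<bar>x\<bar> ^ 3" by simp
    finally show ?thesis .
  qed
  have "(\<lambda>N. log_coeff N * exp (-t) ^ N * sin (real N * y) - log_coeff N * (real N * exp (-t) ^ N) * y)
      sums (gf_im t y - log_gf1 t * y)"
    by (intro sums_diff sums_mult2 sums_gf_im sums_log_gf assms)
  then show "(\<lambda>N. log_coeff N * exp (-t) ^ N * (sin (real N * y) - real N * y)) sums (gf_im t y - log_gf1 t * y)"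
    by (simp add: algebra_simps)
qed

lemma gf_re_approx:
  assumes "t > 0"
  shows "\<bar>gf_re t y - log_gf2 t * (y\<^sup>2 / 2)\<bar> \<le> 216 * pi\<^sup>2 * \<bar>y\<bar> ^ 3 / t ^ 4"
proof (rule suminf_cubic_bound[OF assms])
  show "\<bar>1 - cos x - x\<^sup>2 / 2\<bar> \<le> \<bar>x\<bar> ^ 3" for x :: real
  proof -
    obtain s where "cos x = (\<Sum>m<3. cos_coeff m * x ^ m) + (cos (s + 1/2 * real 3 * pi) / fact 3) * x ^ 3"
      using Maclaurin_cos_expansion[of x 3] by blast
    moreover have "(\<Sum>m<3. cos_coeff m * x ^ m) = 1 - x\<^sup>2 / 2"
      by (simp add: numeral_3_eq_3 cos_coeff_def power2_eq_square)
    ultimately have "\<bar>1 - cos x - x\<^sup>2 / 2\<bar> = \<bar>(cos (s + 1/2 * real 3 * pi) / fact 3) * x ^ 3\<bar>" by simp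
    also have "\<dots> = \<bar>cos (s + 1/2 * real 3 * pi)\<bar> / fact 3 * \<bar>x\<bar> ^ 3"
      by (simp add: abs_mult power_abs)
    also have "\<dots> \<le> 1 * \<bar>x\<bar> ^ 3"
    proof (rule mult_right_mono)
      have "\<bar>cos (s + 1/2 * real 3 * pi)\<bar> / fact 3 \<le> 1 / fact 3"
        by (intro divide_right_mono abs_cos_le_one) simp
      also have "\<dots> \<le> 1" by (simp add: fact_numeral)
      finally show "\<bar>cos (s + 1/2 * real 3 * pi)\<bar> / fact 3 \<le> 1" .
    qed simp
    finally show ?thesis by simp
  qed
  have "(\<lambda>N. log_coeff N * exp (-t) ^ N * (1 - cos (real N * y)) - log_coeff N * (real N ^ 2 * exp (-t) ^ N) * (y\<^sup>2 / 2))
      sums (gf_re t y - log_gf2 t * (y\<^sup>2 / 2))"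
    by (intro sums_diff sums_mult2 sums_gf_re sums_log_gf assms)
  then show "(\<lambda>N. log_coeff N * exp (-t) ^ N * (1 - cos (real N * y) - (real N * y)\<^sup>2 / 2)) sums (gf_re t y - log_gf2 t * (y\<^sup>2 / 2))"
    by (simp add: algebra_simps power_mult_distrib)
qed

lemma cubic_error_tendsto_0:
  "((\<lambda>t. 216 * pi\<^sup>2 * \<bar>t * sqrt t * u\<bar> ^ 3 / t ^ 4) \<longlongrightarrow> 0) (at_right 0)"
proof -
  have "((\<lambda>t. 216 * pi\<^sup>2 * sqrt t * \<bar>u\<bar> ^ 3) \<longlongrightarrow> 216 * pi\<^sup>2 * sqrt 0 * \<bar>u\<bar> ^ 3) (at_right 0)"
    by (intro tendsto_intros)
  moreover have "eventually (\<lambda>t. 216 * pi\<^sup>2 * sqrt t * \<bar>u\<bar> ^ 3 = 216 * pi\<^sup>2 * \<bar>t * sqrt t * u\<bar> ^ 3 / t ^ 4) (at_right 0)"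
    using eventually_at_right_less[of 0]
  proof eventually_elim
    case (elim t)
    have sqrt3: "sqrt t ^ 3 = t * sqrt t" using elim by (simp add: power3_eq_cube)
    have "\<bar>t * sqrt t * u\<bar> = t * sqrt t * \<bar>u\<bar>" using elim by (simp add: abs_mult)
    then have "\<bar>t * sqrt t * u\<bar> ^ 3 = t ^ 3 * sqrt t ^ 3 * \<bar>u\<bar> ^ 3"
      by (simp only: power_mult_distrib)
    also have "\<dots> = t ^ 4 * sqrt t * \<bar>u\<bar> ^ 3"
      unfolding sqrt3 by (simp add: power3_eq_cube power4_eq_xxxx)
    finally show ?case using elim by simp
  qed
  ultimately show ?thesis by (simp add: tendsto_cong)
qed

lemma tendsto_gf_re:
  "((\<lambda>t. gf_re t (t * sqrt t * u)) \<longlongrightarrow> pi\<^sup>2 / 4 * u\<^sup>2) (at_right 0)"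
proof -
  have "((\<lambda>t. gf_re t (t * sqrt t * u) - log_gf2 t * ((t * sqrt t * u)\<^sup>2 / 2)) \<longlongrightarrow> 0) (at_right 0)"
    by (rule Lim_null_comparison[OF _ cubic_error_tendsto_0[of u]])
      (use eventually_at_right_less[of 0] in \<open>eventually_elim, use gf_re_approx in auto\<close>)
  moreover have "((\<lambda>t. t^3 * log_gf2 t * (u\<^sup>2 / 2)) \<longlongrightarrow> pi\<^sup>2 / 2 * (u\<^sup>2 / 2)) (at_right 0)"
    by (intro tendsto_intros tendsto_log_gf2)
  ultimately have "((\<lambda>t. (gf_re t (t * sqrt t * u) - log_gf2 t * ((t * sqrt t * u)\<^sup>2 / 2)) + t^3 * log_gf2 t * (u\<^sup>2 / 2))
      \<longlongrightarrow> 0 + pi\<^sup>2 / 2 * (u\<^sup>2 / 2)) (at_right 0)"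
    by (rule tendsto_add)
  moreover have "eventually (\<lambda>t. (gf_re t (t * sqrt t * u) - log_gf2 t * ((t * sqrt t * u)\<^sup>2 / 2)) + t^3 * log_gf2 t * (u\<^sup>2 / 2)
      = gf_re t (t * sqrt t * u)) (at_right 0)"
    using eventually_at_right_less[of 0]
    by eventually_elim (simp add: power_mult_distrib power2_eq_square power3_eq_cube)
  ultimately have "((\<lambda>t. gf_re t (t * sqrt t * u)) \<longlongrightarrow> 0 + pi\<^sup>2 / 2 * (u\<^sup>2 / 2)) (at_right 0)"
    by (rule Lim_transform_eventually)
  then show ?thesis by simp
qed

text \<open>At t = pi / (2 sqrt n) the coefficient pi^2 / (4 t^2) is n, so the phase of the
  integrand tends to 0. The factor t^(3/4) from \<open>log_gf1_approx\<close> has to beat 1 / sqrt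
  t.\<close>

lemma tendsto_gf_im:
  "((\<lambda>t. gf_im t (t * sqrt t * u) - pi\<^sup>2 / (4 * t\<^sup>2) * (t * sqrt t * u)) \<longlongrightarrow> 0) (at_right 0)"
proof -
  obtain C where C: "\<And>t. t > 0 \<Longrightarrow> \<bar>t\<^sup>2 * log_gf1 t - pi\<^sup>2 / 4\<bar> \<le> C * t powr (3/4)"
    using log_gf1_approx by blast
  have "((\<lambda>t. gf_im t (t * sqrt t * u) - log_gf1 t * (t * sqrt t * u)) \<longlongrightarrow> 0) (at_right 0)"
    by (rule Lim_null_comparison[OF _ cubic_error_tendsto_0[of u]])
      (use eventually_at_right_less[of 0] in \<open>eventually_elim, use gf_im_approx in auto\<close>)
  moreover have "((\<lambda>t. (log_gf1 t - pi\<^sup>2 / (4 * t\<^sup>2)) * (t * sqrt t * u)) \<longlongrightarrow> 0) (at_right 0)"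
  proof (rule Lim_null_comparison)
    show "eventually (\<lambda>t. norm ((log_gf1 t - pi\<^sup>2 / (4 * t\<^sup>2)) * (t * sqrt t * u)) \<le> C * (t powr (3/4) / sqrt t) * \<bar>u\<bar>) (at_right 0)"
      using eventually_at_right_less[of 0]
    proof eventually_elim
      case (elim t)
      have "(log_gf1 t - pi\<^sup>2 / (4 * t\<^sup>2)) * (t * sqrt t * u) = (t\<^sup>2 * log_gf1 t - pi\<^sup>2 / 4) * (u / sqrt t)"
      proof -
        have a: "t\<^sup>2 * log_gf1 t - pi\<^sup>2 / 4 = (log_gf1 t - pi\<^sup>2 / (4 * t\<^sup>2)) * (t * t)"
          using elim by (simp add: field_simps power2_eq_square)
        have b: "t * (u / sqrt t) = sqrt t * u"
          using elim by (simp add: field_simps)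
        show ?thesis unfolding a by (simp only: mult.assoc b)
      qed
      then have "norm ((log_gf1 t - pi\<^sup>2 / (4 * t\<^sup>2)) * (t * sqrt t * u)) = \<bar>t\<^sup>2 * log_gf1 t - pi\<^sup>2 / 4\<bar> * (\<bar>u\<bar> / sqrt t)"
        using elim by (simp only: real_norm_def abs_mult abs_divide) simp
      also have "\<dots> \<le> C * t powr (3/4) * (\<bar>u\<bar> / sqrt t)"
        using C[OF elim] elim by (intro mult_right_mono) auto
      finally show ?case by simp
    qed
    have "((\<lambda>t::real. t powr (3/4) / sqrt t) \<longlongrightarrow> 0) (at_right 0)" by real_asymp
    from tendsto_mult[OF tendsto_mult[OF tendsto_const[of C] this] tendsto_const[of "\<bar>u\<bar>"]]
    show "((\<lambda>t. C * (t powr (3/4) / sqrt t) * \<bar>u\<bar>) \<longlongrightarrow> 0) (at_right 0)"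
      by simp
  qed
  ultimately have "((\<lambda>t. (gf_im t (t * sqrt t * u) - log_gf1 t * (t * sqrt t * u))
      + (log_gf1 t - pi\<^sup>2 / (4 * t\<^sup>2)) * (t * sqrt t * u)) \<longlongrightarrow> 0 + 0) (at_right 0)"
    by (rule tendsto_add)
  then show ?thesis by (simp add: left_diff_distrib)
qed

section \<open>The Gaussian limit of the rescaled integral\<close>

lemma integrable_inverse_1_plus_square_lborel: "integrable lborel (\<lambda>u::real. inverse (1 + u\<^sup>2))"
  using integrable_inverse_1_plus_square by (simp add: set_integrable_def einterval_eq_UNIV)

lemma gaussian_integral: "(\<integral>u. exp (- (pi\<^sup>2 / 4 * u\<^sup>2)) \<partial>lborel) = 2 / sqrt pi"
proof -
  have "has_bochner_integral lborel (\<lambda>x::real. exp (- x\<^sup>2)) (2 *\<^sub>R (sqrt pi / 2))"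
    by (rule has_bochner_integral_even_function[OF gaussian_moment_0]) simp
  then have "(\<integral>x. exp (- (x::real)\<^sup>2) \<partial>lborel) = sqrt pi"
    by (simp add: has_bochner_integral_iff)
  moreover have "(\<integral>x. exp (- (x::real)\<^sup>2) \<partial>lborel) = \<bar>pi / 2\<bar> *\<^sub>R (\<integral>u. exp (- (0 + pi / 2 * u)\<^sup>2) \<partial>lborel)"
    by (rule lborel_integral_real_affine) simp
  moreover have "(0 + pi / 2 * u)\<^sup>2 = pi\<^sup>2 / 4 * u\<^sup>2" for u :: real
    by (simp add: power_mult_distrib power_divide)
  ultimately have "\<bar>pi / 2\<bar> *\<^sub>R (\<integral>u. exp (- (pi\<^sup>2 / 4 * u\<^sup>2)) \<partial>lborel) = sqrt pi"
    by (simp only:)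
  then have "(\<integral>u. exp (- (pi\<^sup>2 / 4 * u\<^sup>2)) \<partial>lborel) = 2 * sqrt pi / pi"
    by (simp add: field_simps)
  also have "\<dots> = 2 * sqrt pi / (sqrt pi * sqrt pi)" by simp
  also have "\<dots> = 2 / sqrt pi" by (simp del: real_sqrt_mult_self)
  finally show ?thesis .
qed

text \<open>An exact identity whose right side splits into two factors that tend to 1. The factor
  exp (pi sqrt n) arises from the two equal contributions pi^2 / (4 t) of \<open>log_gf t\<close>
  and n t. The 1/n is t^2 up to a constant: t^(3/2) from the substitution and sqrt t from the
  logarithmic term.\<close>

lemma overpartition_count_scaled_integral:
  fixes n :: nat
  assumes "n > 0"
  defines "t \<equiv> pi / (2 * sqrt (real n))"
  defines "J \<equiv> \<integral>u. exp (- gf_re t (t * sqrt t * u)) * cos (gf_im t (t * sqrt t * u) - real n * (t * sqrt t * u))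
                   * indicator {-pi..pi} (t * sqrt t * u) \<partial>lborel"
  shows "real (overpartition_count n) / (exp (pi * sqrt (real n)) / (8 * real n)) =
    exp (log_gf t - pi\<^sup>2 / (4 * t) - ln (t / (4 * pi)) / 2) * (sqrt pi / 2 * J)"
proof -
  have t: "t > 0" using assms by (simp add: t_def)
  have n_eq: "real n = pi\<^sup>2 / (4 * t\<^sup>2)"
    using assms(1) by (simp add: t_def power_divide power_mult_distrib)
  have sqrt_n: "pi * sqrt (real n) = 2 * (pi\<^sup>2 / (4 * t))"
    using assms(1) by (simp add: t_def power2_eq_square)
  define e where "e = log_gf t - pi\<^sup>2 / (4 * t) - ln (t / (4 * pi)) / 2"
  define p where "p = real (overpartition_count n)"
  have "(\<integral>y. exp (- gf_re t y) * cos (gf_im t y - real n * y) * indicator {-pi..pi} y \<partial>lborel) = (t * sqrt t) * J"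
    using lborel_integral_real_affine[of "t * sqrt t"
        "\<lambda>y. exp (- gf_re t y) * cos (gf_im t y - real n * y) * indicator {-pi..pi} y" 0] t
    by (simp add: J_def)
  with overpartition_count_integral[OF t, of n]
  have "2 * pi * p * exp (-t) ^ n = exp (log_gf t) * (t * sqrt t * J)"
    by (simp add: p_def)
  moreover have "exp (-t) ^ n = exp (- (pi\<^sup>2 / (4 * t)))"
  proof -
    have "real n * t = pi\<^sup>2 / (4 * t)"
      unfolding n_eq using t by (simp add: power2_eq_square)
    then show ?thesis by (simp flip: exp_of_nat_mult)
  qed
  moreover have "exp (log_gf t) = exp e * exp (pi\<^sup>2 / (4 * t)) * (sqrt t / (2 * sqrt pi))"
  proof -
    have "log_gf t = e + pi\<^sup>2 / (4 * t) + ln (t / (4 * pi)) / 2" by (simp add: e_def)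
    moreover have "exp (ln (t / (4 * pi)) / 2) = sqrt (t / (4 * pi))"
      using t by (simp add: ln_sqrt[symmetric])
    moreover have "sqrt (t / (4 * pi)) = sqrt t / (2 * sqrt pi)"
      by (simp add: real_sqrt_divide real_sqrt_mult)
    ultimately show ?thesis by (simp only: exp_add)
  qed
  ultimately have "2 * pi * p * exp (- (pi\<^sup>2 / (4 * t))) =
      exp e * exp (pi\<^sup>2 / (4 * t)) * (sqrt t / (2 * sqrt pi)) * (t * sqrt t * J)"
    by (simp only:)
  also have "\<dots> = exp e * exp (pi\<^sup>2 / (4 * t)) * (t\<^sup>2 * J / (2 * sqrt pi))"
    using t by (simp add: power2_eq_square)
  finally have eq: "2 * pi * p * exp (- (pi\<^sup>2 / (4 * t))) = exp e * exp (pi\<^sup>2 / (4 * t)) * (t\<^sup>2 * J / (2 * sqrt pi))" .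
  have "2 * pi * p * (exp (- (pi\<^sup>2 / (4 * t))) * exp (pi\<^sup>2 / (4 * t))) =
      2 * pi * p * exp (- (pi\<^sup>2 / (4 * t))) * exp (pi\<^sup>2 / (4 * t))"
    by (rule mult.assoc[symmetric])
  then have "2 * pi * p * (exp (- (pi\<^sup>2 / (4 * t))) * exp (pi\<^sup>2 / (4 * t))) =
      exp e * (exp (pi\<^sup>2 / (4 * t)) * exp (pi\<^sup>2 / (4 * t))) * (t\<^sup>2 * J / (2 * sqrt pi))"
    unfolding eq by (simp only: mult_ac)
  moreover have "exp (pi\<^sup>2 / (4 * t)) * exp (pi\<^sup>2 / (4 * t)) = exp (pi * sqrt (real n))"
    unfolding sqrt_n by (simp flip: exp_add)
  moreover have "exp (- (pi\<^sup>2 / (4 * t))) * exp (pi\<^sup>2 / (4 * t)) = 1" by (simp flip: exp_add)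
  ultimately have p: "2 * pi * p = exp e * exp (pi * sqrt (real n)) * (t\<^sup>2 * J / (2 * sqrt pi))"
    by simp
  define X where "X = exp (pi * sqrt (real n))"
  have "X > 0" by (simp add: X_def)
  have "p / (X / (8 * real n)) = 8 * real n * (2 * pi * p) / (2 * pi * X)"
    using \<open>X > 0\<close> by simp
  also have "\<dots> = 8 * real n * (exp e * (t\<^sup>2 * J / (2 * sqrt pi))) / (2 * pi)"
    unfolding p using \<open>X > 0\<close> by (simp add: X_def)
  also have "\<dots> = exp e * (pi * J / (2 * sqrt pi))"
    unfolding n_eq using t by (simp add: power2_eq_square field_simps)
  also have "pi * J / (2 * sqrt pi) = sqrt pi / 2 * J"
  proof -
    have "pi * J / (2 * sqrt pi) = (sqrt pi * sqrt pi) * J / (2 * sqrt pi)" by simp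
    also have "\<dots> = sqrt pi / 2 * J" by (simp del: real_sqrt_mult_self)
    finally show ?thesis .
  qed
  finally show ?thesis by (simp only: X_def p_def e_def)
qed

lemma filterlim_saddle: "filterlim (\<lambda>i. pi / (2 * sqrt (real (Suc i)))) (at_right 0) sequentially"
  by real_asymp

lemma tendsto_scaled_integral:
  defines "t \<equiv> \<lambda>i. pi / (2 * sqrt (real (Suc i)))"
  defines "s \<equiv> \<lambda>i u. exp (- gf_re (t i) (t i * sqrt (t i) * u))
      * cos (gf_im (t i) (t i * sqrt (t i) * u) - real (Suc i) * (t i * sqrt (t i) * u))
      * indicator {-pi..pi} (t i * sqrt (t i) * u)"
  shows "(\<lambda>i. \<integral>u. s i u \<partial>lborel) \<longlonglongrightarrow> 2 / sqrt pi"
proof -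
  have t0: "t i > 0" for i by (simp add: t_def)
  \<comment> \<open>The majorant is required for every index, not just eventually. The indices start
    at n = 1, where t = pi / 2.\<close>
  have t2: "t i \<le> 2" for i
  proof -
    have "t i \<le> pi / (2 * 1)"
      unfolding t_def by (intro divide_left_mono mult_left_mono) auto
    then show ?thesis using pi_less_4 by simp
  qed
  have lim: "filterlim t (at_right 0) sequentially"
    unfolding t_def by (rule filterlim_saddle)
  have n_eq: "real (Suc i) = pi\<^sup>2 / (4 * (t i)\<^sup>2)" for i
    by (simp add: t_def power_divide power_mult_distrib)
  have "(\<lambda>i. integral\<^sup>L lborel (s i)) \<longlonglongrightarrow> (\<integral>u. exp (- (pi\<^sup>2 / 4 * u\<^sup>2)) \<partial>lborel)"
  proof (rule integral_dominated_convergence[where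
        w = "\<lambda>u. (1 + 256\<^sup>2 + 512 * 108 ^ 4) * inverse (1 + u\<^sup>2)"])
    show "(\<lambda>u. exp (- (pi\<^sup>2 / 4 * u\<^sup>2))) \<in> borel_measurable lborel" by measurable
    show "s i \<in> borel_measurable lborel" for i unfolding s_def by measurable
    show "integrable lborel (\<lambda>u::real. (1 + 256\<^sup>2 + 512 * 108 ^ 4) * inverse (1 + u\<^sup>2))"
      by (intro integrable_mult_right integrable_inverse_1_plus_square_lborel)
    show "AE u in lborel. (\<lambda>i. s i u) \<longlonglongrightarrow> exp (- (pi\<^sup>2 / 4 * u\<^sup>2))"
    proof (rule AE_I2)
      fix u
      have "(\<lambda>i. gf_re (t i) (t i * sqrt (t i) * u)) \<longlonglongrightarrow> pi\<^sup>2 / 4 * u\<^sup>2"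
        by (rule filterlim_compose[OF tendsto_gf_re lim])
      moreover have "(\<lambda>i. gf_im (t i) (t i * sqrt (t i) * u) - real (Suc i) * (t i * sqrt (t i) * u)) \<longlonglongrightarrow> 0"
        unfolding n_eq by (rule filterlim_compose[OF tendsto_gf_im lim])
      ultimately have "(\<lambda>i. exp (- gf_re (t i) (t i * sqrt (t i) * u))
          * cos (gf_im (t i) (t i * sqrt (t i) * u) - real (Suc i) * (t i * sqrt (t i) * u)) * 1)
          \<longlonglongrightarrow> exp (- (pi\<^sup>2 / 4 * u\<^sup>2)) * cos 0 * 1"
        by (intro tendsto_intros)
      moreover have "eventually (\<lambda>i. exp (- gf_re (t i) (t i * sqrt (t i) * u))
          * cos (gf_im (t i) (t i * sqrt (t i) * u) - real (Suc i) * (t i * sqrt (t i) * u)) * 1 = s i u) sequentially"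
      proof -
        have "((\<lambda>x. x * sqrt x * u) \<longlongrightarrow> 0 * sqrt 0 * u) (at_right 0)"
          by (intro tendsto_intros)
        from filterlim_compose[OF this lim] have "(\<lambda>i. t i * sqrt (t i) * u) \<longlonglongrightarrow> 0" by simp
        then have "eventually (\<lambda>i. dist (t i * sqrt (t i) * u) 0 < pi) sequentially"
          by (rule tendstoD) simp
        then show ?thesis
          by eventually_elim (auto simp: s_def dist_real_def split: split_indicator)
      qed
      ultimately have "(\<lambda>i. s i u) \<longlonglongrightarrow> exp (- (pi\<^sup>2 / 4 * u\<^sup>2)) * cos 0 * 1"
        by (rule Lim_transform_eventually)
      then show "(\<lambda>i. s i u) \<longlonglongrightarrow> exp (- (pi\<^sup>2 / 4 * u\<^sup>2))" by simp
    qed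
    show "AE u in lborel. norm (s i u) \<le> (1 + 256\<^sup>2 + 512 * 108 ^ 4) * inverse (1 + u\<^sup>2)" for i
    proof (rule AE_I2)
      fix u
      show "norm (s i u) \<le> (1 + 256\<^sup>2 + 512 * 108 ^ 4) * inverse (1 + u\<^sup>2)"
      proof (cases "\<bar>t i * sqrt (t i) * u\<bar> \<le> pi")
        case True
        have "norm (s i u) \<le> exp (- gf_re (t i) (t i * sqrt (t i) * u)) * 1 * 1"
          unfolding s_def real_norm_def abs_mult by (intro mult_mono) (auto split: split_indicator)
        then show ?thesis using exp_gf_re_dominated[OF t0 t2 True] by simp
      next
        case False
        then have "t i * sqrt (t i) * u \<notin> {-pi..pi}" by auto
        then have "indicator {-pi..pi} (t i * sqrt (t i) * u) = (0::real)" by (rule indicator_simps)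
        then have "s i u = 0" unfolding s_def by (simp only: mult_zero_right)
        moreover have "0 \<le> (1 + 256\<^sup>2 + 512 * 108 ^ 4) * inverse (1 + u\<^sup>2)"
          by (intro mult_nonneg_nonneg) auto
        ultimately show ?thesis by simp
      qed
    qed
  qed
  then show ?thesis by (simp only: gaussian_integral)
qed

lemma overpartition_count_asymptotic:
  "(\<lambda>n. real (overpartition_count n)) \<sim>[at_top] (\<lambda>n. exp (pi * sqrt (real n)) / (8 * real n))"
proof (rule asymp_equivI')
  let ?q = "\<lambda>n. real (overpartition_count n) / (exp (pi * sqrt (real n)) / (8 * real n))"
  define t where "t = (\<lambda>i. pi / (2 * sqrt (real (Suc i))))"
  define s where "s = (\<lambda>i u. exp (- gf_re (t i) (t i * sqrt (t i) * u))
      * cos (gf_im (t i) (t i * sqrt (t i) * u) - real (Suc i) * (t i * sqrt (t i) * u))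
      * indicator {-pi..pi} (t i * sqrt (t i) * u))"
  have "(\<lambda>i. exp (log_gf (t i) - pi\<^sup>2 / (4 * t i) - ln (t i / (4 * pi)) / 2) * (sqrt pi / 2 * (\<integral>u. s i u \<partial>lborel)))
      \<longlonglongrightarrow> exp 0 * (sqrt pi / 2 * (2 / sqrt pi))"
  proof (intro tendsto_mult tendsto_exp tendsto_const)
    show "(\<lambda>i. log_gf (t i) - pi\<^sup>2 / (4 * t i) - ln (t i / (4 * pi)) / 2) \<longlonglongrightarrow> 0"
      unfolding t_def by (rule filterlim_compose[OF log_gf_asymptotic filterlim_saddle])
    show "(\<lambda>i. \<integral>u. s i u \<partial>lborel) \<longlonglongrightarrow> 2 / sqrt pi"
      unfolding s_def t_def by (rule tendsto_scaled_integral)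
  qed
  moreover have "?q (Suc i) = exp (log_gf (t i) - pi\<^sup>2 / (4 * t i) - ln (t i / (4 * pi)) / 2) * (sqrt pi / 2 * (\<integral>u. s i u \<partial>lborel))" for i
    unfolding s_def t_def by (rule overpartition_count_scaled_integral) simp
  ultimately have "(\<lambda>i. ?q (Suc i)) \<longlonglongrightarrow> exp 0 * (sqrt pi / 2 * (2 / sqrt pi))"
    by (simp only:)
  then have "(\<lambda>i. ?q (Suc i)) \<longlonglongrightarrow> 1" by simp
  then show "?q \<longlonglongrightarrow> 1" by (rule LIMSEQ_imp_Suc)
qed

section \<open>Equidistribution of the rank\<close>

lemma num_odd_nonoverlined_block:
  "num_odd_nonoverlined ((k, b) # replicate j (k, False) @ ys) =
     (if odd k then (if b then j else Suc j) else 0) + num_odd_nonoverlined ys"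
  by (simp add: num_odd_nonoverlined_def filter_replicate)

text \<open>What the parts below the largest contribute to zeta^rank: each part lowers the rank by
  one, and an odd part without overline by one more.\<close>

definition tail_weight :: "real \<Rightarrow> overpartition \<Rightarrow> complex" where
  "tail_weight \<theta> ys = cis (- \<theta> * real (length ys + num_odd_nonoverlined ys))"

definition odd_damping :: "real \<Rightarrow> nat \<Rightarrow> real" where
  "odd_damping \<gamma> k = (if odd k then \<gamma> else 1)"

lemma tail_weight_block:
  "tail_weight \<theta> ((k, b) # replicate j (k, False) @ ys) =
     cis (- \<theta> * real (Suc j + (if odd k then (if b then j else Suc j) else 0))) * tail_weight \<theta> ys"
  unfolding tail_weight_def num_odd_nonoverlined_block cis_mult
  by (rule arg_cong[of _ _ cis]) (simp add: algebra_simps)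

lemma norm_sum_block_weights:
  "cmod (\<Sum>b\<in>UNIV. cis (- \<theta> * real (Suc j + (if odd k then (if b then j else Suc j) else 0))))
     \<le> 2 * odd_damping (cmod (1 + cis \<theta>) / 2) k"
proof (cases "odd k")
  case True
  have "(\<Sum>b\<in>UNIV. cis (- \<theta> * real (Suc j + (if odd k then (if b then j else Suc j) else 0)))) =
      cis (- \<theta> * real (Suc j + Suc j)) * (1 + cis \<theta>)"
  proof -
    have "- \<theta> * real (Suc j + j) = - \<theta> * real (Suc j + Suc j) + \<theta>" by (simp add: algebra_simps)
    then have "cis (- \<theta> * real (Suc j + j)) = cis (- \<theta> * real (Suc j + Suc j)) * cis \<theta>"
      by (simp only: cis_mult)
    moreover have "(\<Sum>b\<in>UNIV. f b) = f False + f True" for f :: "bool \<Rightarrow> complex"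
      by (simp add: UNIV_bool)
    ultimately show ?thesis using True by (simp only: if_True if_False not_False_eq_True distrib_left mult_1_right)
  qed
  then show ?thesis using True by (simp add: norm_mult odd_damping_def)
next
  case False
  then have "cmod (\<Sum>b\<in>UNIV. cis (- \<theta> * real (Suc j + (if odd k then (if b then j else Suc j) else 0))))
      \<le> (\<Sum>b\<in>(UNIV :: bool set). 1)"
    by (intro sum_norm_le) simp
  then show ?thesis using False by (simp add: UNIV_bool odd_damping_def)
qed

lemma odd_damping_nonneg: "\<gamma> \<ge> 0 \<Longrightarrow> odd_damping \<gamma> k \<ge> 0"
  by (simp add: odd_damping_def)

lemma norm_sum_tail_weight:
  "cmod (\<Sum>ys\<in>bounded_overpartitions m n. tail_weight \<theta> ys)
     \<le> weight_count (odd_damping (cmod (1 + cis \<theta>) / 2)) m n"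
proof (induction m arbitrary: n)
  case 0
  then show ?case by (simp add: bounded_overpartitions_0 tail_weight_def num_odd_nonoverlined_def)
next
  case (Suc m)
  let ?g = "odd_damping (cmod (1 + cis \<theta>) / 2)"
  have "cmod (\<Sum>b\<in>UNIV. \<Sum>ys\<in>bounded_overpartitions m n'. tail_weight \<theta> ((Suc m, b) # replicate j (Suc m, False) @ ys))
      \<le> 2 * ?g (Suc m) * weight_count ?g m n'" for j n'
  proof -
    have "(\<Sum>b\<in>UNIV. \<Sum>ys\<in>bounded_overpartitions m n'. tail_weight \<theta> ((Suc m, b) # replicate j (Suc m, False) @ ys)) =
        (\<Sum>b\<in>UNIV. cis (- \<theta> * real (Suc j + (if odd (Suc m) then (if b then j else Suc j) else 0)))) *
        (\<Sum>ys\<in>bounded_overpartitions m n'. tail_weight \<theta> ys)"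
      unfolding tail_weight_block by (simp only: sum_product)
    also have "cmod \<dots> \<le> 2 * ?g (Suc m) * weight_count ?g m n'"
      unfolding norm_mult
      by (rule mult_mono[OF norm_sum_block_weights Suc]) (auto simp: odd_damping_nonneg)
    finally show ?thesis .
  qed
  then have "cmod (\<Sum>j | Suc j * Suc m \<le> n. \<Sum>b\<in>UNIV. \<Sum>ys\<in>bounded_overpartitions m (n - Suc j * Suc m).
      tail_weight \<theta> ((Suc m, b) # replicate j (Suc m, False) @ ys))
      \<le> (\<Sum>j | Suc j * Suc m \<le> n. 2 * ?g (Suc m) * weight_count ?g m (n - Suc j * Suc m))"
    by (intro sum_norm_le) blast
  then show ?case
    unfolding sum_bounded_overpartitions_Suc weight_count.simps sum_distrib_left
    by (intro norm_triangle_mono Suc)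
qed

text \<open>The ceiling and chi are read off the head of the list, so for a fixed block they only
  contribute a constant phase, which the modulus ignores.\<close>

lemma M2_rank_block:
  "\<exists>z. \<forall>ys. cis (\<theta> * real_of_int (M2_rank ((k, b) # replicate j (k, False) @ ys))) = cis z * tail_weight \<theta> ys"
proof -
  define z :: int where "z = \<lceil>real k / 2\<rceil> - int (Suc j) - int (if odd k then (if b then j else Suc j) else 0)
      - int (if odd k \<and> \<not> b then 1 else 0)"
  have "\<theta> * real_of_int (M2_rank ((k, b) # replicate j (k, False) @ ys)) =
      \<theta> * real_of_int z + - \<theta> * real (length ys + num_odd_nonoverlined ys)" for ys
  proof -
    have rank: "M2_rank ((k, b) # replicate j (k, False) @ ys) = z - int (length ys + num_odd_nonoverlined ys)"
      unfolding M2_rank_def num_odd_nonoverlined_block z_def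
      by (simp add: largest_part_def chi_def)
    show ?thesis unfolding rank by (simp add: algebra_simps)
  qed
  then show ?thesis unfolding tail_weight_def cis_mult by metis
qed

text \<open>
  The largest part itself gives no cancellation; replacing its weight 2 by 2 g k / \<gamma> makes the sum
  over the largest part telescope.
\<close>

lemma norm_sum_rank_bounded:
  assumes \<gamma>: "cmod (1 + cis \<theta>) / 2 = \<gamma>" "0 < \<gamma>" "\<gamma> \<le> 1"
  shows "cmod (\<Sum>xs\<in>bounded_overpartitions m n. cis (\<theta> * real_of_int (M2_rank xs)))
     \<le> weight_count (odd_damping \<gamma>) m n / \<gamma>"
proof (induction m arbitrary: n)
  case 0
  then show ?case using \<gamma> by (simp add: bounded_overpartitions_0)
next
  case (Suc m)
  let ?g = "odd_damping \<gamma>"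
  have V0: "weight_count ?g m n' \<ge> 0" for n'
    using \<gamma> by (intro weight_count_nonneg odd_damping_nonneg) auto
  have "cmod (\<Sum>b\<in>UNIV. \<Sum>ys\<in>bounded_overpartitions m n'.
        cis (\<theta> * real_of_int (M2_rank ((Suc m, b) # replicate j (Suc m, False) @ ys))))
      \<le> 2 * weight_count ?g m n'" for j n'
  proof -
    have "cmod (\<Sum>ys\<in>bounded_overpartitions m n'.
        cis (\<theta> * real_of_int (M2_rank ((Suc m, b) # replicate j (Suc m, False) @ ys)))) \<le> weight_count ?g m n'" for b
    proof -
      obtain z where z: "\<And>ys. cis (\<theta> * real_of_int (M2_rank ((Suc m, b) # replicate j (Suc m, False) @ ys)))
          = cis z * tail_weight \<theta> ys"
        using M2_rank_block[of \<theta> "Suc m" b j] by blast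
      have "cmod (\<Sum>ys\<in>bounded_overpartitions m n'.
          cis (\<theta> * real_of_int (M2_rank ((Suc m, b) # replicate j (Suc m, False) @ ys)))) =
          cmod (\<Sum>ys\<in>bounded_overpartitions m n'. tail_weight \<theta> ys)"
        unfolding z sum_distrib_left[symmetric] by (simp add: norm_mult)
      then show ?thesis using norm_sum_tail_weight[of \<theta> m n'] unfolding \<gamma>(1) by simp
    qed
    then have "cmod (\<Sum>b\<in>UNIV. \<Sum>ys\<in>bounded_overpartitions m n'.
        cis (\<theta> * real_of_int (M2_rank ((Suc m, b) # replicate j (Suc m, False) @ ys))))
        \<le> (\<Sum>b\<in>(UNIV :: bool set). weight_count ?g m n')"
      by (intro sum_norm_le) blast
    then show ?thesis by (simp add: UNIV_bool)
  qed
  also have "2 * weight_count ?g m n' \<le> 2 * ?g (Suc m) * weight_count ?g m n' / \<gamma>" for n'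
  proof -
    have "1 \<le> ?g (Suc m) / \<gamma>" using \<gamma> by (simp add: odd_damping_def field_simps)
    then have "2 * weight_count ?g m n' * 1 \<le> 2 * weight_count ?g m n' * (?g (Suc m) / \<gamma>)"
      using V0 by (intro mult_left_mono) auto
    then show ?thesis by (simp add: mult_ac)
  qed
  finally have step: "cmod (\<Sum>b\<in>UNIV. \<Sum>ys\<in>bounded_overpartitions m n'.
        cis (\<theta> * real_of_int (M2_rank ((Suc m, b) # replicate j (Suc m, False) @ ys))))
      \<le> 2 * ?g (Suc m) * weight_count ?g m n' / \<gamma>" for j n' .
  have "cmod (\<Sum>j | Suc j * Suc m \<le> n. \<Sum>b\<in>UNIV. \<Sum>ys\<in>bounded_overpartitions m (n - Suc j * Suc m).
      cis (\<theta> * real_of_int (M2_rank ((Suc m, b) # replicate j (Suc m, False) @ ys))))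
      \<le> (\<Sum>j | Suc j * Suc m \<le> n. 2 * ?g (Suc m) * weight_count ?g m (n - Suc j * Suc m) / \<gamma>)"
    by (intro sum_norm_le step)
  then show ?case
    unfolding sum_bounded_overpartitions_Suc weight_count.simps sum_distrib_left add_divide_distrib sum_divide_distrib
    by (intro norm_triangle_mono Suc)
qed

section \<open>The damped product at the saddle point\<close>

lemma product_le_exp_log_gf:
  assumes "t > 0"
  shows "(\<Prod>k=1..m. 1 + 2 * (exp (-t) ^ k / (1 - exp (-t) ^ k))) \<le> exp (log_gf t)"
proof (rule sums_le)
  show "(\<lambda>n. weight_count (\<lambda>_. 1) m n * exp (-t) ^ n) sums (\<Prod>k=1..m. 1 + 2 * (exp (-t) ^ k / (1 - exp (-t) ^ k)))"
    using sums_weight_count[of "\<lambda>_. 1" "exp (-t)" m] assms by simp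
  show "(\<lambda>n. real (overpartition_count n) * exp (-t) ^ n) sums exp (log_gf t)"
    by (rule sums_overpartition_count[OF assms])
  fix n
  have "card (bounded_overpartitions m n) \<le> overpartition_count n"
    unfolding overpartition_count_def by (intro card_mono finite_overpartitions) (auto simp: bounded_overpartitions_def)
  then show "weight_count (\<lambda>_. 1) m n * exp (-t) ^ n \<le> real (overpartition_count n) * exp (-t) ^ n"
    unfolding card_bounded_overpartitions[symmetric] by (intro mult_right_mono) auto
qed

text \<open>For one odd k and z = x^k, the damped numerator 1 - z + 2 \<gamma> z is at most (1 + z)
  (1 - (1 - \<gamma>) z), with difference (1 - \<gamma>) z (1 - z) \<ge> 0. So damping costs the
  factor at least exp (-(1 - \<gamma>) z).\<close>

lemma damped_product_le:
  assumes t: "t > 0" and \<gamma>: "0 \<le> \<gamma>" "\<gamma> \<le> 1"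
  shows "(\<Prod>k=1..m. 1 + 2 * odd_damping \<gamma> k * (exp (-t) ^ k / (1 - exp (-t) ^ k)))
    \<le> exp (log_gf t) * exp (- (1 - \<gamma>) * (\<Sum>k | k \<in> {1..m} \<and> odd k. exp (-t) ^ k))"
proof -
  define x where "x = exp (-t)"
  have x: "0 < x" "x < 1" using t by (auto simp: x_def)
  let ?d = "\<lambda>k. if odd k then x ^ k else 0"
  have "(\<Prod>k=1..m. 1 + 2 * odd_damping \<gamma> k * (x ^ k / (1 - x ^ k)))
      \<le> (\<Prod>k=1..m. (1 + 2 * (x ^ k / (1 - x ^ k))) * exp (- (1 - \<gamma>) * ?d k))"
  proof (rule prod_mono, rule conjI)
    fix k assume k: "k \<in> {1..m}"
    have xk: "0 < x ^ k" "x ^ k < 1" using x k by (auto simp: power_less_one_iff)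
    show "0 \<le> 1 + 2 * odd_damping \<gamma> k * (x ^ k / (1 - x ^ k))"
      using xk odd_damping_nonneg[OF \<gamma>(1), of k] by (intro add_nonneg_nonneg mult_nonneg_nonneg) auto
    show "1 + 2 * odd_damping \<gamma> k * (x ^ k / (1 - x ^ k)) \<le> (1 + 2 * (x ^ k / (1 - x ^ k))) * exp (- (1 - \<gamma>) * ?d k)"
    proof (cases "odd k")
      case True
      have "1 + 2 * \<gamma> * (z / (1 - z)) \<le> (1 + 2 * (z / (1 - z))) * (1 + - (1 - \<gamma>) * z)" if z: "0 < z" "z < 1" for z :: real
      proof -
        have "0 \<le> (1 - \<gamma>) * z * (1 - z)" using z \<gamma> by simp
        then have "(1 - z + 2 * \<gamma> * z) / (1 - z) \<le> (1 + z) * (1 + - (1 - \<gamma>) * z) / (1 - z)"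
          using z by (intro divide_right_mono) (auto simp: algebra_simps)
        moreover have "1 + 2 * \<gamma> * (z / (1 - z)) = (1 - z + 2 * \<gamma> * z) / (1 - z)" "1 + 2 * (z / (1 - z)) = (1 + z) / (1 - z)"
          using z by (simp_all add: field_simps)
        ultimately show ?thesis by simp
      qed
      from this[OF xk] have "1 + 2 * \<gamma> * (x ^ k / (1 - x ^ k)) \<le> (1 + 2 * (x ^ k / (1 - x ^ k))) * (1 + - (1 - \<gamma>) * x ^ k)" .
      also have "\<dots> \<le> (1 + 2 * (x ^ k / (1 - x ^ k))) * exp (- (1 - \<gamma>) * x ^ k)"
        using xk by (intro mult_left_mono exp_ge_add_one_self) auto
      finally show ?thesis using True by (simp add: odd_damping_def)
    qed (simp add: odd_damping_def)
  qed
  also have "\<dots> = (\<Prod>k=1..m. 1 + 2 * (x ^ k / (1 - x ^ k))) * exp (- (1 - \<gamma>) * (\<Sum>k=1..m. ?d k))"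
    by (simp only: prod.distrib sum_distrib_left exp_sum[OF finite_atLeastAtMost])
  also have "\<dots> \<le> exp (log_gf t) * exp (- (1 - \<gamma>) * (\<Sum>k=1..m. ?d k))"
    unfolding x_def by (intro mult_right_mono product_le_exp_log_gf t) simp
  also have "(\<Sum>k=1..m. ?d k) = (\<Sum>k | k \<in> {1..m} \<and> odd k. x ^ k)"
    by (simp add: sum.inter_filter[symmetric])
  finally show ?thesis unfolding x_def .
qed

text \<open>Only odd k up to sqrt n are kept. There t k \<le> pi/2, so each term is at least exp
  (-pi/2), and the -1 makes up for rounding their number down. This makes the saving in the exponent
  of order sqrt n.\<close>

lemma sum_odd_powers_ge:
  assumes "n > 0"
  shows "(sqrt (real n) / 2 - 1) * exp (- pi / 2) \<le>
    (\<Sum>k | k \<in> {1..n} \<and> odd k. exp (- (pi / (2 * sqrt (real n)))) ^ k)"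
proof -
  define t where "t = pi / (2 * sqrt (real n))"
  define m where "m = nat \<lfloor>sqrt (real n) / 2\<rfloor>"
  have sq: "sqrt (real n) \<ge> 1" using assms by simp
  have m: "real m \<le> sqrt (real n) / 2" "sqrt (real n) / 2 - 1 \<le> real m"
    unfolding m_def using sq by (auto simp: of_nat_nat) linarith
  have "sqrt (real n) * 1 \<le> sqrt (real n) * sqrt (real n)" using sq by (intro mult_left_mono) auto
  then have sqn: "sqrt (real n) \<le> real n" by simp
  have "(sqrt (real n) / 2 - 1) * exp (- pi / 2) \<le> real m * exp (- pi / 2)"
    using m by (intro mult_right_mono) auto
  also have "\<dots> = (\<Sum>i<m. exp (- pi / 2))" by simp
  also have "\<dots> \<le> (\<Sum>i<m. exp (-t) ^ (2 * i + 1))"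
  proof (rule sum_mono)
    fix i assume "i \<in> {..<m}"
    then have "real (2 * i + 1) \<le> sqrt (real n)" using m(1) by auto
    then have "real (2 * i + 1) * t \<le> sqrt (real n) * t"
      by (intro mult_right_mono) (auto simp: t_def)
    also have "\<dots> = pi / 2" using assms by (simp add: t_def)
    finally have "exp (- pi / 2) \<le> exp (- (real (2 * i + 1) * t))" by simp
    also have "\<dots> = exp (-t) ^ (2 * i + 1)" by (simp only: exp_of_nat_mult[symmetric] mult_minus_right)
    finally show "exp (- pi / 2) \<le> exp (-t) ^ (2 * i + 1)" .
  qed
  also have "\<dots> = (\<Sum>k\<in>(\<lambda>i. 2 * i + 1) ` {..<m}. exp (-t) ^ k)"
    by (subst sum.reindex) (auto simp: inj_on_def)
  also have "\<dots> \<le> (\<Sum>k | k \<in> {1..n} \<and> odd k. exp (-t) ^ k)"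
  proof (rule sum_mono2)
    show "(\<lambda>i. 2 * i + 1) ` {..<m} \<subseteq> {k. k \<in> {1..n} \<and> odd k}"
    proof safe
      fix i assume "i < m"
      then have "real (2 * i + 1) \<le> real n" using m(1) sqn by auto
      then show "2 * i + 1 \<in> {1..n}" by simp
    qed auto
  qed auto
  finally show ?thesis by (simp only: t_def)
qed

text \<open>A nonnegative series bounds each of its terms, here at the saddle point of the undamped
  series. This overshoots by a power of n at most, which the exponential saving absorbs.\<close>

lemma norm_rank_sum_le:
  assumes \<gamma>: "cmod (1 + cis \<theta>) / 2 = \<gamma>" "0 < \<gamma>" "\<gamma> \<le> 1" and n: "n > 0"
  shows "cmod (\<Sum>xs\<in>overpartitions n. cis (\<theta> * real_of_int (M2_rank xs)))
     \<le> exp (pi * sqrt (real n)) * exp (- ((1 - \<gamma>) * exp (- pi / 2) * (sqrt (real n) / 2 - 1))) / \<gamma>"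
proof -
  define t where "t = pi / (2 * sqrt (real n))"
  define x where "x = exp (-t)"
  define S where "S = (\<Sum>k | k \<in> {1..n} \<and> odd k. exp (-t) ^ k)"
  have t: "t > 0" using n by (simp add: t_def)
  have x: "0 < x" "x < 1" using t by (auto simp: x_def)
  let ?V = "weight_count (odd_damping \<gamma>) n"
  have nonneg: "odd_damping \<gamma> k \<ge> 0" for k using \<gamma> by (simp add: odd_damping_nonneg)
  have V: "(\<lambda>i. ?V i * x ^ i) sums (\<Prod>k=1..n. 1 + 2 * odd_damping \<gamma> k * (x ^ k / (1 - x ^ k)))"
    by (rule sums_weight_count[OF nonneg x])
  have "?V n * x ^ n \<le> (\<Prod>k=1..n. 1 + 2 * odd_damping \<gamma> k * (x ^ k / (1 - x ^ k)))"
    using sum_le_suminf[of "\<lambda>i. ?V i * x ^ i" "{n}"] V weight_count_nonneg[OF nonneg] x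
    by (simp add: sums_iff)
  also have "\<dots> \<le> exp (log_gf t) * exp (- (1 - \<gamma>) * S)"
    unfolding x_def S_def using \<gamma> by (intro damped_product_le t) auto
  also have "\<dots> \<le> exp (pi\<^sup>2 / (4 * t)) * exp (- ((1 - \<gamma>) * exp (- pi / 2) * (sqrt (real n) / 2 - 1)))"
  proof (intro mult_mono)
    have "(1 - \<gamma>) * ((sqrt (real n) / 2 - 1) * exp (- pi / 2)) \<le> (1 - \<gamma>) * S"
      unfolding S_def t_def using \<gamma> by (intro mult_left_mono sum_odd_powers_ge n) auto
    moreover have "(1 - \<gamma>) * exp (- pi / 2) * (sqrt (real n) / 2 - 1) = (1 - \<gamma>) * ((sqrt (real n) / 2 - 1) * exp (- pi / 2))"
      by (simp only: mult_ac)
    ultimately show "exp (- (1 - \<gamma>) * S) \<le> exp (- ((1 - \<gamma>) * exp (- pi / 2) * (sqrt (real n) / 2 - 1)))"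
      by (simp only: exp_le_cancel_iff mult_minus_left neg_le_iff_le)
  qed (use log_gf_le[OF t] in auto)
  finally have *: "?V n * x ^ n * exp (real n * t) \<le>
      exp (pi\<^sup>2 / (4 * t)) * exp (- ((1 - \<gamma>) * exp (- pi / 2) * (sqrt (real n) / 2 - 1))) * exp (real n * t)"
    by (intro mult_right_mono) auto
  have cancel: "x ^ n * exp (real n * t) = 1"
    by (simp add: x_def flip: exp_of_nat_mult exp_add)
  have total: "exp (pi\<^sup>2 / (4 * t)) * exp (real n * t) = exp (pi * sqrt (real n))"
  proof -
    have "pi\<^sup>2 / (4 * t) = pi * sqrt (real n) / 2" "real n * t = pi * sqrt (real n) / 2"
      using n by (simp_all add: t_def field_simps power2_eq_square)
    then show ?thesis by (simp flip: exp_add)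
  qed
  have "?V n = ?V n * x ^ n * exp (real n * t)"
    by (simp only: mult.assoc cancel mult_1_right)
  also note *
  also have "exp (pi\<^sup>2 / (4 * t)) * exp (- ((1 - \<gamma>) * exp (- pi / 2) * (sqrt (real n) / 2 - 1))) * exp (real n * t) =
      exp (pi * sqrt (real n)) * exp (- ((1 - \<gamma>) * exp (- pi / 2) * (sqrt (real n) / 2 - 1)))"
    unfolding total[symmetric] by (simp only: mult_ac)
  finally have "?V n \<le> exp (pi * sqrt (real n)) * exp (- ((1 - \<gamma>) * exp (- pi / 2) * (sqrt (real n) / 2 - 1)))" .
  then have "?V n / \<gamma> \<le> exp (pi * sqrt (real n)) * exp (- ((1 - \<gamma>) * exp (- pi / 2) * (sqrt (real n) / 2 - 1))) / \<gamma>"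
    using \<gamma> by (intro divide_right_mono) auto
  with norm_sum_rank_bounded[OF \<gamma>, of n n] show ?thesis
    by (simp add: bounded_overpartitions_eq)
qed

section \<open>Detection of residue classes by roots of unity\<close>

lemma cos_eq_1_imp_dvd:
  fixes c d :: int
  assumes "c > 0" "cos (2 * pi * real_of_int d / real_of_int c) = 1"
  shows "c dvd d"
proof -
  obtain k :: int where "2 * pi * real_of_int d / real_of_int c = real_of_int k * 2 * pi"
    using assms(2) unfolding cos_one_2pi_int by blast
  then have "real_of_int d = real_of_int (c * k)"
    using assms(1) by (simp add: field_simps)
  then have "d = c * k" by (simp only: of_int_eq_iff)
  then show ?thesis by simp
qed

lemma sum_roots_of_unity:
  fixes c d :: int
  assumes "c > 0"
  shows "(\<Sum>h<nat c. cis (2 * pi * real h / real_of_int c * real_of_int d)) = (if c dvd d then of_int c else 0)"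
proof -
  define w where "w = cis (2 * pi * real_of_int d / real_of_int c)"
  have eq: "cis (2 * pi * real h / real_of_int c * real_of_int d) = w ^ h" for h
    unfolding w_def Complex.DeMoivre by (rule arg_cong[of _ _ cis]) simp
  show ?thesis
  proof (cases "c dvd d")
    case True
    then obtain k where "d = c * k" by (rule dvdE)
    then have "w = cis (2 * pi * real_of_int k)"
      unfolding w_def using assms by (intro arg_cong[of _ _ cis]) simp
    then have "w = 1" by (simp only: cis_multiple_2pi Ints_of_int)
    with True assms show ?thesis unfolding eq by simp
  next
    case False
    then have "w \<noteq> 1"
      using cos_eq_1_imp_dvd[OF assms, of d] unfolding w_def by (auto simp: complex_eq_iff)
    moreover have "w ^ nat c = cis (2 * pi * real_of_int d)"
      unfolding w_def Complex.DeMoivre using assms by (intro arg_cong[of _ _ cis]) simp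
    then have "w ^ nat c = 1" by (simp only: cis_multiple_2pi Ints_of_int)
    ultimately show ?thesis unfolding eq using False by (simp add: sum_gp_strict)
  qed
qed

text \<open>The condition cos (2 \<theta>) \<noteq> 1 excludes zeta = 1 and zeta = -1 at once:
  otherwise c divides 2 h, hence h, as c is odd. Away from 1 there is damping, and away from -1 the
  division by \<gamma> is legitimate.\<close>

lemma norm_one_plus_cis_bounds:
  fixes c :: int and h :: nat
  assumes c: "c > 0" "odd c" and h: "0 < h" "int h < c"
  shows "0 < cmod (1 + cis (2 * pi * real h / real_of_int c)) / 2"
    and "cmod (1 + cis (2 * pi * real h / real_of_int c)) / 2 < 1"
proof -
  define \<theta> where "\<theta> = 2 * pi * real h / real_of_int c"
  have "cos (2 * \<theta>) \<noteq> 1"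
  proof
    assume "cos (2 * \<theta>) = 1"
    then have "cos (2 * pi * real_of_int (2 * int h) / real_of_int c) = 1" by (simp add: \<theta>_def mult_ac)
    from cos_eq_1_imp_dvd[OF c(1) this] have "c dvd 2 * int h" .
    moreover have "coprime c 2" using c by simp
    ultimately have "c dvd int h" by (simp add: coprime_dvd_mult_right_iff)
    then show False using h zdvd_imp_le[of c "int h"] by simp
  qed
  then have "(cos \<theta>)\<^sup>2 \<noteq> 1" by (simp add: cos_double_cos)
  then have ne: "cos \<theta> \<noteq> 1" "cos \<theta> \<noteq> -1" by auto
  have sq: "(cmod (1 + cis \<theta>))\<^sup>2 = 2 + 2 * cos \<theta>"
  proof -
    have "(cmod (1 + cis \<theta>))\<^sup>2 = (1 + cos \<theta>)\<^sup>2 + (sin \<theta>)\<^sup>2" by (simp add: cmod_power2)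
    also have "\<dots> = 1 + 2 * cos \<theta> + ((sin \<theta>)\<^sup>2 + (cos \<theta>)\<^sup>2)" by (simp add: power2_eq_square algebra_simps)
    finally show ?thesis by simp
  qed
  have "1 + cis \<theta> \<noteq> 0"
  proof
    assume "1 + cis \<theta> = 0"
    then have "2 + 2 * cos \<theta> = 0" using sq by simp
    then show False using ne(2) by simp
  qed
  then show "0 < cmod (1 + cis (2 * pi * real h / real_of_int c)) / 2" by (simp add: \<theta>_def)
  have "cos \<theta> < 1" using ne(1) by (simp add: less_le)
  then have "(cmod (1 + cis \<theta>))\<^sup>2 < 2\<^sup>2" using sq by simp
  then have "cmod (1 + cis \<theta>) < 2" by (rule power2_less_imp_less) simp
  then show "cmod (1 + cis (2 * pi * real h / real_of_int c)) / 2 < 1" by (simp add: \<theta>_def)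
qed

lemma rank_sum_negligible:
  assumes \<gamma>: "cmod (1 + cis \<theta>) / 2 = \<gamma>" "0 < \<gamma>" "\<gamma> < 1"
  shows "(\<lambda>n. cmod (\<Sum>xs\<in>overpartitions n. cis (\<theta> * real_of_int (M2_rank xs)))
            / (exp (pi * sqrt (real n)) / (8 * real n))) \<longlonglongrightarrow> 0"
proof (rule Lim_null_comparison)
  define \<delta> where "\<delta> = (1 - \<gamma>) * exp (- pi / 2)"
  have \<delta>: "\<delta> > 0" using \<gamma> by (simp add: \<delta>_def)
  show "eventually (\<lambda>n. norm (cmod (\<Sum>xs\<in>overpartitions n. cis (\<theta> * real_of_int (M2_rank xs)))
            / (exp (pi * sqrt (real n)) / (8 * real n))) \<le> 8 * real n * exp (- (\<delta> * (sqrt (real n) / 2 - 1))) / \<gamma>) sequentially"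
    using eventually_gt_at_top[of 0]
  proof eventually_elim
    case (elim n)
    define X where "X = exp (pi * sqrt (real n))"
    have X: "X > 0" by (simp add: X_def)
    have "cmod (\<Sum>xs\<in>overpartitions n. cis (\<theta> * real_of_int (M2_rank xs))) \<le> X * exp (- (\<delta> * (sqrt (real n) / 2 - 1))) / \<gamma>"
      unfolding X_def \<delta>_def using norm_rank_sum_le[OF \<gamma>(1,2) _ elim] \<gamma>(3) by simp
    then have "cmod (\<Sum>xs\<in>overpartitions n. cis (\<theta> * real_of_int (M2_rank xs))) / (X / (8 * real n))
        \<le> X * exp (- (\<delta> * (sqrt (real n) / 2 - 1))) / \<gamma> / (X / (8 * real n))"
      using X by (intro divide_right_mono) auto
    also have "\<dots> = 8 * real n * exp (- (\<delta> * (sqrt (real n) / 2 - 1))) / \<gamma>"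
      using X by simp
    finally show ?case by (simp add: X_def)
  qed
  show "(\<lambda>n. 8 * real n * exp (- (\<delta> * (sqrt (real n) / 2 - 1))) / \<gamma>) \<longlonglongrightarrow> 0"
    using \<delta> \<gamma>(2) by real_asymp
qed

text \<open>The indicator of a residue class modulo c is the average of the c-th roots of unity
  raised to rank minus a.\<close>

lemma N2_count_fourier:
  fixes a c :: int
  assumes "c > 0"
  shows "of_int c * of_nat (N2_count a c n) =
    (\<Sum>h<nat c. cis (- (2 * pi * real h / real_of_int c * real_of_int a)) *
       (\<Sum>xs\<in>overpartitions n. cis (2 * pi * real h / real_of_int c * real_of_int (M2_rank xs))))"
proof -
  have "(\<Sum>h<nat c. cis (- (2 * pi * real h / real_of_int c * real_of_int a)) *
       (\<Sum>xs\<in>overpartitions n. cis (2 * pi * real h / real_of_int c * real_of_int (M2_rank xs)))) =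
      (\<Sum>xs\<in>overpartitions n. \<Sum>h<nat c. cis (2 * pi * real h / real_of_int c * real_of_int (M2_rank xs - a)))"
    unfolding sum_distrib_left cis_mult
    by (subst sum.swap) (simp add: algebra_simps diff_divide_distrib)
  also have "\<dots> = (\<Sum>xs\<in>overpartitions n. if c dvd M2_rank xs - a then of_int c else 0)"
    unfolding sum_roots_of_unity[OF assms] ..
  also have "\<dots> = (\<Sum>xs | xs \<in> overpartitions n \<and> c dvd M2_rank xs - a. of_int c)"
    by (rule sum.inter_filter[OF finite_overpartitions, symmetric])
  also have "\<dots> = of_nat (N2_count a c n) * of_int c"
    by (simp add: N2_count_def cong_iff_dvd_diff)
  finally show ?thesis by (simp add: mult.commute)
qed

theorem theorem1p1:
  fixes a c :: int
  assumes "c \<ge> 2" and "odd c" and "0 \<le> a" and "a < c"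
  shows "((\<lambda>n::nat. real (N2_count a c n))
            \<sim>[at_top] (\<lambda>n. 1 / real_of_int c * real (overpartition_count n))) \<and>
         ((\<lambda>n::nat. 1 / real_of_int c * real (overpartition_count n))
            \<sim>[at_top] (\<lambda>n. 1 / (8 * real_of_int c * real n) * exp (pi * sqrt (real n))))"
proof -
  define G where "G = (\<lambda>n::nat. exp (pi * sqrt (real n)) / (8 * real n))"
  define H where "H = (\<lambda>h n. \<Sum>xs\<in>overpartitions n. cis (2 * pi * real h / real_of_int c * real_of_int (M2_rank xs)))"
  have c: "c > 0" using assms by simp
  have G0: "G n \<ge> 0" for n by (simp add: G_def)
  have main: "\<bar>real_of_int c * real (N2_count a c n) - real (overpartition_count n)\<bar>
      \<le> (\<Sum>h\<in>{1..<nat c}. cmod (H h n))" for n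
  proof -
    have "of_int c * of_nat (N2_count a c n) =
        (\<Sum>h<nat c. cis (- (2 * pi * real h / real_of_int c * real_of_int a)) * H h n)"
      unfolding H_def by (rule N2_count_fourier[OF c])
    \<comment> \<open>At h = 0 every weight is 1 and the inner sum counts all overpartitions; the
      other frequencies form the error.\<close>
    also have "{..<nat c} = insert 0 {1..<nat c}" using c by auto
    also have "(\<Sum>h\<in>insert 0 {1..<nat c}. cis (- (2 * pi * real h / real_of_int c * real_of_int a)) * H h n) =
        of_nat (overpartition_count n) +
        (\<Sum>h\<in>{1..<nat c}. cis (- (2 * pi * real h / real_of_int c * real_of_int a)) * H h n)"
      by (subst sum.insert) (auto simp: H_def overpartition_count_def)
    finally have "of_int c * of_nat (N2_count a c n) - of_nat (overpartition_count n) =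
        (\<Sum>h\<in>{1..<nat c}. cis (- (2 * pi * real h / real_of_int c * real_of_int a)) * H h n)" by simp
    moreover have "of_int c * of_nat (N2_count a c n) - of_nat (overpartition_count n) =
        complex_of_real (real_of_int c * real (N2_count a c n) - real (overpartition_count n))" by simp
    ultimately have "\<bar>real_of_int c * real (N2_count a c n) - real (overpartition_count n)\<bar> =
        cmod (\<Sum>h\<in>{1..<nat c}. cis (- (2 * pi * real h / real_of_int c * real_of_int a)) * H h n)"
      by (metis norm_of_real)
    also have "\<dots> \<le> (\<Sum>h\<in>{1..<nat c}. cmod (H h n))"
      by (intro sum_norm_le) (simp add: norm_mult)
    finally show ?thesis .
  qed
  have "(\<lambda>n. \<Sum>h\<in>{1..<nat c}. cmod (H h n) / G n) \<longlonglongrightarrow> (\<Sum>h\<in>{1..<nat c}. 0)"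
  proof (rule tendsto_sum)
    fix h assume "h \<in> {1..<nat c}"
    then have h: "0 < h" "int h < c" using c by auto
    show "(\<lambda>n. cmod (H h n) / G n) \<longlonglongrightarrow> 0"
      unfolding H_def G_def
      by (rule rank_sum_negligible[OF refl]) (use norm_one_plus_cis_bounds[OF c assms(2) h] in auto)
  qed
  then have err: "(\<lambda>n. (real_of_int c * real (N2_count a c n) - real (overpartition_count n)) / G n) \<longlonglongrightarrow> 0"
  proof (rule Lim_null_comparison[rotated, OF tendsto_eq_rhs])
    show "eventually (\<lambda>n. norm ((real_of_int c * real (N2_count a c n) - real (overpartition_count n)) / G n)
        \<le> (\<Sum>h\<in>{1..<nat c}. cmod (H h n) / G n)) sequentially"
    proof (rule always_eventually, rule allI)
      fix n
      show "norm ((real_of_int c * real (N2_count a c n) - real (overpartition_count n)) / G n)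
          \<le> (\<Sum>h\<in>{1..<nat c}. cmod (H h n) / G n)"
        using divide_right_mono[OF main[of n] G0[of n]] G0[of n] by (simp add: sum_divide_distrib)
    qed
  qed simp
  have pG: "(\<lambda>n. real (overpartition_count n)) \<sim>[at_top] G"
    unfolding G_def by (rule overpartition_count_asymptotic)
  \<comment> \<open>Only n = 0 is exceptional, where division by zero gives G the value 0.\<close>
  have "eventually (\<lambda>n. G n \<noteq> 0) at_top"
    using eventually_gt_at_top[of 0] by eventually_elim (simp add: G_def)
  then have pG1: "(\<lambda>n. real (overpartition_count n) / G n) \<longlonglongrightarrow> 1"
    using pG by (intro asymp_equivD_strong) (auto elim: eventually_mono)
  have "(\<lambda>n. (real_of_int c * real (N2_count a c n) - real (overpartition_count n)) / G n + real (overpartition_count n) / G n)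
      \<longlonglongrightarrow> 0 + 1"
    by (intro tendsto_add err pG1)
  then have "(\<lambda>n. real_of_int c * real (N2_count a c n) / G n) \<longlonglongrightarrow> 1"
    by (simp add: diff_divide_distrib)
  then have "(\<lambda>n. real (N2_count a c n) / (1 / real_of_int c * G n)) \<longlonglongrightarrow> 1"
    by (simp add: mult.commute)
  then have N2G: "(\<lambda>n. real (N2_count a c n)) \<sim>[at_top] (\<lambda>n. 1 / real_of_int c * G n)"
    by (rule asymp_equivI')
  have pcG: "(\<lambda>n. 1 / real_of_int c * real (overpartition_count n)) \<sim>[at_top] (\<lambda>n. 1 / real_of_int c * G n)"
    by (intro asymp_equiv_intros pG)
  have "(\<lambda>n. 1 / real_of_int c * G n) = (\<lambda>n. 1 / (8 * real_of_int c * real n) * exp (pi * sqrt (real n)))"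
    by (auto simp: G_def)
  with pcG asymp_equiv_trans[OF N2G asymp_equiv_symI[OF pcG]] show ?thesis by simp
qed

end
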